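(* Let $\omega$ be any pure translation invariant finitely correlated state on the chain with one-site algebra $\mathcal{A}=M_d(\mathbb{C})$, memory algebra $\mathcal{B}=M_b(\mathbb{C})$ and generating data $(V,\rho)$ (as described in the context), with associated density matrices $\rho_{\mathcal{A}\otimes\mathcal{B}}$ on $\mathbb{C}^d\otimes\mathbb{C}^b$ and $\rho_{[1,n]}$ on $(\mathbb{C}^d)^{\otimes n}$. Then there exist constants $C>0$ and $\mu\in(0,1)$, depending on the state but not on $n$, such that with $\epsilon(n)=C\mu^n$, for all $n\ge 1$, $$0\;\le\; E_{[\mathcal{A},\mathcal{B}]}(\rho_{\mathcal{A}\otimes\mathcal{B}})\;-\;E_{[\mathcal{A},\mathcal{A}^{\otimes n-1}]}(\rho_{[1,n]})\;\le\;\epsilon(n),$$ where $E$ denotes the entanglement of formation and $\rho_{[1,n]}$ is regarded as a bipartite state of the spin at site $1$ versus the spins at sites $2,\dots,n$.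
   Context: Pure translation invariant finitely correlated states (FCS). Let $d,b\ge1$ be integers, $\mathcal{A}=M_d(\mathbb{C})$ (observables of one spin) and $\mathcal{B}=M_b(\mathbb{C})$ (the "memory"). Translation invariant states $\omega$ on the infinite chain $\mathcal{A}_{\mathbb{Z}}$ (the quasi-local limit of the algebras $\mathcal{A}^{\otimes(2n+1)}$ of sites $[-n,n]$) are determined by the density matrices $\rho_{[1,n]}$, $n\ge1$, of $n$ consecutive spins. A pure translation invariant FCS is given by the following data: - A linear map $V:\mathbb{C}^d\otimes\mathbb{C}^b\to\mathbb{C}^b$ with $VV^\dagger=\mathbf{1}_{\mathcal{B}}$. Set $\mathbb{E}(A\otimes B)=V(A\otimes B)V^\dagger$, a unital completely positive map $\mathcal{A}\otimes\mathcal{B}\to\mathcal{B}$, and $\hat{\mathbb{E}}(B)=\mathbb{E}(\mathbf{1}_{\mathcal{A}}\otimes B)$, a unital completely positive map $\mathcal{B}\to\mathcal{B}$. - A unique, non-singular $b\times b$ density matrix $\rho$ such that $\operatorname{Tr}(\rho\,\hat{\mathbb{E}}(B))=\operatorname{Tr}(\rho B)$ for all $B\in\mathcal{B}$. - The peripheral spectrum of $\hat{\mathbb{E}}$ is trivial: up to scalars, $\mathbf{1}_{\mathcal{B}}$ is the only eigenvector of $\hat{\mathbb{E}}$ with eigenvalue of modulus $1$ (a property of pure FCS). Consequently $\hat{\mathbb{E}}^n(B)\to\operatorname{Tr}(\rho B)\mathbf{1}_{\mathcal{B}}$ exponentially fast. The associated density matrices are $\rho_{\mathcal{A}\otimes\mathcal{B}}=V^\dagger\rho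 V$ on $\mathbb{C}^d\otimes\mathbb{C}^b$ (equivalently $\operatorname{Tr}(\rho_{\mathcal{A}\otimes\mathcal{B}}\,A\otimes B)=\operatorname{Tr}(\rho\,\mathbb{E}(A\otimes B))$), and $$\rho_{[1,n]}=\operatorname{Tr}_{\mathcal{B}}(V_n^\dagger\,\rho_{\mathcal{A}\otimes\mathcal{B}}\,V_n),\qquad V_n=(\mathbf{1}_{\mathcal{A}}\otimes V)(\mathbf{1}_{\mathcal{A}^{\otimes2}}\otimes V)\cdots(\mathbf{1}_{\mathcal{A}^{\otimes n-1}}\otimes V),$$ where $V_n:(\mathbb{C}^d)^{\otimes n}\otimes\mathbb{C}^b\to\mathbb{C}^d\otimes\mathbb{C}^b$, $V_1$ is the identity, and $\operatorname{Tr}_{\mathcal{B}}$ is the partial trace over $\mathbb{C}^b$. Entanglement of formation. For a density matrix $\sigma_{12}$ of a bipartite system with observable algebra $\mathcal{X}_1\otimes\mathcal{X}_2$ (full matrix algebras), $$E_{[\mathcal{X}_1,\mathcal{X}_2]}(\sigma_{12})=\inf\sum_i p_i\,S\big(\operatorname{Tr}_{\mathcal{X}_2}(\sigma_{12}^i)\big),$$ where $S(\tau)=-\operatorname{Tr}\tau\log\tau$ (natural logarithm) and the infimum is over all convex decompositions $\sigma_{12}=\sum_i p_i\sigma_{12}^i$ into pure states $\sigma_{12}^i$ (rank-one projections). Convention: $\mathcal{A}^{\otimes0}=\mathbb{C}$. *)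

theory Defs
  imports Complex_Main "Jordan_Normal_Form.Schur_Decomposition" "Jordan_Normal_Form.DL_Rank"
begin

text \<open>
  The basis vector $e_i \otimes e_j$ of $C^m \otimes C^n$ has index $i n + j$. Under this convention
  the tensor product is strictly associative, with the leftmost factor the most significant: on
  $(C^d)^{\otimes n} \otimes C^b$, of dimension $d^n b$, site 1 comes first and the memory last.
\<close>

definition kron :: "complex mat \<Rightarrow> complex mat \<Rightarrow> complex mat" (infixr "\<otimes>\<^sub>m" 70) where
  "A \<otimes>\<^sub>m B = mat (dim_row A * dim_row B) (dim_col A * dim_col B)
     (\<lambda>(i, j). A $$ (i div dim_row B, j div dim_col B) * B $$ (i mod dim_row B, j mod dim_col B))"

definition mat_trace :: "complex mat \<Rightarrow> complex" where
  "mat_trace A = (\<Sum>i<dim_row A. A $$ (i, i))"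

text \<open>Partial trace over the second factor of $C^m \otimes C^n$.\<close>

definition ptrace2 :: "nat \<Rightarrow> nat \<Rightarrow> complex mat \<Rightarrow> complex mat" where
  "ptrace2 m n X = mat m m (\<lambda>(i, j). \<Sum>k<n. X $$ (i * n + k, j * n + k))"

definition density_mat :: "nat \<Rightarrow> complex mat \<Rightarrow> bool" where
  "density_mat n \<tau> \<longleftrightarrow> \<tau> \<in> carrier_mat n n \<and> mat_adjoint \<tau> = \<tau> \<and>
     (\<forall>v \<in> carrier_vec n. 0 \<le> Re ((\<tau> *\<^sub>v v) \<bullet>c v)) \<and> mat_trace \<tau> = 1"

definition pure_state :: "nat \<Rightarrow> complex mat \<Rightarrow> bool" where
  "pure_state n P \<longleftrightarrow> P \<in> carrier_mat n n \<and> mat_adjoint P = P \<and> P * P = P \<and> vec_space.rank n P = 1"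

definition unitary_mat :: "nat \<Rightarrow> complex mat \<Rightarrow> bool" where
  "unitary_mat n U \<longleftrightarrow> U \<in> carrier_mat n n \<and> U * mat_adjoint U = 1\<^sub>m n \<and> mat_adjoint U * U = 1\<^sub>m n"

text \<open>
  Functional calculus for Hermitian matrices, through any unitary diagonalization; the value does
  not depend on which one is used, see \<open>spectral_apply_unique\<close>.
\<close>

definition spectral_apply :: "(real \<Rightarrow> real) \<Rightarrow> complex mat \<Rightarrow> complex mat \<Rightarrow> bool" where
  "spectral_apply f A B \<longleftrightarrow> (\<exists>U x. unitary_mat (dim_row A) U \<and>
     A = U * mat_diag (dim_row A) (\<lambda>i. complex_of_real (x i)) * mat_adjoint U \<and>
     B = U * mat_diag (dim_row A) (\<lambda>i. complex_of_real (f (x i))) * mat_adjoint U)"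

definition hermitian_fun :: "(real \<Rightarrow> real) \<Rightarrow> complex mat \<Rightarrow> complex mat" where
  "hermitian_fun f A = (THE B. spectral_apply f A B)"

text \<open>
  The library's \<open>ln 0 = 0\<close> makes zero eigenvalues contribute nothing to the entropy, which is the
  usual convention $0 \log 0 = 0$.
\<close>

definition entropy :: "complex mat \<Rightarrow> real" where
  "entropy \<tau> = - Re (mat_trace (\<tau> * hermitian_fun ln \<tau>))"

definition pure_decomposition ::
    "nat \<Rightarrow> complex mat \<Rightarrow> nat \<Rightarrow> (nat \<Rightarrow> real) \<Rightarrow> (nat \<Rightarrow> complex mat) \<Rightarrow> bool" where
  "pure_decomposition N \<sigma> K p s \<longleftrightarrow>
     (\<forall>k<K. 0 \<le> p k \<and> pure_state N (s k)) \<and> (\<Sum>k<K. p k) = 1 \<and>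
     \<sigma> = mat N N (\<lambda>(i, j). \<Sum>k<K. complex_of_real (p k) * s k $$ (i, j))"

text \<open>\<open>entanglement_of_formation m n \<sigma>\<close> is for the bipartition $C^m \otimes C^n$.\<close>

definition entanglement_of_formation :: "nat \<Rightarrow> nat \<Rightarrow> complex mat \<Rightarrow> real" where
  "entanglement_of_formation m n \<sigma> =
     Inf {(\<Sum>k<K. p k * entropy (ptrace2 m n (s k))) | K p s. pure_decomposition (m * n) \<sigma> K p s}"

definition fcs_map :: "complex mat \<Rightarrow> complex mat \<Rightarrow> complex mat \<Rightarrow> complex mat" where
  "fcs_map V A B = V * (A \<otimes>\<^sub>m B) * mat_adjoint V"

definition fcs_transfer :: "nat \<Rightarrow> complex mat \<Rightarrow> complex mat \<Rightarrow> complex mat" where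
  "fcs_transfer d V B = fcs_map V (1\<^sub>m d) B"

definition invariant_density :: "nat \<Rightarrow> nat \<Rightarrow> complex mat \<Rightarrow> complex mat \<Rightarrow> bool" where
  "invariant_density d b V \<rho> \<longleftrightarrow> density_mat b \<rho> \<and>
     (\<forall>B \<in> carrier_mat b b. mat_trace (\<rho> * fcs_transfer d V B) = mat_trace (\<rho> * B))"

definition pure_fcs :: "nat \<Rightarrow> nat \<Rightarrow> complex mat \<Rightarrow> complex mat \<Rightarrow> bool" where
  "pure_fcs d b V \<rho> \<longleftrightarrow>
     1 \<le> d \<and> 1 \<le> b \<and>
     V \<in> carrier_mat b (d * b) \<and> V * mat_adjoint V = 1\<^sub>m b \<and>
     invariant_density d b V \<rho> \<and> (\<forall>\<rho>'. invariant_density d b V \<rho>' \<longrightarrow> \<rho>' = \<rho>) \<and>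
     invertible_mat \<rho> \<and>
     (\<forall>B \<in> carrier_mat b b. \<forall>z. B \<noteq> 0\<^sub>m b b \<and> cmod z = 1 \<and> fcs_transfer d V B = z \<cdot>\<^sub>m B
        \<longrightarrow> (\<exists>c. B = c \<cdot>\<^sub>m 1\<^sub>m b))"

definition rho_AB :: "complex mat \<Rightarrow> complex mat \<Rightarrow> complex mat" where
  "rho_AB V \<rho> = mat_adjoint V * \<rho> * V"

text \<open>Only the values at \<open>n \<ge> 1\<close> are meaningful; the value at 0 is a dummy.\<close>

fun V_iter :: "nat \<Rightarrow> nat \<Rightarrow> complex mat \<Rightarrow> nat \<Rightarrow> complex mat" where
  "V_iter d b V 0 = 1\<^sub>m (d * b)"
| "V_iter d b V (Suc 0) = 1\<^sub>m (d * b)"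
| "V_iter d b V (Suc (Suc n)) = V_iter d b V (Suc n) * (1\<^sub>m (d ^ Suc n) \<otimes>\<^sub>m V)"

definition rho_chain :: "nat \<Rightarrow> nat \<Rightarrow> complex mat \<Rightarrow> complex mat \<Rightarrow> nat \<Rightarrow> complex mat" where
  "rho_chain d b V \<rho> n =
     ptrace2 (d ^ n) b (mat_adjoint (V_iter d b V n) * rho_AB V \<rho> * V_iter d b V n)"

lemma mat_adjoint_carrier [simp]:
  "A \<in> carrier_mat m n \<Longrightarrow> mat_adjoint A \<in> carrier_mat n m" for A :: "complex mat"
  by (auto simp: mat_adjoint_def)

lemma kron_carrier [simp]:
  "A \<in> carrier_mat m n \<Longrightarrow> B \<in> carrier_mat k l \<Longrightarrow> A \<otimes>\<^sub>m B \<in> carrier_mat (m * k) (n * l)"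
  by (auto simp: kron_def)

lemma V_iter_carrier:
  assumes "V \<in> carrier_mat b (d * b)" "n \<ge> 1"
  shows "V_iter d b V n \<in> carrier_mat (d * b) (d ^ n * b)"
  using assms(2)
proof (induction n rule: dec_induct)
  case base
  then show ?case by simp
next
  case (step n)
  then obtain k where k: "n = Suc k"
    by (cases n) auto
  have "1\<^sub>m (d ^ n) \<otimes>\<^sub>m V \<in> carrier_mat (d ^ n * b) (d ^ n * (d * b))"
    using assms(1) by (intro kron_carrier) auto
  then have "1\<^sub>m (d ^ n) \<otimes>\<^sub>m V \<in> carrier_mat (d ^ n * b) (d ^ Suc n * b)"
    by (simp add: algebra_simps)
  moreover have "V_iter d b V (Suc n) = V_iter d b V n * (1\<^sub>m (d ^ n) \<otimes>\<^sub>m V)"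
    by (simp add: k)
  ultimately show ?case
    using step.IH by simp
qed

lemma spectral_apply_unique:
  assumes "spectral_apply f A B" "spectral_apply f A B'"
  shows "B = B'"
proof -
  define n where "n = dim_row A"
  let ?D = "\<lambda>x. mat_diag n (\<lambda>i. complex_of_real (x i))"
  obtain U x where U: "unitary_mat n U" and A: "A = U * ?D x * mat_adjoint U"
    and B: "B = U * ?D (\<lambda>i. f (x i)) * mat_adjoint U"
    using assms(1) unfolding spectral_apply_def n_def by blast
  obtain W y where W: "unitary_mat n W" and A': "A = W * ?D y * mat_adjoint W"
    and B': "B' = W * ?D (\<lambda>i. f (y i)) * mat_adjoint W"
    using assms(2) unfolding spectral_apply_def n_def by blast
  define U' where "U' = mat_adjoint U"
  define W' where "W' = mat_adjoint W"
  have c [simp]: "U \<in> carrier_mat n n" "W \<in> carrier_mat n n" "U' \<in> carrier_mat n n"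
      "W' \<in> carrier_mat n n"
    using U W by (auto simp: unitary_mat_def U'_def W'_def)
  have u: "U * U' = 1\<^sub>m n" "U' * U = 1\<^sub>m n" "W * W' = 1\<^sub>m n" "W' * W = 1\<^sub>m n"
    using U W by (auto simp: unitary_mat_def U'_def W'_def)
  define M where "M = W' * U"
  have [simp]: "M \<in> carrier_mat n n"
    unfolding M_def by (rule mult_carrier_mat[OF c(4) c(1)])
  have mc [simp]: "X * Y \<in> carrier_mat n n"
    if "X \<in> carrier_mat n n" "Y \<in> carrier_mat n n" for X Y :: "complex mat"
    using that by (rule mult_carrier_mat)
  have eq: "U * ?D g * U' = W * ?D h * W' \<longleftrightarrow> M * ?D g = ?D h * M" for g h
  proof -
    have [simp]: "?D g \<in> carrier_mat n n" "?D h \<in> carrier_mat n n" by auto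
    have "W' * (U * ?D g * U') * U = M * ?D g * (U' * U)"
      unfolding M_def by (simp add: assoc_mult_mat[of _ n n _ n _ n])
    then have 1: "W' * (U * ?D g * U') * U = M * ?D g"
      using u by (simp add: right_mult_one_mat[of _ n n] left_mult_one_mat[of _ n n])
    have "W' * (W * ?D h * W') * U = (W' * W) * ?D h * M"
      unfolding M_def by (simp add: assoc_mult_mat[of _ n n _ n _ n])
    then have 2: "W' * (W * ?D h * W') * U = ?D h * M"
      using u by (simp add: right_mult_one_mat[of _ n n] left_mult_one_mat[of _ n n])
    have 3: "W * (M * ?D g) * U' = (W * W') * (U * ?D g * U')"
      unfolding M_def by (simp add: assoc_mult_mat[of _ n n _ n _ n])
    have 4: "W * (?D h * M) * U' = W * ?D h * W' * (U * U')"
      unfolding M_def by (simp add: assoc_mult_mat[of _ n n _ n _ n])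
    from 3 4 u have 5: "W * (M * ?D g) * U' = U * ?D g * U'" "W * (?D h * M) * U' = W * ?D h * W'"
      by (simp_all add: right_mult_one_mat[of _ n n] left_mult_one_mat[of _ n n])
    show ?thesis using 1 2 5 by metis
  qed
  have com: "M * ?D x = ?D y * M"
    using A A' eq unfolding U'_def W'_def by metis
  have "M * ?D (\<lambda>i. f (x i)) = ?D (\<lambda>i. f (y i)) * M"
  proof (rule eq_matI)
    fix i j assume "i < dim_row (?D (\<lambda>i. f (y i)) * M)" "j < dim_col (?D (\<lambda>i. f (y i)) * M)"
    then have ij: "i < n" "j < n"
      by (auto simp: mat_diag_def carrier_matD[OF \<open>M \<in> carrier_mat n n\<close>])
    have "(M * ?D x) $$ (i, j) = (?D y * M) $$ (i, j)"
      using com by simp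
    then have "M $$ (i, j) * complex_of_real (x j) = complex_of_real (y i) * M $$ (i, j)"
      using ij by (simp add: mat_diag_mult_left[of _ n n] mat_diag_mult_right[of _ n n])
    then have "M $$ (i, j) = 0 \<or> x j = y i"
      by (auto simp: mult.commute)
    then show "(M * ?D (\<lambda>i. f (x i))) $$ (i, j) = (?D (\<lambda>i. f (y i)) * M) $$ (i, j)"
      using ij by (auto simp: mat_diag_mult_left[of _ n n] mat_diag_mult_right[of _ n n])
  qed (auto simp: mat_diag_def carrier_matD[OF \<open>M \<in> carrier_mat n n\<close>])
  then show ?thesis
    using B B' eq unfolding U'_def W'_def by metis
qed

lemma hermitian_fun_eq: "spectral_apply f A B \<Longrightarrow> hermitian_fun f A = B"
  unfolding hermitian_fun_def by (rule the_equality) (auto intro: spectral_apply_unique)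

end

theory Submission
  imports Defs "Jordan_Normal_Form.Spectral_Radius"
begin

text \<open>
  Split \<open>V_iter\<close> as \<open>1 \<otimes> W\<close>, where \<open>W = V (1 \<otimes> V) \<dots>\<close> maps $m = n - 1$ spins and the memory to the
  memory, \<open>W W\<^sup>* = 1\<close>. Writing \<open>X\<^sub>k\<close> for \<open>W\<close> with the memory input fixed to the \<open>k\<close>-th basis vector,
  \<open>rho_chain\<close> arises from \<open>rho_AB\<close> by the local Kraus operators \<open>X\<^sub>k\<^sup>*\<close>.

  Everything rests on one monotonicity property: if \<open>K\<^sub>k\<close> acts on the second factor and
  \<open>\<Sum> K\<^sub>k\<^sup>* K\<^sub>k \<le> C\<close>, then the entanglement of formation grows at most by the factor \<open>C\<close>.
  For the lower bound take \<open>K\<^sub>k = X\<^sub>k\<^sup>*\<close> and \<open>C = 1\<close>.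

  For the upper bound the memory is recovered from the spins. In the eigenbasis of \<open>\<rho>\<close>, the operators
  \<open>X\<^sub>k X\<^sub>l\<^sup>*\<close> are $m$-th powers of the transfer map, hence exponentially close to \<open>r\<^sub>k \<delta>\<^sub>k\<^sub>l 1\<close>, where \<open>r\<close> are
  the eigenvalues. So the \<open>X\<^sub>k\<^sup>* / \<surd>r\<^sub>k\<close> combine to an almost isometric map from memory \<open>\<otimes>\<close> auxiliary
  space into the spins. Its left inverse yields Kraus operators that map \<open>rho_chain\<close> exactly to \<open>rho_AB\<close>,
  with \<open>C = 1 / (1 - \<epsilon>)\<close> and \<open>\<epsilon>\<close> exponentially small.
\<close>

section \<open>Spectral theorem\<close>

text \<open>Estimating the entropy difference of two nearby states would bring in a continuity bound
  for the entanglement of formation. No such bound is used: where the Gram error is below the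
  threshold, local operations carry each of \<open>rho_AB\<close> and \<open>rho_chain\<close>
  exactly onto the other. The approximation enters only through the norm of the recovery operators,
  hence as a factor \<open>C\<close> multiplying the entanglement. Monotonicity tolerates this
  factor because Klein's bound is linear in the weights and the coefficients
  \<open>- ln (x j)\<close> are nonnegative. Exactness comes from the factorisation
  \<open>T\<^sup>* (rho_AB \<otimes> diag r) T\<close> of the chain state, an identity for every
  length; only the orthonormality of the rows of \<open>T\<close> is approximate. The eigenbasis of
  \<open>\<rho>\<close> makes the limiting Gram matrix diagonal, and invertibility of
  \<open>\<rho>\<close> permits division by the square roots of its eigenvalues. The Gram matrix has
  the fixed size \<open>b * b\<close>, so entrywise decay controls its inverse uniformly in the
  length of the chain.\<close>

lemma mat_mult_entry:
  fixes A B :: "'a :: semiring_0 mat"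
  assumes "A \<in> carrier_mat n m" "B \<in> carrier_mat m k" "i < n" "j < k"
  shows "(A * B) $$ (i, j) = (\<Sum>l<m. A $$ (i, l) * B $$ (l, j))"
  using assms by (auto simp: scalar_prod_def atLeast0LessThan intro!: sum.cong)

lemma mat_adjoint_entry:
  fixes A :: "complex mat"
  assumes "A \<in> carrier_mat n m" "i < m" "j < n"
  shows "mat_adjoint A $$ (i, j) = cnj (A $$ (j, i))"
  using assms by (auto simp: mat_adjoint_def mat_of_rows_def)

lemma mat_adjoint_dim [simp]:
  "dim_row (mat_adjoint A) = dim_col A" "dim_col (mat_adjoint A) = dim_row A" for A :: "complex mat"
  by (auto simp: mat_adjoint_def)

lemma mat_adjoint_adjoint: "mat_adjoint (mat_adjoint A) = A" for A :: "complex mat"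
  by (rule eq_matI) (auto simp: mat_adjoint_entry[of _ "dim_col A" "dim_row A"] mat_adjoint_entry[of _ "dim_row A" "dim_col A"])

lemma mat_adjoint_mult:
  fixes A B :: "complex mat"
  assumes "A \<in> carrier_mat n m" "B \<in> carrier_mat m k"
  shows "mat_adjoint (A * B) = mat_adjoint B * mat_adjoint A"
  using assms
  by (intro eq_matI)
    (auto simp: mat_adjoint_entry[of _ n k] mat_adjoint_entry[of _ m k] mat_adjoint_entry[of _ n m]
      mat_mult_entry[of _ n m _ k] mat_mult_entry[of _ k m _ n] mult.commute
      simp del: index_mult_mat(1) intro!: sum.cong)

lemma unitary_matD:
  assumes "unitary_mat n U"
  shows "U \<in> carrier_mat n n" "mat_adjoint U \<in> carrier_mat n n"
    and "i < n \<Longrightarrow> j < n \<Longrightarrow> (\<Sum>k<n. cnj (U $$ (k, i)) * U $$ (k, j)) = of_bool (i = j)"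
    and "i < n \<Longrightarrow> j < n \<Longrightarrow> (\<Sum>k<n. U $$ (i, k) * cnj (U $$ (j, k))) = of_bool (i = j)"
proof -
  show U: "U \<in> carrier_mat n n" "mat_adjoint U \<in> carrier_mat n n"
    using assms by (auto simp: unitary_mat_def)
  show "(\<Sum>k<n. cnj (U $$ (k, i)) * U $$ (k, j)) = of_bool (i = j)" if "i < n" "j < n"
  proof -
    have "(mat_adjoint U * U) $$ (i, j) = of_bool (i = j)"
      using assms that by (auto simp: unitary_mat_def)
    then show ?thesis
      using that U by (simp add: mat_mult_entry[of _ n n _ n] mat_adjoint_entry[of _ n n] del: index_mult_mat)
  qed
  show "(\<Sum>k<n. U $$ (i, k) * cnj (U $$ (j, k))) = of_bool (i = j)" if "i < n" "j < n"
  proof -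
    have "(U * mat_adjoint U) $$ (i, j) = of_bool (i = j)"
      using assms that by (auto simp: unitary_mat_def)
    then show ?thesis
      using that U by (simp add: mat_mult_entry[of _ n n _ n] mat_adjoint_entry[of _ n n] del: index_mult_mat)
  qed
qed

lemma unitary_matI:
  assumes U: "U \<in> carrier_mat n n"
    and "\<And>i j. i < n \<Longrightarrow> j < n \<Longrightarrow> (\<Sum>k<n. cnj (U $$ (k, i)) * U $$ (k, j)) = of_bool (i = j)"
  shows "unitary_mat n U"
proof -
  have U': "mat_adjoint U \<in> carrier_mat n n"
    using U by simp
  have "mat_adjoint U * U = 1\<^sub>m n"
    using U U' assms(2)
    by (intro eq_matI)
      (simp_all add: mat_mult_entry[of _ n n _ n] mat_adjoint_entry[of _ n n] del: index_mult_mat(1))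
  then show ?thesis
    using U mat_mult_left_right_inverse[OF U' U] by (auto simp: unitary_mat_def)
qed

lemma unitary_mat_mult:
  assumes "unitary_mat n U" "unitary_mat n W"
  shows "unitary_mat n (U * W)"
proof -
  note U = unitary_matD(1,2)[OF assms(1)] and W = unitary_matD(1,2)[OF assms(2)]
  have "mat_adjoint (U * W) * (U * W) = mat_adjoint W * (mat_adjoint U * U) * W"
    using U W by (simp add: mat_adjoint_mult[OF U(1) W(1)] assoc_mult_mat[of _ n n _ n _ n] mult_carrier_mat[of _ n n _ n])
  also have "\<dots> = 1\<^sub>m n"
    using assms W by (simp add: unitary_mat_def)
  finally have 1: "mat_adjoint (U * W) * (U * W) = 1\<^sub>m n" .
  have "U * W \<in> carrier_mat n n"
    using U W by simp
  then show ?thesis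
    using 1 mat_mult_left_right_inverse[of "mat_adjoint (U * W)" n "U * W"] by (auto simp: unitary_mat_def)
qed

text \<open>Gram-Schmidt applied to a basis starting with \<open>v\<close> leaves \<open>v\<close>
  in first place. Its output is orthogonal but not normalised, so the columns are divided by their
  norms. The scalar \<open>c\<close> absorbs this, since deflation needs only the direction of
  \<open>v\<close>.\<close>

lemma unitary_mat_with_first_col:
  fixes v :: "complex vec"
  assumes v: "v \<in> carrier_vec n" "v \<noteq> 0\<^sub>v n" and n: "0 < n"
  obtains W c where "unitary_mat n W" "\<And>i. i < n \<Longrightarrow> W $$ (i, 0) = c * v $ i"
proof -
  interpret cof_vec_space n "TYPE(complex)" .
  define bs where "bs = basis_completion v"
  from basis_completion[OF v, folded bs_def]
  have dist_b: "distinct bs" and indep: "\<not> lin_dep (set bs)" and b: "set bs \<subseteq> carrier_vec n"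
    and hdb: "hd bs = v" and len_b: "length bs = n" by auto
  from hdb len_b n obtain vs where bv: "bs = v # vs" by (cases bs) auto
  define ws where "ws = gram_schmidt n bs"
  from gram_schmidt_result[OF b dist_b indep refl, folded ws_def]
  have ws: "set ws \<subseteq> carrier_vec n" "corthogonal ws" "length ws = n"
    by (auto simp: len_b)
  from gram_schmidt_hd[OF v(1), of vs, folded bv] have hdws: "hd ws = v"
    unfolding ws_def .
  have wc: "ws ! i \<in> carrier_vec n" if "i < n" for i
    using ws that by auto
  have orth: "(ws ! i) \<bullet>c (ws ! j) = 0 \<longleftrightarrow> i \<noteq> j" if "i < n" "j < n" for i j
    using corthogonalD[OF ws(2)] that ws(3) by auto
  define N where "N i = (\<Sum>k<n. (cmod (ws ! i $ k))\<^sup>2)" for i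
  have ip: "(ws ! i) \<bullet>c (ws ! j) = (\<Sum>k<n. ws ! i $ k * cnj (ws ! j $ k))" if "i < n" "j < n" for i j
    using wc[OF that(1)] wc[OF that(2)]
    by (auto simp: scalar_prod_def atLeast0LessThan intro!: sum.cong)
  have ipN: "(\<Sum>k<n. ws ! i $ k * cnj (ws ! i $ k)) = complex_of_real (N i)" for i
    by (simp add: N_def complex_norm_square[symmetric] del: of_real_power)
  have N: "N i > 0" if "i < n" for i
  proof -
    have "N i \<noteq> 0"
      using orth[OF that that] ip[OF that that] ipN[of i] by auto
    moreover have "N i \<ge> 0"
      by (auto simp: N_def intro: sum_nonneg)
    ultimately show ?thesis by simp
  qed
  define W where "W = mat n n (\<lambda>(i, j). ws ! j $ i / complex_of_real (sqrt (N j)))"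
  have "unitary_mat n W"
  proof (rule unitary_matI)
    show "W \<in> carrier_mat n n" by (simp add: W_def)
    fix i j assume ij: "i < n" "j < n"
    have "(\<Sum>k<n. cnj (W $$ (k, i)) * W $$ (k, j))
        = (\<Sum>k<n. ws ! j $ k * cnj (ws ! i $ k)) / complex_of_real (sqrt (N i) * sqrt (N j))"
      using ij by (simp add: W_def sum_divide_distrib mult.commute)
    also have "\<dots> = of_bool (i = j)"
    proof (cases "i = j")
      case True
      then show ?thesis using N[OF ij(1)] by (simp add: ipN flip: of_real_mult)
    next
      case False
      then show ?thesis using orth[OF ij(2) ij(1)] ip[OF ij(2) ij(1)] by auto
    qed
    finally show "(\<Sum>k<n. cnj (W $$ (k, i)) * W $$ (k, j)) = of_bool (i = j)" .
  qed
  moreover have "W $$ (i, 0) = (1 / complex_of_real (sqrt (N 0))) * v $ i" if "i < n" for i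
  proof -
    have "ws ! 0 = v"
      using hdws ws(3) n by (metis hd_conv_nth length_greater_0_conv)
    then show ?thesis using that n by (simp add: W_def)
  qed
  ultimately show ?thesis using that by blast
qed

lemma complex_mat_has_eigenvector:
  fixes A :: "complex mat"
  assumes A: "A \<in> carrier_mat n n" and n: "0 < n"
  obtains v e where "v \<in> carrier_vec n" "v \<noteq> 0\<^sub>v n" "A *\<^sub>v v = e \<cdot>\<^sub>v v"
proof -
  have "spectrum A \<noteq> {}"
    using spectrum_non_empty[OF A] n by auto
  then obtain e where "eigenvalue A e"
    by (auto simp: spectrum_def)
  then show ?thesis
    using that A by (auto simp: eigenvalue_def eigenvector_def)
qed

lemma diag_conj_entry:
  assumes "U \<in> carrier_mat n n" "i < n" "j < n"
  shows "(U * mat_diag n f * mat_adjoint U) $$ (i, j) = (\<Sum>k<n. U $$ (i, k) * f k * cnj (U $$ (j, k)))"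
  using assms
  by (simp add: mat_mult_entry[of _ n n _ n] mat_adjoint_entry[of _ n n] mat_diag_mult_right[of _ n n]
      del: index_mult_mat)

text \<open>Deflation: in an orthonormal basis starting with an eigenvector the first column is
  cleared below the diagonal, and hermiticity clears the first row as well. The remaining block is
  Hermitian of size \<open>n\<close>, and the induction hypothesis diagonalises it.\<close>

lemma hermitian_diagonalize:
  fixes A :: "complex mat"
  assumes "A \<in> carrier_mat n n" "mat_adjoint A = A"
  shows "\<exists>U x. unitary_mat n U \<and> A = U * mat_diag n (\<lambda>i. complex_of_real (x i)) * mat_adjoint U"
  using assms
proof (induction n arbitrary: A)
  case 0
  then show ?case
    by (intro exI[of _ "1\<^sub>m 0"]) (auto simp: unitary_mat_def intro!: eq_matI)
next
  case (Suc n)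
  let ?N = "Suc n"
  note A = Suc.prems(1)
  obtain v e where v: "v \<in> carrier_vec ?N" "v \<noteq> 0\<^sub>v ?N" and ev: "A *\<^sub>v v = e \<cdot>\<^sub>v v"
    using complex_mat_has_eigenvector[OF A] by auto
  obtain W c where W: "unitary_mat ?N W" and W0: "\<And>i. i < ?N \<Longrightarrow> W $$ (i, 0) = c * v $ i"
    using unitary_mat_with_first_col[OF v] by auto
  note Wc = unitary_matD(1,2)[OF W]
  define A' where "A' = mat_adjoint W * (A * W)"
  have A'c: "A' \<in> carrier_mat ?N ?N"
    using A Wc by (simp add: A'_def mult_carrier_mat[of _ ?N ?N _ ?N])
  have A'h: "mat_adjoint A' = A'"
    using A Wc Suc.prems(2)
    by (simp add: A'_def mat_adjoint_mult[of _ ?N ?N _ ?N] mat_adjoint_adjoint assoc_mult_mat[of _ ?N ?N _ ?N _ ?N]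
        mult_carrier_mat[of _ ?N ?N _ ?N])
  have AW0: "(A * W) $$ (i, 0) = e * W $$ (i, 0)" if "i < ?N" for i
  proof -
    have "(\<Sum>k<?N. A $$ (i, k) * v $ k) = e * v $ i"
      using arg_cong[OF ev, of "\<lambda>w. w $ i"] A v that
      by (simp add: scalar_prod_def atLeast0LessThan del: sum.lessThan_Suc)
    then show ?thesis
      using A Wc that W0
      by (simp add: mat_mult_entry[of _ ?N ?N _ ?N] mult.left_commute[of _ c] sum_distrib_left[symmetric]
          del: sum.lessThan_Suc index_mult_mat)
  qed
  have A'0: "A' $$ (i, 0) = e * of_bool (i = 0)" if "i < ?N" for i
  proof -
    have "A' $$ (i, 0) = (\<Sum>k<?N. cnj (W $$ (k, i)) * (A * W) $$ (k, 0))"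
      using A Wc that
      by (simp add: A'_def mat_mult_entry[of _ ?N ?N "A * W" ?N] mat_adjoint_entry[of _ ?N ?N]
          del: sum.lessThan_Suc index_mult_mat)
    also have "\<dots> = e * (\<Sum>k<?N. cnj (W $$ (k, i)) * W $$ (k, 0))"
      by (simp add: AW0 sum_distrib_left mult.left_commute del: sum.lessThan_Suc index_mult_mat)
    finally show ?thesis
      using unitary_matD(3)[OF W that, of 0] by (simp del: sum.lessThan_Suc)
  qed
  have A'sym: "A' $$ (i, j) = cnj (A' $$ (j, i))" if "i < ?N" "j < ?N" for i j
    using arg_cong[OF A'h, of "\<lambda>M. M $$ (i, j)"] mat_adjoint_entry[OF A'c that] by simp
  define A3 where "A3 = mat n n (\<lambda>(i, j). A' $$ (Suc i, Suc j))"
  have "A3 \<in> carrier_mat n n" "mat_adjoint A3 = A3"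
    using A'sym[symmetric] by (auto simp: A3_def mat_adjoint_entry[of _ n n])
  from Suc.IH[OF this] obtain U3 x3 where U3: "unitary_mat n U3"
    and A3: "A3 = U3 * mat_diag n (\<lambda>i. complex_of_real (x3 i)) * mat_adjoint U3"
    by blast
  \<comment> \<open>The block sum of the 1 by 1 identity and \<open>U3\<close>; it leaves the
    split-off eigenvector alone.\<close>
  define U where "U = mat ?N ?N (\<lambda>(i, j). if i = 0 \<or> j = 0 then of_bool (i = j) else U3 $$ (i - 1, j - 1))"
  define x where "x i = (if i = 0 then Re e else x3 (i - 1))" for i
  have Uc: "U \<in> carrier_mat ?N ?N" by (simp add: U_def)
  have U00: "U $$ (0, 0) = 1" and U0S: "\<And>k. k < n \<Longrightarrow> U $$ (0, Suc k) = 0"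
    and US0: "\<And>k. k < n \<Longrightarrow> U $$ (Suc k, 0) = 0"
    and USS: "\<And>k l. k < n \<Longrightarrow> l < n \<Longrightarrow> U $$ (Suc k, Suc l) = U3 $$ (k, l)"
    by (auto simp: U_def)
  have U: "unitary_mat ?N U"
  proof (rule unitary_matI[OF Uc])
    fix i j assume ij: "i < ?N" "j < ?N"
    show "(\<Sum>k<?N. cnj (U $$ (k, i)) * U $$ (k, j)) = of_bool (i = j)"
    proof (cases i)
      case 0
      then show ?thesis
        using ij by (cases j) (auto simp: sum.lessThan_Suc_shift U00 U0S US0 simp del: sum.lessThan_Suc)
    next
      case (Suc i')
      then show ?thesis
        using ij unitary_matD(3)[OF U3]
        by (cases j) (auto simp: sum.lessThan_Suc_shift U00 U0S US0 USS simp del: sum.lessThan_Suc)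
    qed
  qed
  \<comment> \<open>\<open>e\<close> is a diagonal entry of the Hermitian matrix \<open>A'\<close>,
    so storing only \<open>Re e\<close> in \<open>x\<close> loses nothing.\<close>
  have e: "e = complex_of_real (Re e)"
  proof -
    have "e = cnj e"
      using A'sym[of 0 0] A'0[of 0] by simp
    then show ?thesis by (auto simp: complex_eq_iff)
  qed
  have A': "A' = U * mat_diag ?N (\<lambda>i. complex_of_real (x i)) * mat_adjoint U"
  proof (rule eq_matI)
    fix i j
    assume "i < dim_row (U * mat_diag ?N (\<lambda>i. complex_of_real (x i)) * mat_adjoint U)"
      "j < dim_col (U * mat_diag ?N (\<lambda>i. complex_of_real (x i)) * mat_adjoint U)"
    then have ij: "i < ?N" "j < ?N" using Uc by auto
    have "A' $$ (i, j) = (\<Sum>k<?N. U $$ (i, k) * complex_of_real (x k) * cnj (U $$ (j, k)))"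
    proof (cases i)
      case 0
      then show ?thesis
        using ij A'sym[of i j] A'0[of j] e
        by (cases j) (auto simp: sum.lessThan_Suc_shift U00 U0S US0 USS x_def simp del: sum.lessThan_Suc)
    next
      case (Suc i')
      show ?thesis
      proof (cases j)
        case 0
        then show ?thesis
          using ij Suc A'0[of i]
          by (auto simp: sum.lessThan_Suc_shift U00 U0S US0 USS x_def simp del: sum.lessThan_Suc)
      next
        case (Suc j')
        have "A' $$ (i, j) = A3 $$ (i', j')"
          using ij Suc \<open>i = Suc i'\<close> by (simp add: A3_def)
        also have "\<dots> = (\<Sum>k<n. U3 $$ (i', k) * complex_of_real (x3 k) * cnj (U3 $$ (j', k)))"
          unfolding A3 using ij Suc \<open>i = Suc i'\<close> unitary_matD(1)[OF U3] by (subst diag_conj_entry) auto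
        finally show ?thesis
          using ij Suc \<open>i = Suc i'\<close>
          by (auto simp: sum.lessThan_Suc_shift U00 U0S US0 USS x_def simp del: sum.lessThan_Suc)
      qed
    qed
    then show "A' $$ (i, j) = (U * mat_diag ?N (\<lambda>i. complex_of_real (x i)) * mat_adjoint U) $$ (i, j)"
      using diag_conj_entry[OF Uc ij] by simp
  qed (use A'c Uc in auto)
  define D where "D = mat_diag ?N (\<lambda>i. complex_of_real (x i))"
  have D: "D \<in> carrier_mat ?N ?N" by (simp add: D_def)
  have U'c: "mat_adjoint U \<in> carrier_mat ?N ?N" using Uc by simp
  have "A = (W * mat_adjoint W) * A * (W * mat_adjoint W)"
    using W A by (simp add: unitary_mat_def)
  also have "\<dots> = W * A' * mat_adjoint W"
    using A Wc by (simp add: A'_def assoc_mult_mat[of _ ?N ?N _ ?N _ ?N]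
        mult_carrier_mat[of _ ?N ?N _ ?N])
  also have "\<dots> = (W * U) * D * mat_adjoint (W * U)"
    using A' Wc Uc U'c D unfolding D_def[symmetric]
    by (simp add: mat_adjoint_mult[of _ ?N ?N _ ?N] assoc_mult_mat[of _ ?N ?N _ ?N _ ?N]
        mult_carrier_mat[of _ ?N ?N _ ?N])
  finally show ?case
    using unitary_mat_mult[OF W U] unfolding D_def by blast
qed

section \<open>Pure states and entropy\<close>

context vec_space begin

lemma in_span_singleton:
  assumes "w \<in> carrier_vec n" "u \<in> span {w}"
  shows "\<exists>c. u = c \<cdot>\<^sub>v w"
proof -
  obtain a where "u = lincomb a {w}"
    using assms finite_in_span[of "{w}" u] by auto
  then show ?thesis
    using assms by (intro exI[of _ "a w"]) (simp add: lincomb_def)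
qed

lemma lin_indpt_singleton:
  assumes "w \<in> carrier_vec n" "w \<noteq> 0\<^sub>v n"
  shows "lin_indpt {w}"
  using assms lindep_span[of "{w}"] by (auto simp: span_empty)

text \<open>A maximal independent set of columns has one element \<open>w\<close>, and maximality
  puts every other column into its span. The coefficient \<open>f\<close> depends on the column as a
  vector because \<open>cols\<close> is used as a set.\<close>

lemma rank_1_cols:
  assumes A: "A \<in> carrier_mat n nc" and r: "rank A = 1"
  obtains w f where "w \<in> carrier_vec n" "w \<noteq> 0\<^sub>v n" "\<And>u. u \<in> set (cols A) \<Longrightarrow> u = f u \<cdot>\<^sub>v w"
proof -
  let ?P = "\<lambda>T. T \<subseteq> set (cols A) \<and> lin_indpt T"
  have C: "set (cols A) \<subseteq> carrier_vec n"
    using A cols_dim by blast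
  have "lin_indpt {}"
    by (simp add: lin_dep_def)
  then obtain S where S: "finite S" "maximal S ?P"
    using maximal_exists_superset[of "set (cols A)" ?P "{}"] by auto
  then have "card S = 1"
    using rank_card_indpt[OF A S(2)] r by simp
  then obtain w where w: "S = {w}"
    by (auto simp: card_1_singleton_iff)
  have wS: "w \<in> set (cols A)" "lin_indpt {w}"
    using S(2) unfolding maximal_def w by auto
  have wc: "w \<in> carrier_vec n" using wS C by auto
  have "\<exists>c. u = c \<cdot>\<^sub>v w" if u: "u \<in> set (cols A)" for u
  proof (cases "u = w")
    case True
    then show ?thesis by (intro exI[of _ 1]) auto
  next
    case False
    have "\<not> ?P {w, u}"
      using S(2) False unfolding maximal_def w by (metis insertCI singletonD subset_insertI insert_subset)
    then have "lin_dep (insert u {w})"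
      using u wS by (auto simp: insert_commute)
    then have "u \<in> span {w}"
      using lin_dep_iff_in_span[of "{w}" u] u C wc wS False by auto
    then show ?thesis
      using in_span_singleton[OF wc] by blast
  qed
  then obtain f where "\<And>u. u \<in> set (cols A) \<Longrightarrow> u = f u \<cdot>\<^sub>v w"
    by metis
  moreover have "w \<noteq> 0\<^sub>v n"
    using wS vs_zero_lin_dep[of "{w}"] wc by auto
  ultimately show ?thesis using that wc by blast
qed

lemma rank_pos:
  assumes A: "A \<in> carrier_mat n nc" and w: "w \<in> set (cols A)" "w \<noteq> 0\<^sub>v n"
  shows "rank A \<ge> 1"
proof -
  have "w \<in> carrier_vec n" using A w cols_dim by blast
  then show ?thesis
    using rank_ge_card_indpt[OF A, of "{w}"] w lin_indpt_singleton by auto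
qed

end

text \<open>The operator \<open>|v><v|\<close>, a projection when \<open>v\<close> is a unit vector.
  Amplitudes are plain functions, which makes reindexing free of carrier conditions.\<close>

definition proj_mat :: "nat \<Rightarrow> (nat \<Rightarrow> complex) \<Rightarrow> complex mat" where
  "proj_mat N v = mat N N (\<lambda>(i, j). v i * cnj (v j))"

lemma pure_state_proj_mat:
  assumes v: "(\<Sum>i<N. (cmod (v i))\<^sup>2) = 1"
  shows "pure_state N (proj_mat N v)"
proof -
  interpret vec_space "TYPE(complex)" N .
  let ?P = "proj_mat N v"
  have P: "?P \<in> carrier_mat N N" by (simp add: proj_mat_def)
  have 1: "(\<Sum>i<N. cnj (v i) * v i) = 1"
    using arg_cong[OF v, of complex_of_real] by (simp add: complex_norm_square mult.commute del: of_real_power)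
  have "mat_adjoint ?P = ?P"
    using P by (intro eq_matI) (auto simp: mat_adjoint_entry[of _ N N] proj_mat_def)
  moreover have "?P * ?P = ?P"
  proof (rule eq_matI)
    fix i j assume "i < dim_row ?P" "j < dim_col ?P"
    then have ij: "i < N" "j < N" by (auto simp: proj_mat_def)
    have "(?P * ?P) $$ (i, j) = (\<Sum>k<N. v i * cnj (v j) * (cnj (v k) * v k))"
      using ij unfolding mat_mult_entry[OF P P ij] by (auto simp: proj_mat_def intro!: sum.cong)
    then show "(?P * ?P) $$ (i, j) = ?P $$ (i, j)"
      using ij 1 by (simp add: sum_distrib_left[symmetric] proj_mat_def)
  qed (auto simp: proj_mat_def)
  moreover have "rank ?P = 1"
  proof (rule antisym)
    show "rank ?P \<le> 1"
      by (rule rank_le_1_product_entries[OF P, of v "\<lambda>j. cnj (v j)"]) (auto simp: proj_mat_def)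
    have "\<exists>j<N. v j \<noteq> 0"
    proof (rule ccontr)
      assume "\<not> ?thesis"
      then have "(\<Sum>i<N. (cmod (v i))\<^sup>2) = 0" by (intro sum.neutral) auto
      then show False using v by simp
    qed
    then obtain j where j: "j < N" "v j \<noteq> 0" by blast
    have "col ?P j \<noteq> 0\<^sub>v N"
    proof
      assume "col ?P j = 0\<^sub>v N"
      then have "col ?P j $ j = 0" using j by simp
      then show False using j by (simp add: proj_mat_def)
    qed
    moreover have "col ?P j \<in> set (cols ?P)"
      using j P by (auto simp: cols_def)
    ultimately show "1 \<le> rank ?P"
      using rank_pos[OF P] by blast
  qed
  ultimately show ?thesis
    using P by (simp add: pure_state_def)
qed

text \<open>Rank one gives entries \<open>g j * w $ i\<close>. Since \<open>P\<close> is Hermitian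
  and idempotent, it equals its product with its own adjoint, which removes the dependence on
  \<open>g\<close> except for the squared norm \<open>s\<close>; rescaling \<open>w\<close> by
  \<open>sqrt s\<close> yields \<open>v\<close>.\<close>

lemma pure_stateE:
  assumes "pure_state N P"
  obtains v where "P = proj_mat N v" "(\<Sum>i<N. (cmod (v i))\<^sup>2) = 1"
proof -
  interpret vec_space "TYPE(complex)" N .
  have P: "P \<in> carrier_mat N N" and h: "mat_adjoint P = P" and i: "P * P = P" and r: "rank P = 1"
    using assms by (auto simp: pure_state_def)
  obtain w f where w: "w \<in> carrier_vec N" "w \<noteq> 0\<^sub>v N" and f: "\<And>u. u \<in> set (cols P) \<Longrightarrow> u = f u \<cdot>\<^sub>v w"
    using rank_1_cols[OF P r] by blast
  define g where "g j = f (col P j)" for j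
  have Pwg: "P $$ (i, j) = g j * w $ i" if "i < N" "j < N" for i j
  proof -
    have "col P j \<in> set (cols P)" using that P by (auto simp: cols_def)
    from f[OF this] have "col P j $ i = (g j \<cdot>\<^sub>v w) $ i" by (simp add: g_def)
    then show ?thesis using that P w by simp
  qed
  define s where "s = (\<Sum>k<N. (cmod (g k))\<^sup>2)"
  have "s \<ge> 0" unfolding s_def by (intro sum_nonneg) auto
  define v where "v i = complex_of_real (sqrt s) * w $ i" for i
  have Pv: "P = proj_mat N v"
  proof (rule eq_matI)
    fix i j assume "i < dim_row (proj_mat N v)" "j < dim_col (proj_mat N v)"
    then have ij: "i < N" "j < N" by (auto simp: proj_mat_def)
    have "P $$ (i, j) = (P * mat_adjoint P) $$ (i, j)" using h i by simp
    also have "\<dots> = (\<Sum>k<N. P $$ (i, k) * cnj (P $$ (j, k)))"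
      using P ij unfolding mat_mult_entry[OF P mat_adjoint_carrier[OF P] ij]
      by (auto simp: mat_adjoint_entry[of _ N N] intro!: sum.cong)
    also have "\<dots> = (\<Sum>k<N. (g k * cnj (g k)) * (w $ i * cnj (w $ j)))"
      using ij by (intro sum.cong) (auto simp: Pwg)
    also have "\<dots> = complex_of_real s * (w $ i * cnj (w $ j))"
      by (simp add: s_def sum_distrib_right complex_norm_square del: of_real_power)
    also have "\<dots> = v i * cnj (v j)"
      using \<open>s \<ge> 0\<close> by (simp add: v_def algebra_simps flip: of_real_mult)
    finally show "P $$ (i, j) = proj_mat N v $$ (i, j)" using ij by (simp add: proj_mat_def)
  qed (use P in \<open>auto simp: proj_mat_def\<close>)
  define t where "t = (\<Sum>i<N. (cmod (v i))\<^sup>2)"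
  have t: "(\<Sum>k<N. cnj (v k) * v k) = complex_of_real t"
    by (simp add: t_def complex_norm_square mult.commute del: of_real_power)
  have "\<exists>a<N. v a \<noteq> 0"
  proof (rule ccontr)
    assume "\<not> ?thesis"
    then have "P = 0\<^sub>m N N" unfolding Pv by (intro eq_matI) (auto simp: proj_mat_def)
    then show False using r rank_0I[of N] by simp
  qed
  then obtain a where a: "a < N" "v a \<noteq> 0" by blast
  \<comment> \<open>One nonzero diagonal entry of \<open>P * P = P\<close> suffices to force the
    squared norm \<open>t\<close> to be 1.\<close>
  have "v a * cnj (v a) = (P * P) $$ (a, a)" using i a by (simp add: Pv proj_mat_def)
  also have "\<dots> = (\<Sum>k<N. (v a * cnj (v a)) * (cnj (v k) * v k))"
    using a unfolding mat_mult_entry[OF P P a(1) a(1)]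
    by (auto simp: Pv proj_mat_def intro!: sum.cong)
  also have "\<dots> = v a * cnj (v a) * complex_of_real t"
    by (simp add: sum_distrib_left[symmetric] t)
  finally have "t = 1" using a by simp
  then show ?thesis using that Pv unfolding t_def by blast
qed

section \<open>Entropy through eigenvalues, and Klein's inequality\<close>

lemma mat_trace_diag_conj:
  assumes "unitary_mat n U"
  shows "mat_trace (U * mat_diag n f * mat_adjoint U) = (\<Sum>k<n. f k)"
proof -
  note U = unitary_matD[OF assms]
  have "mat_trace (U * mat_diag n f * mat_adjoint U) = (\<Sum>i<n. \<Sum>k<n. U $$ (i, k) * f k * cnj (U $$ (i, k)))"
    using U(1) by (auto simp: mat_trace_def diag_conj_entry[OF U(1)] simp del: index_mult_mat(1) intro!: sum.cong)
  also have "\<dots> = (\<Sum>k<n. f k * (\<Sum>i<n. cnj (U $$ (i, k)) * U $$ (i, k)))"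
    by (subst sum.swap) (simp add: sum_distrib_left mult_ac)
  also have "\<dots> = (\<Sum>k<n. f k)"
    using U(3) by (intro sum.cong) auto
  finally show ?thesis .
qed

lemma diag_conj_mult:
  assumes "unitary_mat n U"
  shows "(U * mat_diag n f * mat_adjoint U) * (U * mat_diag n g * mat_adjoint U)
    = U * mat_diag n (\<lambda>k. f k * g k) * mat_adjoint U"
proof -
  note U = unitary_matD(1,2)[OF assms]
  have D: "mat_diag n h \<in> carrier_mat n n" for h :: "nat \<Rightarrow> complex" by simp
  have "(U * mat_diag n f * mat_adjoint U) * (U * mat_diag n g * mat_adjoint U)
    = U * mat_diag n f * (mat_adjoint U * U) * mat_diag n g * mat_adjoint U"
    using U D by (simp add: assoc_mult_mat[of _ n n _ n _ n] mult_carrier_mat[of _ n n _ n])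
  also have "\<dots> = U * (mat_diag n f * mat_diag n g) * mat_adjoint U"
    using U D assms unfolding unitary_mat_def
    by (simp del: mat_diag_diag add: assoc_mult_mat[of _ n n _ n _ n] mult_carrier_mat[of _ n n _ n] left_mult_one_mat[of _ n n])
  finally show ?thesis by (simp add: mat_diag_diag)
qed

text \<open>Uniqueness of the functional calculus lets any diagonalization be used; from here on
  entropies are handled only through lists of eigenvalues.\<close>

lemma entropy_diag_conj:
  assumes U: "unitary_mat n U"
  shows "entropy (U * mat_diag n (\<lambda>i. complex_of_real (x i)) * mat_adjoint U) = - (\<Sum>i<n. x i * ln (x i))"
proof -
  let ?A = "U * mat_diag n (\<lambda>i. complex_of_real (x i)) * mat_adjoint U"
  have "dim_row ?A = n" using unitary_matD(1)[OF U] by simp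
  then have "hermitian_fun ln ?A = U * mat_diag n (\<lambda>i. complex_of_real (ln (x i))) * mat_adjoint U"
    using U by (intro hermitian_fun_eq) (auto simp: spectral_apply_def)
  then show ?thesis
    by (simp add: entropy_def diag_conj_mult[OF U] mat_trace_diag_conj[OF U])
qed

text \<open>The quadratic form of \<open>M\<close> at \<open>u\<close>. For \<open>u\<close> a
  column of a unitary \<open>U\<close> it is a diagonal entry of \<open>M\<close> in the basis given
  by \<open>U\<close>, which is all that Klein's inequality sees of the first state.\<close>

definition exp_val :: "nat \<Rightarrow> complex mat \<Rightarrow> (nat \<Rightarrow> complex) \<Rightarrow> complex" where
  "exp_val n M u = (\<Sum>a<n. \<Sum>c<n. cnj (u a) * M $$ (a, c) * u c)"

lemma exp_val_eq_inner:
  assumes "M \<in> carrier_mat n n"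
  shows "exp_val n M u = (M *\<^sub>v vec n u) \<bullet>c vec n u"
  using assms
  by (auto simp: exp_val_def scalar_prod_def atLeast0LessThan sum_distrib_left mult_ac intro!: sum.cong)

lemma exp_val_diag_conj:
  assumes "U \<in> carrier_mat n n"
  shows "exp_val n (U * mat_diag n (\<lambda>i. complex_of_real (x i)) * mat_adjoint U) u
    = complex_of_real (\<Sum>k<n. x k * (cmod (\<Sum>a<n. cnj (u a) * U $$ (a, k)))\<^sup>2)"
proof -
  have "exp_val n (U * mat_diag n (\<lambda>i. complex_of_real (x i)) * mat_adjoint U) u
      = (\<Sum>a<n. \<Sum>c<n. \<Sum>k<n. complex_of_real (x k) * ((cnj (u a) * U $$ (a, k)) * cnj (cnj (u c) * U $$ (c, k))))"
    using assms by (auto simp: exp_val_def diag_conj_entry sum_distrib_left sum_distrib_right mult_ac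
        simp del: index_mult_mat(1) intro!: sum.cong)
  also have "\<dots> = (\<Sum>k<n. \<Sum>a<n. \<Sum>c<n. complex_of_real (x k) * ((cnj (u a) * U $$ (a, k)) * cnj (cnj (u c) * U $$ (c, k))))"
    by (subst sum.swap[of _ "{..<n}" "{..<n}"], subst sum.swap[of _ "{..<n}" "{..<n}"]) (intro sum.cong refl sum.swap)
  also have "\<dots> = complex_of_real (\<Sum>k<n. x k * (cmod (\<Sum>a<n. cnj (u a) * U $$ (a, k)))\<^sup>2)"
    by (simp add: complex_norm_square sum_product sum_distrib_left mult_ac del: of_real_power)
  finally show ?thesis .
qed

lemma density_mat_diagonalize:
  assumes "density_mat n \<tau>"
  obtains U x where "unitary_mat n U" "\<tau> = U * mat_diag n (\<lambda>i. complex_of_real (x i)) * mat_adjoint U"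
    "\<And>i. i < n \<Longrightarrow> 0 \<le> x i" "(\<Sum>i<n. x i) = 1"
proof -
  have \<tau>: "\<tau> \<in> carrier_mat n n" "mat_adjoint \<tau> = \<tau>" "mat_trace \<tau> = 1"
    and pos: "\<And>v. v \<in> carrier_vec n \<Longrightarrow> 0 \<le> Re ((\<tau> *\<^sub>v v) \<bullet>c v)"
    using assms by (auto simp: density_mat_def)
  obtain U x where U: "unitary_mat n U" and eq: "\<tau> = U * mat_diag n (\<lambda>i. complex_of_real (x i)) * mat_adjoint U"
    using hermitian_diagonalize[OF \<tau>(1,2)] by blast
  have "0 \<le> x i" if i: "i < n" for i
  proof -
    have "exp_val n \<tau> (\<lambda>a. U $$ (a, i)) = complex_of_real (\<Sum>k<n. x k * (cmod (of_bool (i = k)))\<^sup>2)"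
      unfolding eq exp_val_diag_conj[OF unitary_matD(1)[OF U]]
      using unitary_matD(3)[OF U i] by (intro arg_cong[of _ _ complex_of_real] sum.cong) auto
    also have "\<dots> = complex_of_real (x i)"
      using i by (simp add: of_bool_def if_distrib[of cmod] if_distrib[of "\<lambda>t. t\<^sup>2"] if_distrib[of "\<lambda>t. _ * t"]
          cong: if_cong)
    finally show ?thesis
      using pos[of "vec n (\<lambda>a. U $$ (a, i))"] exp_val_eq_inner[OF \<tau>(1)] by simp
  qed
  moreover have "(\<Sum>i<n. x i) = 1"
    using \<tau>(3) mat_trace_diag_conj[OF U] unfolding eq by (metis of_real_eq_1_iff of_real_sum)
  ultimately show ?thesis using that U eq by blast
qed

lemma entropy_nonneg:
  assumes "density_mat n \<tau>"
  shows "0 \<le> entropy \<tau>"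
proof -
  obtain U x where U: "unitary_mat n U" and eq: "\<tau> = U * mat_diag n (\<lambda>i. complex_of_real (x i)) * mat_adjoint U"
    and x: "\<And>i. i < n \<Longrightarrow> 0 \<le> x i" "(\<Sum>i<n. x i) = 1"
    using density_mat_diagonalize[OF assms] by blast
  have "x i * ln (x i) \<le> 0" if "i < n" for i
  proof -
    have "x i \<le> 1"
      using member_le_sum[of i "{..<n}" x] that x by auto
    then show ?thesis
      using x(1)[OF that] by (cases "x i = 0") (auto intro: mult_nonneg_nonpos)
  qed
  then have "(\<Sum>i<n. x i * ln (x i)) \<le> 0" by (intro sum_nonpos) auto
  then show ?thesis unfolding eq entropy_diag_conj[OF U] by simp
qed

text \<open>Klein's inequality; the second state has eigenvalues \<open>x\<close> and the columns of \<open>U\<close> as eigenvectors.\<close>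

lemma entropy_le_cross_entropy:
  assumes \<tau>: "density_mat n \<tau>" and U: "unitary_mat n U"
    and x: "\<And>j. j < n \<Longrightarrow> 0 \<le> x j" "(\<Sum>j<n. x j) \<le> 1"
    and supp: "\<And>j. j < n \<Longrightarrow> x j = 0 \<Longrightarrow> exp_val n \<tau> (\<lambda>a. U $$ (a, j)) = 0"
  shows "entropy \<tau> \<le> - (\<Sum>j<n. Re (exp_val n \<tau> (\<lambda>a. U $$ (a, j))) * ln (x j))"
proof -
  obtain W l where W: "unitary_mat n W" and eq: "\<tau> = W * mat_diag n (\<lambda>i. complex_of_real (l i)) * mat_adjoint W"
    and l: "\<And>i. i < n \<Longrightarrow> 0 \<le> l i" "(\<Sum>i<n. l i) = 1"
    using density_mat_diagonalize[OF \<tau>] by blast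
  define M where "M = mat_adjoint U * W"
  note Uc = unitary_matD[OF U] and Wc = unitary_matD[OF W]
  have "unitary_mat n (mat_adjoint U)"
    using U by (simp add: unitary_mat_def mat_adjoint_adjoint)
  then have M: "unitary_mat n M"
    using W unfolding M_def by (rule unitary_mat_mult)
  have Mjk: "M $$ (j, k) = (\<Sum>a<n. cnj (U $$ (a, j)) * W $$ (a, k))" if "j < n" "k < n" for j k
    unfolding M_def mat_mult_entry[OF Uc(2) Wc(1) that]
    using that Uc(1) by (simp add: mat_adjoint_entry[of _ n n])
  \<comment> \<open>Squared overlaps of the two eigenbases. Unitarity of \<open>M\<close> makes
    \<open>D\<close> doubly stochastic, and the expectation values become averages of the
    eigenvalues \<open>l\<close> under \<open>D\<close>.\<close>
  define D where "D j k = (cmod (M $$ (j, k)))\<^sup>2" for j k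
  have D0: "0 \<le> D j k" for j k by (simp add: D_def)
  have row: "(\<Sum>k<n. D j k) = 1" if "j < n" for j
    using unitary_matD(4)[OF M that that] unfolding D_def
    by (simp add: complex_eq_iff flip: complex_norm_square of_real_sum)
  have col: "(\<Sum>j<n. D j k) = 1" if "k < n" for k
    using unitary_matD(3)[OF M that that] unfolding D_def
    by (simp add: complex_eq_iff mult.commute[of "cnj _"] flip: complex_norm_square of_real_sum)
  have y: "exp_val n \<tau> (\<lambda>a. U $$ (a, j)) = complex_of_real (\<Sum>k<n. l k * D j k)" if "j < n" for j
    unfolding eq exp_val_diag_conj[OF Wc(1)] using that by (simp add: D_def Mjk)
  \<comment> \<open>This is \<open>ln t \<le> t - 1\<close> at \<open>t = x j / l k\<close>. If
    \<open>l k = 0\<close> the right side vanishes and the left is nonpositive, so only positive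
    \<open>l k\<close> and \<open>D j k\<close> need an argument.\<close>
  have termwise: "D j k * (l k - x j) \<le> D j k * l k * (ln (l k) - ln (x j))" if jk: "j < n" "k < n" for j k
  proof (cases "l k = 0 \<or> D j k = 0")
    case True
    then show ?thesis using x(1)[OF jk(1)] D0[of j k] by auto
  next
    case False
    then have pos: "0 < l k" "0 < D j k" using l(1)[OF jk(2)] D0[of j k] by auto
    \<comment> \<open>The support hypothesis: at \<open>x j = 0\<close> the average of the
      \<open>l k\<close> under \<open>D j\<close> vanishes, hence so does each of its terms. This
      also keeps the convention \<open>ln 0 = 0\<close> from entering the inequality.\<close>
    have "x j \<noteq> 0"
    proof
      assume "x j = 0"
      then have "(\<Sum>k<n. l k * D j k) = 0"
        using supp[OF jk(1)] y[OF jk(1)] by (metis of_real_eq_0_iff)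
      then have "l k * D j k = 0"
        using sum_nonneg_0[of "{..<n}" "\<lambda>k. l k * D j k" k] l(1) D0 jk(2) by auto
      then show False using pos by simp
    qed
    then have xpos: "0 < x j" using x(1)[OF jk(1)] by simp
    have "ln (x j / l k) \<le> x j / l k - 1"
      using xpos pos by (intro ln_le_minus_one) simp
    then have "l k * ln (x j / l k) \<le> l k * (x j / l k - 1)"
      using pos by (intro mult_left_mono) auto
    also have "\<dots> = x j - l k" using pos by (simp add: field_simps)
    finally have "l k - x j \<le> l k * (ln (l k) - ln (x j))"
      using xpos pos by (simp add: ln_div algebra_simps)
    then have "D j k * (l k - x j) \<le> D j k * (l k * (ln (l k) - ln (x j)))"
      using pos by (intro mult_left_mono) auto
    then show ?thesis by (simp add: mult.assoc)
  qed
  have "0 \<le> (\<Sum>k<n. l k) - (\<Sum>j<n. x j)" using l x by simp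
  also have "\<dots> = (\<Sum>k<n. l k * (\<Sum>j<n. D j k)) - (\<Sum>j<n. x j * (\<Sum>k<n. D j k))"
    by (simp add: row col)
  also have "\<dots> = (\<Sum>j<n. \<Sum>k<n. D j k * (l k - x j))"
    unfolding sum_distrib_left
    by (subst sum.swap) (simp add: sum_subtractf algebra_simps)
  also have "\<dots> \<le> (\<Sum>j<n. \<Sum>k<n. D j k * l k * (ln (l k) - ln (x j)))"
    by (intro sum_mono termwise) auto
  also have "\<dots> = (\<Sum>j<n. \<Sum>k<n. D j k * (l k * ln (l k))) - (\<Sum>j<n. (\<Sum>k<n. l k * D j k) * ln (x j))"
    by (simp add: sum_subtractf algebra_simps sum_distrib_left sum_distrib_right)
  also have "(\<Sum>j<n. \<Sum>k<n. D j k * (l k * ln (l k))) = (\<Sum>k<n. l k * ln (l k))"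
    by (subst sum.swap) (simp add: sum_distrib_right[symmetric] col)
  finally have "(\<Sum>j<n. (\<Sum>k<n. l k * D j k) * ln (x j)) \<le> (\<Sum>k<n. l k * ln (l k))" by simp
  moreover have "(\<Sum>j<n. Re (exp_val n \<tau> (\<lambda>a. U $$ (a, j))) * ln (x j)) = (\<Sum>j<n. (\<Sum>k<n. l k * D j k) * ln (x j))"
    by (intro sum.cong) (auto simp: y)
  ultimately show ?thesis
    unfolding eq entropy_diag_conj[OF W] by simp
qed

section \<open>Entanglement of formation under local Kraus operators\<close>

lemma sum_lessThan_times:
  fixes f :: "nat \<Rightarrow> 'a :: comm_monoid_add"
  shows "(\<Sum>I<m * n. f I) = (\<Sum>i<m. \<Sum>k<n. f (i * n + k))"
proof -
  have "sum f {i * n..<i * n + n} = (\<Sum>k<n. f (i * n + k))" for i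
    using sum.shift_bounds_nat_ivl[of f 0 "i * n" n] by (simp add: atLeast0LessThan add.commute)
  then show ?thesis
    by (simp flip: sum.nat_group)
qed

lemma lessThan_times_index:
  assumes "i < (m::nat)" "k < n"
  shows "i * n + k < m * n"
proof -
  have "i * n + k < Suc i * n" using assms by simp
  also have "\<dots> \<le> m * n" using assms by (intro mult_le_mono1) simp
  finally show ?thesis .
qed

text \<open>The reduced state on the first factor of the vector with amplitudes
  \<open>\<phi> a c\<close>: with \<open>\<phi>\<close> read as an \<open>m\<close> by
  \<open>n\<close> matrix, its product with its adjoint.\<close>

definition reduced_mat :: "nat \<Rightarrow> nat \<Rightarrow> (nat \<Rightarrow> nat \<Rightarrow> complex) \<Rightarrow> complex mat" where
  "reduced_mat m n \<phi> = mat m m (\<lambda>(a, a'). \<Sum>c<n. \<phi> a c * cnj (\<phi> a' c))"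

lemma ptrace2_proj_mat:
  "ptrace2 m n (proj_mat (m * n) v) = reduced_mat m n (\<lambda>a c. v (a * n + c))"
  by (intro eq_matI) (auto simp: ptrace2_def reduced_mat_def proj_mat_def lessThan_times_index)

lemma exp_val_reduced_mat:
  "exp_val m (reduced_mat m n \<phi>) u = complex_of_real (\<Sum>c<n. (cmod (\<Sum>a<m. cnj (u a) * \<phi> a c))\<^sup>2)"
proof -
  have "exp_val m (reduced_mat m n \<phi>) u
      = (\<Sum>a<m. \<Sum>a'<m. \<Sum>c<n. (cnj (u a) * \<phi> a c) * cnj (cnj (u a') * \<phi> a' c))"
    by (auto simp: exp_val_def reduced_mat_def sum_distrib_left sum_distrib_right mult_ac intro!: sum.cong)
  also have "\<dots> = (\<Sum>c<n. \<Sum>a<m. \<Sum>a'<m. (cnj (u a) * \<phi> a c) * cnj (cnj (u a') * \<phi> a' c))"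
    by (subst sum.swap[of _ "{..<n}" "{..<m}"], subst sum.swap[of _ "{..<n}" "{..<m}"]) simp
  finally show ?thesis
    by (simp add: complex_norm_square sum_product del: of_real_power)
qed

lemma density_mat_reduced_mat:
  assumes "(\<Sum>a<m. \<Sum>c<n. (cmod (\<phi> a c))\<^sup>2) = 1"
  shows "density_mat m (reduced_mat m n \<phi>)"
proof -
  let ?R = "reduced_mat m n \<phi>"
  have c: "?R \<in> carrier_mat m m" by (simp add: reduced_mat_def)
  have "mat_adjoint ?R = ?R"
    using c by (intro eq_matI) (auto simp: mat_adjoint_entry[of _ m m] reduced_mat_def mult.commute)
  moreover have "0 \<le> Re ((?R *\<^sub>v v) \<bullet>c v)" if "v \<in> carrier_vec m" for v
  proof -
    have "vec m (\<lambda>a. v $ a) = v" using that by auto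
    then have "(?R *\<^sub>v v) \<bullet>c v = exp_val m ?R (\<lambda>a. v $ a)"
      by (simp add: exp_val_eq_inner[OF c])
    then show ?thesis by (simp add: exp_val_reduced_mat sum_nonneg)
  qed
  moreover have "mat_trace ?R = 1"
  proof -
    have "mat_trace ?R = complex_of_real (\<Sum>a<m. \<Sum>c<n. (cmod (\<phi> a c))\<^sup>2)"
      by (simp add: mat_trace_def reduced_mat_def complex_norm_square del: of_real_power)
    then show ?thesis using assms by simp
  qed
  ultimately show ?thesis using c by (simp add: density_mat_def)
qed

lemma entropy_ptrace2_pure_nonneg:
  assumes "pure_state (m * n) P"
  shows "0 \<le> entropy (ptrace2 m n P)"
proof -
  obtain v where v: "P = proj_mat (m * n) v" "(\<Sum>i<m * n. (cmod (v i))\<^sup>2) = 1"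
    using pure_stateE[OF assms] by blast
  show ?thesis
    unfolding v(1) ptrace2_proj_mat using v(2)
    by (intro entropy_nonneg[OF density_mat_reduced_mat]) (simp add: sum_lessThan_times)
qed

text \<open>
  Applying the Kraus operators \<open>Kr k\<close> to the second factor yields the ensemble of the \<open>\<chi> k\<close> with
  weights \<open>w k\<close>. In the eigenbasis of the original reduced state, Klein's inequality bounds
  every entropy of the ensemble against the same weights \<open>- ln (x j)\<close>, and these bounds add up.
\<close>

lemma entropy_local_kraus_le:
  fixes Kr :: "nat \<Rightarrow> nat \<Rightarrow> nat \<Rightarrow> complex"
  assumes \<psi>: "(\<Sum>a<m. \<Sum>e<n1. (cmod (\<psi> a e))\<^sup>2) = 1"
    and bound: "\<And>v. (\<Sum>k<r. \<Sum>c<n2. (cmod (\<Sum>e<n1. Kr k c e * v e))\<^sup>2) \<le> C * (\<Sum>e<n1. (cmod (v e))\<^sup>2)"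
    and w: "\<And>k. k < r \<Longrightarrow> 0 \<le> w k"
    and \<chi>: "\<And>k. k < r \<Longrightarrow> (\<Sum>a<m. \<Sum>c<n2. (cmod (\<chi> k a c))\<^sup>2) = 1"
    and split: "\<And>k a c. k < r \<Longrightarrow> a < m \<Longrightarrow> c < n2 \<Longrightarrow>
      (\<Sum>e<n1. Kr k c e * \<psi> a e) = complex_of_real (sqrt (w k)) * \<chi> k a c"
  shows "(\<Sum>k<r. w k * entropy (reduced_mat m n2 (\<chi> k))) \<le> C * entropy (reduced_mat m n1 \<psi>)"
proof -
  let ?T = "reduced_mat m n1 \<psi>"
  obtain U x where U: "unitary_mat m U" and T: "?T = U * mat_diag m (\<lambda>i. complex_of_real (x i)) * mat_adjoint U"
    and x: "\<And>i. i < m \<Longrightarrow> 0 \<le> x i" "(\<Sum>i<m. x i) = 1"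
    using density_mat_diagonalize[OF density_mat_reduced_mat[OF \<psi>]] by blast
  have x1: "x j \<le> 1" if "j < m" for j
    using member_le_sum[of j "{..<m}" x] that x by auto
  \<comment> \<open>The unnormalised vector left on the second factor after contracting the first
    with eigenvector \<open>j\<close>; its squared norm is the eigenvalue
    \<open>x j\<close>.\<close>
  define v where "v j e = (\<Sum>a<m. cnj (U $$ (a, j)) * \<psi> a e)" for j e
  have xj: "x j = (\<Sum>e<n1. (cmod (v j e))\<^sup>2)" if j: "j < m" for j
  proof -
    have "complex_of_real (\<Sum>e<n1. (cmod (v j e))\<^sup>2) = exp_val m ?T (\<lambda>a. U $$ (a, j))"
      by (simp only: exp_val_reduced_mat v_def)
    also have "\<dots> = complex_of_real (\<Sum>k<m. x k * (cmod (of_bool (j = k)))\<^sup>2)"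
      unfolding T exp_val_diag_conj[OF unitary_matD(1)[OF U]]
      using unitary_matD(3)[OF U j] by (intro arg_cong[of _ _ complex_of_real] sum.cong) auto
    also have "\<dots> = complex_of_real (x j)"
      using j by (simp add: of_bool_def if_distrib[of cmod] if_distrib[of "\<lambda>t. t\<^sup>2"] if_distrib[of "\<lambda>t. _ * t"]
          cong: if_cong)
    finally show ?thesis by (metis of_real_eq_iff)
  qed
  define y where "y k j = (\<Sum>c<n2. (cmod (\<Sum>a<m. cnj (U $$ (a, j)) * \<chi> k a c))\<^sup>2)" for k j
  have y0: "0 \<le> y k j" for k j unfolding y_def by (intro sum_nonneg) auto
  have N: "w k * y k j = (\<Sum>c<n2. (cmod (\<Sum>e<n1. Kr k c e * v j e))\<^sup>2)" if k: "k < r" for k j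
  proof -
    have "(cmod (\<Sum>e<n1. Kr k c e * v j e))\<^sup>2 = w k * (cmod (\<Sum>a<m. cnj (U $$ (a, j)) * \<chi> k a c))\<^sup>2"
      if c: "c < n2" for c
    proof -
      have "(\<Sum>e<n1. Kr k c e * v j e) = (\<Sum>a<m. cnj (U $$ (a, j)) * (\<Sum>e<n1. Kr k c e * \<psi> a e))"
        unfolding v_def sum_distrib_left by (subst sum.swap) (simp add: mult_ac)
      also have "\<dots> = (\<Sum>a<m. cnj (U $$ (a, j)) * (complex_of_real (sqrt (w k)) * \<chi> k a c))"
        using k c by (intro sum.cong) (auto simp: split)
      also have "\<dots> = complex_of_real (sqrt (w k)) * (\<Sum>a<m. cnj (U $$ (a, j)) * \<chi> k a c)"
        by (simp add: sum_distrib_left mult_ac)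
      finally show ?thesis
        using w[OF k] by (simp add: norm_mult power_mult_distrib)
    qed
    then show ?thesis by (simp add: y_def sum_distrib_left)
  qed
  \<comment> \<open>Operators on the second factor commute with contracting the first, so the norm
    bound applies to each \<open>v j\<close> separately. This is where \<open>C\<close>
    enters.\<close>
  have Nsum: "(\<Sum>k<r. w k * y k j) \<le> C * x j" if "j < m" for j
    using bound[of "v j"] by (simp add: N xj[OF that])
  have "w k * entropy (reduced_mat m n2 (\<chi> k)) \<le> - (\<Sum>j<m. w k * y k j * ln (x j))" if k: "k < r" for k
  proof (cases "w k = 0")
    case False
    have "entropy (reduced_mat m n2 (\<chi> k))
        \<le> - (\<Sum>j<m. Re (exp_val m (reduced_mat m n2 (\<chi> k)) (\<lambda>a. U $$ (a, j))) * ln (x j))"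
    proof (rule entropy_le_cross_entropy[OF density_mat_reduced_mat[OF \<chi>[OF k]] U])
      fix j assume j: "j < m" "x j = 0"
      \<comment> \<open>This gives the support condition of Klein's inequality: an eigenvector of
        eigenvalue 0 has \<open>v j = 0\<close>, and no Kraus operator can produce weight on
        it.\<close>
      have "w k * y k j \<le> (\<Sum>k<r. w k * y k j)"
        using k w y0 by (intro member_le_sum) auto
      also have "\<dots> \<le> 0" using Nsum[OF j(1)] j(2) by simp
      finally have "y k j = 0" using w[OF k] y0[of k j] False
        by (metis mult_le_0_iff mult_nonneg_nonneg order_antisym mult_eq_0_iff)
      then show "exp_val m (reduced_mat m n2 (\<chi> k)) (\<lambda>a. U $$ (a, j)) = 0"
        unfolding exp_val_reduced_mat y_def by simp
    qed (use x in auto)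
    also have "\<dots> = - (\<Sum>j<m. y k j * ln (x j))"
      by (simp add: exp_val_reduced_mat y_def)
    finally have "w k * entropy (reduced_mat m n2 (\<chi> k)) \<le> w k * (- (\<Sum>j<m. y k j * ln (x j)))"
      using w[OF k] by (intro mult_left_mono)
    then show ?thesis by (simp add: sum_distrib_left mult.assoc)
  qed simp
  then have "(\<Sum>k<r. w k * entropy (reduced_mat m n2 (\<chi> k))) \<le> (\<Sum>k<r. \<Sum>j<m. w k * y k j * (- ln (x j)))"
    by (intro sum_mono) (simp add: sum_negf)
  also have "\<dots> = (\<Sum>j<m. (\<Sum>k<r. w k * y k j) * (- ln (x j)))"
    by (subst sum.swap) (simp add: sum_distrib_right sum_negf)
  also have "\<dots> \<le> (\<Sum>j<m. C * x j * (- ln (x j)))"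
  proof (rule sum_mono)
    fix j assume "j \<in> {..<m}"
    then have j: "j < m" by simp
    \<comment> \<open>Eigenvalues are at most 1, and \<open>ln 0 = 0\<close> covers the null ones;
      the sign is what allows multiplying the bound \<open>Nsum\<close>.\<close>
    have "0 \<le> - ln (x j)"
      using x(1)[OF j] x1[OF j] by (cases "x j = 0") auto
    then show "(\<Sum>k<r. w k * y k j) * (- ln (x j)) \<le> C * x j * (- ln (x j))"
      using Nsum[OF j] by (rule mult_right_mono[rotated])
  qed
  also have "\<dots> = C * entropy ?T"
    unfolding T entropy_diag_conj[OF U] by (simp add: sum_distrib_left sum_negf mult.assoc)
  finally show ?thesis .
qed

text \<open>The map sending \<open>\<sigma>\<close> to the sum over \<open>k\<close> of \<open>(1
  \<otimes> K\<^sub>k) \<sigma> (1 \<otimes> K\<^sub>k)\<^sup>*\<close>, where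
  \<open>Kr k c e\<close> is the entry of \<open>K\<^sub>k\<close> in row \<open>c\<close> and
  column \<open>e\<close>.\<close>

definition local_kraus ::
    "nat \<Rightarrow> nat \<Rightarrow> nat \<Rightarrow> nat \<Rightarrow> (nat \<Rightarrow> nat \<Rightarrow> nat \<Rightarrow> complex) \<Rightarrow> complex mat \<Rightarrow> complex mat" where
  "local_kraus m n1 n2 r Kr \<sigma> = mat (m * n2) (m * n2) (\<lambda>(I, J). \<Sum>k<r. \<Sum>e<n1. \<Sum>e'<n1.
     Kr k (I mod n2) e * \<sigma> $$ (I div n2 * n1 + e, J div n2 * n1 + e') * cnj (Kr k (J mod n2) e'))"

text \<open>Each pure component \<open>i\<close> and each Kraus index \<open>k\<close> yield one
  vector \<open>\<phi> i k\<close>, whose squared norm becomes part of the new weight. The norm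
  bound alone does not normalise these weights when \<open>C\<close> differs from 1; the trace
  condition does.\<close>

lemma pure_decomposition_local_kraus:
  assumes dec: "pure_decomposition (m * n1) \<sigma> N p s"
    and bound: "\<And>v. (\<Sum>k<r. \<Sum>c<n2. (cmod (\<Sum>e<n1. Kr k c e * v e))\<^sup>2) \<le> C * (\<Sum>e<n1. (cmod (v e))\<^sup>2)"
    and tr: "mat_trace (local_kraus m n1 n2 r Kr \<sigma>) = 1"
  obtains N' p' s' where "pure_decomposition (m * n2) (local_kraus m n1 n2 r Kr \<sigma>) N' p' s'"
    "(\<Sum>t<N'. p' t * entropy (ptrace2 m n2 (s' t))) \<le> C * (\<Sum>t<N. p t * entropy (ptrace2 m n1 (s t)))"
proof -
  let ?L = "local_kraus m n1 n2 r Kr \<sigma>"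
  have p: "\<And>i. i < N \<Longrightarrow> 0 \<le> p i" and ps: "\<And>i. i < N \<Longrightarrow> pure_state (m * n1) (s i)"
    and \<sigma>: "\<sigma> = mat (m * n1) (m * n1) (\<lambda>(i, j). \<Sum>k<N. complex_of_real (p k) * s k $$ (i, j))"
    using dec by (auto simp: pure_decomposition_def)
  have "\<forall>i. \<exists>v. i < N \<longrightarrow> s i = proj_mat (m * n1) v \<and> (\<Sum>i<m * n1. (cmod (v i))\<^sup>2) = 1"
    using pure_stateE[OF ps] by metis
  then obtain v where v: "\<And>i. i < N \<Longrightarrow> s i = proj_mat (m * n1) (v i)"
    "\<And>i. i < N \<Longrightarrow> (\<Sum>I<m * n1. (cmod (v i I))\<^sup>2) = 1"
    by metis
  have mn: "0 < m * n2"
    using tr by (cases "m * n2 = 0") (auto simp: mat_trace_def local_kraus_def)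
  define \<phi> where "\<phi> i k I = (\<Sum>e<n1. Kr k (I mod n2) e * v i (I div n2 * n1 + e))" for i k I
  define w where "w i k = (\<Sum>I<m * n2. (cmod (\<phi> i k I))\<^sup>2)" for i k
  have w0: "0 \<le> w i k" for i k unfolding w_def by (intro sum_nonneg) auto
  \<comment> \<open>A component of weight zero still has to be a pure state, so it gets the first
    basis vector as a dummy. That vector exists because trace 1 rules out dimension 0, see
    \<open>mn\<close>.\<close>
  define \<chi> where "\<chi> i k I = (if w i k = 0 then of_bool (I = 0) else \<phi> i k I / complex_of_real (sqrt (w i k)))"
    for i k I
  have \<chi>: "complex_of_real (sqrt (w i k)) * \<chi> i k I = \<phi> i k I" if "I < m * n2" for i k I
  proof (cases "w i k = 0")
    case True
    then have "\<phi> i k I = 0"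
      using that sum_nonneg_0[of "{..<m * n2}" "\<lambda>I. (cmod (\<phi> i k I))\<^sup>2" I] by (auto simp: w_def)
    then show ?thesis using True by simp
  qed (simp add: \<chi>_def)
  have \<chi>1: "(\<Sum>I<m * n2. (cmod (\<chi> i k I))\<^sup>2) = 1" for i k
  proof (cases "w i k = 0")
    case True
    then show ?thesis
      using mn by (simp add: \<chi>_def of_bool_def if_distrib[of cmod] if_distrib[of "\<lambda>t. t\<^sup>2"] cong: if_cong)
  next
    case False
    have "(\<Sum>I<m * n2. (cmod (\<chi> i k I))\<^sup>2) = (\<Sum>I<m * n2. (cmod (\<phi> i k I))\<^sup>2 / w i k)"
      using False w0[of i k] by (simp add: \<chi>_def norm_divide power_divide)
    also have "\<dots> = 1"
      using False by (simp add: w_def flip: sum_divide_distrib)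
    finally show ?thesis .
  qed
  define s' where "s' t = proj_mat (m * n2) (\<chi> (t div r) (t mod r))" for t
  define p' where "p' t = p (t div r) * w (t div r) (t mod r)" for t
  have L: "?L $$ (I, J) = (\<Sum>i<N. \<Sum>k<r. complex_of_real (p i) * (\<phi> i k I * cnj (\<phi> i k J)))"
    if IJ: "I < m * n2" "J < m * n2" for I J
  proof -
    have n2: "0 < n2" using mn by auto
    have idx: "I div n2 * n1 + e < m * n1" "J div n2 * n1 + e < m * n1" if "e < n1" for e
      using IJ that n2 by (auto intro!: lessThan_times_index simp: less_mult_imp_div_less)
    have "?L $$ (I, J) = (\<Sum>k<r. \<Sum>e<n1. \<Sum>e'<n1. \<Sum>i<N. complex_of_real (p i) *
        ((Kr k (I mod n2) e * v i (I div n2 * n1 + e)) * cnj (Kr k (J mod n2) e' * v i (J div n2 * n1 + e'))))"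
      using IJ idx by (auto simp: local_kraus_def \<sigma> v(1) proj_mat_def sum_distrib_left sum_distrib_right mult_ac
          intro!: sum.cong)
    also have "\<dots> = (\<Sum>k<r. \<Sum>e<n1. \<Sum>i<N. \<Sum>e'<n1. complex_of_real (p i) *
        ((Kr k (I mod n2) e * v i (I div n2 * n1 + e)) * cnj (Kr k (J mod n2) e' * v i (J div n2 * n1 + e'))))"
      by (intro sum.cong refl sum.swap)
    also have "\<dots> = (\<Sum>k<r. \<Sum>i<N. \<Sum>e<n1. \<Sum>e'<n1. complex_of_real (p i) *
        ((Kr k (I mod n2) e * v i (I div n2 * n1 + e)) * cnj (Kr k (J mod n2) e' * v i (J div n2 * n1 + e'))))"
      by (intro sum.cong refl sum.swap)
    also have "\<dots> = (\<Sum>k<r. \<Sum>i<N. complex_of_real (p i) * (\<phi> i k I * cnj (\<phi> i k J)))"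
      unfolding \<phi>_def cnj_sum sum_product by (simp only: sum_distrib_left)
    also have "\<dots> = (\<Sum>i<N. \<Sum>k<r. complex_of_real (p i) * (\<phi> i k I * cnj (\<phi> i k J)))"
      by (rule sum.swap)
    finally show ?thesis .
  qed
  have ws: "complex_of_real (w i k) * (\<chi> i k I * cnj (\<chi> i k J)) = \<phi> i k I * cnj (\<phi> i k J)"
    if "I < m * n2" "J < m * n2" for i k I J
  proof -
    have "complex_of_real (sqrt (w i k)) * complex_of_real (sqrt (w i k)) = complex_of_real (w i k)"
      using w0 by (simp flip: of_real_mult)
    then show ?thesis
      by (simp add: mult_ac flip: \<chi>[OF that(1)] \<chi>[OF that(2)])
  qed
  have "1 = (\<Sum>I<m * n2. ?L $$ (I, I))"
    using tr by (simp add: mat_trace_def local_kraus_def)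
  also have "\<dots> = (\<Sum>I<m * n2. \<Sum>i<N. \<Sum>k<r. complex_of_real (p i * (cmod (\<phi> i k I))\<^sup>2))"
    by (simp add: L complex_norm_square del: of_real_power)
  also have "\<dots> = (\<Sum>i<N. \<Sum>k<r. \<Sum>I<m * n2. complex_of_real (p i * (cmod (\<phi> i k I))\<^sup>2))"
    by (subst sum.swap, intro sum.cong refl sum.swap)
  also have "\<dots> = complex_of_real (\<Sum>i<N. \<Sum>k<r. p i * w i k)"
    by (simp add: w_def sum_distrib_left)
  finally have sum1: "(\<Sum>i<N. \<Sum>k<r. p i * w i k) = 1"
    by (metis of_real_eq_1_iff)
  have dec': "pure_decomposition (m * n2) ?L (N * r) p' s'"
    unfolding pure_decomposition_def
  proof (intro conjI allI impI)
    fix t assume t: "t < N * r"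
    then have "t div r < N" by (simp add: less_mult_imp_div_less)
    then show "0 \<le> p' t" using p w0 by (simp add: p'_def)
    show "pure_state (m * n2) (s' t)"
      unfolding s'_def by (rule pure_state_proj_mat) (rule \<chi>1)
  next
    show "(\<Sum>t<N * r. p' t) = 1"
      using sum1 by (simp add: sum_lessThan_times p'_def)
    show "?L = mat (m * n2) (m * n2) (\<lambda>(i, j). \<Sum>t<N * r. complex_of_real (p' t) * s' t $$ (i, j))"
    proof (rule eq_matI)
      fix I J
      assume "I < dim_row (mat (m * n2) (m * n2) (\<lambda>(i, j). \<Sum>t<N * r. complex_of_real (p' t) * s' t $$ (i, j)))"
        "J < dim_col (mat (m * n2) (m * n2) (\<lambda>(i, j). \<Sum>t<N * r. complex_of_real (p' t) * s' t $$ (i, j)))"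
      then have IJ: "I < m * n2" "J < m * n2" by auto
      have "(\<Sum>t<N * r. complex_of_real (p' t) * s' t $$ (I, J))
          = (\<Sum>i<N. \<Sum>k<r. complex_of_real (p i) * (complex_of_real (w i k) * (\<chi> i k I * cnj (\<chi> i k J))))"
        using IJ by (simp add: sum_lessThan_times p'_def s'_def proj_mat_def mult.assoc)
      then show "?L $$ (I, J) = mat (m * n2) (m * n2) (\<lambda>(i, j). \<Sum>t<N * r. complex_of_real (p' t) * s' t $$ (i, j)) $$ (I, J)"
        using IJ by (simp add: L ws)
    qed (auto simp: local_kraus_def)
  qed
  have "(\<Sum>k<r. w i k * entropy (ptrace2 m n2 (proj_mat (m * n2) (\<chi> i k)))) \<le> C * entropy (ptrace2 m n1 (s i))"
    if i: "i < N" for i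
    unfolding v(1)[OF i] ptrace2_proj_mat
  proof (rule entropy_local_kraus_le[OF _ bound])
    show "(\<Sum>a<m. \<Sum>e<n1. (cmod (v i (a * n1 + e)))\<^sup>2) = 1"
      using v(2)[OF i] by (simp add: sum_lessThan_times)
    show "(\<Sum>a<m. \<Sum>c<n2. (cmod (\<chi> i k (a * n2 + c)))\<^sup>2) = 1" for k
      using \<chi>1[of i k] by (simp add: sum_lessThan_times)
    show "(\<Sum>e<n1. Kr k c e * v i (a * n1 + e)) = complex_of_real (sqrt (w i k)) * \<chi> i k (a * n2 + c)"
      if "a < m" "c < n2" for k a c
      using \<chi>[OF lessThan_times_index[OF that]] that by (simp add: \<phi>_def)
  qed (rule w0)
  then have "(\<Sum>i<N. p i * (\<Sum>k<r. w i k * entropy (ptrace2 m n2 (proj_mat (m * n2) (\<chi> i k)))))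
      \<le> (\<Sum>i<N. p i * (C * entropy (ptrace2 m n1 (s i))))"
    using p by (intro sum_mono mult_left_mono) auto
  also have "\<dots> = C * (\<Sum>i<N. p i * entropy (ptrace2 m n1 (s i)))"
    by (simp add: sum_distrib_left mult_ac)
  also have "(\<Sum>i<N. p i * (\<Sum>k<r. w i k * entropy (ptrace2 m n2 (proj_mat (m * n2) (\<chi> i k)))))
      = (\<Sum>t<N * r. p' t * entropy (ptrace2 m n2 (s' t)))"
    by (simp add: sum_lessThan_times p'_def s'_def sum_distrib_left mult.assoc)
  finally show ?thesis using that dec' by blast
qed

section \<open>The infimum over decompositions\<close>

lemma entanglement_of_formation_le:
  assumes "pure_decomposition (m * n) \<sigma> N p s"
  shows "entanglement_of_formation m n \<sigma> \<le> (\<Sum>t<N. p t * entropy (ptrace2 m n (s t)))"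
  unfolding entanglement_of_formation_def
proof (rule cInf_lower)
  show "bdd_below {(\<Sum>k<K. p k * entropy (ptrace2 m n (s k))) |K p s. pure_decomposition (m * n) \<sigma> K p s}"
    by (rule bdd_belowI[of _ 0])
      (auto simp: pure_decomposition_def intro!: sum_nonneg mult_nonneg_nonneg entropy_ptrace2_pure_nonneg)
qed (use assms in blast)

text \<open>The exhibited decomposition makes the set under the infimum nonempty, without which
  \<open>Inf\<close> carries no information.\<close>

lemma entanglement_of_formation_ge:
  assumes "pure_decomposition (m * n) \<sigma> N p s"
    and "\<And>N p s. pure_decomposition (m * n) \<sigma> N p s \<Longrightarrow> B \<le> (\<Sum>t<N. p t * entropy (ptrace2 m n (s t)))"
  shows "B \<le> entanglement_of_formation m n \<sigma>"
  unfolding entanglement_of_formation_def using assms by (intro cInf_greatest) auto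

lemma entanglement_of_formation_nonneg:
  assumes "pure_decomposition (m * n) \<sigma> N p s"
  shows "0 \<le> entanglement_of_formation m n \<sigma>"
  by (rule entanglement_of_formation_ge[OF assms])
    (auto simp: pure_decomposition_def intro!: sum_nonneg mult_nonneg_nonneg entropy_ptrace2_pure_nonneg)

text \<open>Every decomposition of the input induces one of the output at no more than
  \<open>C\<close> times the cost. Dividing by \<open>C\<close> first turns this into a lower bound
  valid for all input decompositions, hence for their infimum.\<close>

lemma entanglement_of_formation_local_kraus_le:
  assumes dec: "pure_decomposition (m * n1) \<sigma> N p s" and C: "0 < C"
    and bound: "\<And>v. (\<Sum>k<r. \<Sum>c<n2. (cmod (\<Sum>e<n1. Kr k c e * v e))\<^sup>2) \<le> C * (\<Sum>e<n1. (cmod (v e))\<^sup>2)"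
    and tr: "mat_trace (local_kraus m n1 n2 r Kr \<sigma>) = 1"
  shows "entanglement_of_formation m n2 (local_kraus m n1 n2 r Kr \<sigma>) \<le> C * entanglement_of_formation m n1 \<sigma>"
proof -
  let ?E = "entanglement_of_formation m n2 (local_kraus m n1 n2 r Kr \<sigma>)"
  have "?E / C \<le> entanglement_of_formation m n1 \<sigma>"
  proof (rule entanglement_of_formation_ge[OF dec])
    fix N p s assume "pure_decomposition (m * n1) \<sigma> N p s"
    from pure_decomposition_local_kraus[OF this bound tr]
    obtain N' p' s' where "pure_decomposition (m * n2) (local_kraus m n1 n2 r Kr \<sigma>) N' p' s'"
      and le: "(\<Sum>t<N'. p' t * entropy (ptrace2 m n2 (s' t))) \<le> C * (\<Sum>t<N. p t * entropy (ptrace2 m n1 (s t)))"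
      by blast
    from entanglement_of_formation_le[OF this(1)] le
    have "?E \<le> C * (\<Sum>t<N. p t * entropy (ptrace2 m n1 (s t)))" by simp
    then show "?E / C \<le> (\<Sum>t<N. p t * entropy (ptrace2 m n1 (s t)))"
      using C by (simp add: field_simps)
  qed
  then show ?thesis using C by (simp add: field_simps)
qed

section \<open>Matrix product form of the chain state\<close>

lemma sum_of_bool_mult:
  fixes f :: "nat \<Rightarrow> 'a :: semiring_1"
  assumes "a < n"
  shows "(\<Sum>i<n. of_bool (i = a) * f i) = f a"
proof -
  have "(\<Sum>i<n. of_bool (i = a) * f i) = (\<Sum>i<n. if i = a then f i else 0)"
    by (intro sum.cong) auto
  then show ?thesis using assms by simp
qed

text \<open>Reassociation of a matrix product \<open>(X f) (g Y)\<close>. The inner index ranges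
  over an arbitrary set so that tuples can serve as composite indices.\<close>

lemma sum_bilinear:
  fixes X Y :: "nat \<Rightarrow> 'a :: comm_semiring_0"
  shows "(\<Sum>t\<in>T. (\<Sum>a<n. X a * f a t) * (\<Sum>c<n. g c t * Y c))
    = (\<Sum>a<n. \<Sum>c<n. X a * (\<Sum>t\<in>T. f a t * g c t) * Y c)"
proof -
  have "(\<Sum>t\<in>T. (\<Sum>a<n. X a * f a t) * (\<Sum>c<n. g c t * Y c))
      = (\<Sum>t\<in>T. \<Sum>a<n. \<Sum>c<n. X a * (f a t * g c t) * Y c)"
    by (simp add: sum_product mult_ac)
  also have "\<dots> = (\<Sum>a<n. \<Sum>c<n. \<Sum>t\<in>T. X a * (f a t * g c t) * Y c)"
    by (subst sum.swap, intro sum.cong refl sum.swap)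
  finally show ?thesis by (simp add: sum_distrib_left sum_distrib_right)
qed

lemma sum_delta_bilinear:
  fixes X Y :: "nat \<Rightarrow> 'a :: comm_semiring_1"
  assumes "\<And>a c. a < n \<Longrightarrow> c < n \<Longrightarrow> (\<Sum>t\<in>T. f a t * g c t) = of_bool (a = c)"
  shows "(\<Sum>t\<in>T. (\<Sum>a<n. X a * f a t) * (\<Sum>c<n. g c t * Y c)) = (\<Sum>a<n. X a * Y a)"
proof -
  have "(\<Sum>t\<in>T. (\<Sum>a<n. X a * f a t) * (\<Sum>c<n. g c t * Y c)) = (\<Sum>a<n. \<Sum>c<n. of_bool (c = a) * (X a * Y c))"
    unfolding sum_bilinear by (intro sum.cong refl) (auto simp: assms)
  also have "\<dots> = (\<Sum>a<n. X a * Y a)"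
    by (intro sum.cong refl sum_of_bool_mult) simp
  finally show ?thesis .
qed

text \<open>Orthonormal rows of \<open>f\<close> make the adjoint of \<open>f\<close> an
  isometry.\<close>

lemma sum_cmod_isometry:
  fixes v :: "nat \<Rightarrow> complex"
  assumes "\<And>a c. a < n \<Longrightarrow> c < n \<Longrightarrow> (\<Sum>t\<in>T. f a t * cnj (f c t)) = of_bool (a = c)"
  shows "(\<Sum>t\<in>T. (cmod (\<Sum>a<n. cnj (f a t) * v a))\<^sup>2) = (\<Sum>a<n. (cmod (v a))\<^sup>2)"
proof -
  have "complex_of_real (\<Sum>t\<in>T. (cmod (\<Sum>a<n. cnj (f a t) * v a))\<^sup>2)
      = (\<Sum>t\<in>T. (\<Sum>a<n. cnj (v a) * f a t) * (\<Sum>c<n. cnj (f c t) * v c))"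
    by (simp add: complex_norm_square mult.commute del: of_real_power)
  also have "\<dots> = (\<Sum>a<n. cnj (v a) * v a)"
    by (rule sum_delta_bilinear) (rule assms)
  also have "\<dots> = complex_of_real (\<Sum>a<n. (cmod (v a))\<^sup>2)"
    by (simp add: complex_norm_square mult.commute del: of_real_power)
  finally show ?thesis by (simp only: of_real_eq_iff)
qed

lemma kron_one_left_entry:
  assumes "B \<in> carrier_mat b b'" "I < m" "k < b" "J < m" "l < b'"
  shows "(1\<^sub>m m \<otimes>\<^sub>m B) $$ (I * b + k, J * b' + l) = of_bool (I = J) * B $$ (k, l)"
  using assms by (simp add: kron_def lessThan_times_index)

section \<open>Transfer map and chain state in coordinates\<close>

lemma fcs_transfer_carrier:
  assumes "V \<in> carrier_mat b (d * b)" "B \<in> carrier_mat b b"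
  shows "fcs_transfer d V B \<in> carrier_mat b b"
proof -
  have "1\<^sub>m d \<otimes>\<^sub>m B \<in> carrier_mat (d * b) (d * b)" using assms by simp
  then have "V * (1\<^sub>m d \<otimes>\<^sub>m B) \<in> carrier_mat b (d * b)" using assms by simp
  then show ?thesis
    using assms by (simp add: fcs_transfer_def fcs_map_def mult_carrier_mat[of _ b "d * b"])
qed

lemma fcs_transfer_entry:
  assumes V: "V \<in> carrier_mat b (d * b)" and B: "B \<in> carrier_mat b b" and pq: "p < b" "q < b"
  shows "fcs_transfer d V B $$ (p, q)
    = (\<Sum>s<d. \<Sum>k<b. \<Sum>l<b. V $$ (p, s * b + k) * B $$ (k, l) * cnj (V $$ (q, s * b + l)))"
proof -
  have K: "1\<^sub>m d \<otimes>\<^sub>m B \<in> carrier_mat (d * b) (d * b)" using B by simp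
  have VK: "V * (1\<^sub>m d \<otimes>\<^sub>m B) \<in> carrier_mat b (d * b)" using V K by simp
  have VKe: "(V * (1\<^sub>m d \<otimes>\<^sub>m B)) $$ (p, s * b + l) = (\<Sum>k<b. V $$ (p, s * b + k) * B $$ (k, l))"
    if sl: "s < d" "l < b" for s l
  proof -
    have "(V * (1\<^sub>m d \<otimes>\<^sub>m B)) $$ (p, s * b + l)
        = (\<Sum>s'<d. \<Sum>k<b. V $$ (p, s' * b + k) * (1\<^sub>m d \<otimes>\<^sub>m B) $$ (s' * b + k, s * b + l))"
      using mat_mult_entry[OF V K pq(1) lessThan_times_index[OF sl]] by (simp add: sum_lessThan_times)
    also have "\<dots> = (\<Sum>s'<d. if s' = s then \<Sum>k<b. V $$ (p, s' * b + k) * B $$ (k, l) else 0)"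
      using sl by (intro sum.cong) (auto simp: kron_one_left_entry[OF B])
    finally show ?thesis using sl by simp
  qed
  have "fcs_transfer d V B $$ (p, q)
      = (\<Sum>s<d. \<Sum>l<b. (V * (1\<^sub>m d \<otimes>\<^sub>m B)) $$ (p, s * b + l) * mat_adjoint V $$ (s * b + l, q))"
    unfolding fcs_transfer_def fcs_map_def
    using mat_mult_entry[OF VK mat_adjoint_carrier[OF V] pq] by (simp add: sum_lessThan_times)
  also have "\<dots> = (\<Sum>s<d. \<Sum>l<b. \<Sum>k<b. V $$ (p, s * b + k) * B $$ (k, l) * cnj (V $$ (q, s * b + l)))"
    using pq by (intro sum.cong refl)
      (simp add: VKe mat_adjoint_entry[OF V] lessThan_times_index sum_distrib_right del: index_mult_mat)
  also have "\<dots> = (\<Sum>s<d. \<Sum>k<b. \<Sum>l<b. V $$ (p, s * b + k) * B $$ (k, l) * cnj (V $$ (q, s * b + l)))"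
    by (intro sum.cong refl sum.swap)
  finally show ?thesis .
qed

text \<open>
  \<open>chain_amp d b V m\<close> is the matrix product operator \<open>V (1 \<otimes> V) \<dots>\<close> with \<open>m\<close> factors, from
  $m$ spins (index \<open>J\<close>) and the memory (index \<open>k\<close>) to the memory (index \<open>p\<close>).
\<close>

fun chain_amp :: "nat \<Rightarrow> nat \<Rightarrow> complex mat \<Rightarrow> nat \<Rightarrow> nat \<Rightarrow> nat \<Rightarrow> nat \<Rightarrow> complex" where
  "chain_amp d b V 0 p J k = of_bool (p = k)"
| "chain_amp d b V (Suc m) p J k = (\<Sum>l<b. chain_amp d b V m p (J div d) l * V $$ (l, J mod d * b + k))"

text \<open>No factor of \<open>V_iter\<close> touches site 1, hence the delta in \<open>i\<close>
  and \<open>i'\<close>. Since \<open>V_iter\<close> starts from the identity, \<open>Suc m\<close>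
  sites correspond to \<open>m\<close> factors of \<open>V\<close>; the first spin is already part
  of \<open>rho_AB\<close>.\<close>

lemma V_iter_entry:
  assumes V: "V \<in> carrier_mat b (d * b)"
    and "i < d" "p < b" "i' < d" "J < d ^ m" "k < b"
  shows "V_iter d b V (Suc m) $$ (i * b + p, (i' * d ^ m + J) * b + k) = of_bool (i = i') * chain_amp d b V m p J k"
  using assms(2-)
proof (induction m arbitrary: i' J k)
  case 0
  then have "i * b + p < d * b" "i' * b + k < d * b"
    by (auto intro: lessThan_times_index)
  moreover have "i * b + p = i' * b + k \<longleftrightarrow> i = i' \<and> p = k"
    using 0 by (metis div_mult_self3 mod_mult_self3 div_less mod_less add_0_right bot_nat_0.not_eq_extremum less_zeroE)
  ultimately show ?case using 0 by auto
next
  case (Suc m)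
  let ?K = "1\<^sub>m (d ^ Suc m) \<otimes>\<^sub>m V"
  have W: "V_iter d b V (Suc m) \<in> carrier_mat (d * b) (d ^ Suc m * b)"
    using V_iter_carrier[OF V, of "Suc m"] by simp
  have K: "?K \<in> carrier_mat (d ^ Suc m * b) (d ^ Suc m * (d * b))"
    using V by (intro kron_carrier) auto
  have d: "0 < d" using Suc.prems by simp
  define I1 where "I1 = i' * d ^ m + J div d"
  have Jd: "J div d < d ^ m"
    using Suc.prems by (intro less_mult_imp_div_less) (simp add: mult.commute)
  have I1: "I1 < d ^ Suc m"
    unfolding I1_def using lessThan_times_index[OF Suc.prems(3) Jd] by (simp add: mult.commute)
  have sk: "J mod d * b + k < d * b"
    using Suc.prems d by (intro lessThan_times_index) auto
  \<comment> \<open>Two readings of one column index: the last spin \<open>J mod d\<close> is split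
    off the chain and joined to the memory index, which matches the factors of
    \<open>1 \<otimes> V\<close>.\<close>
  have col: "(i' * d ^ Suc m + J) * b + k = I1 * (d * b) + (J mod d * b + k)"
  proof -
    have "(i' * (d * D) + (A * d + s)) * b + k = (i' * D + A) * (d * b) + (s * b + k)" for A D s
      by (simp add: algebra_simps)
    from this[of "d ^ m" "J div d" "J mod d"] show ?thesis
      by (simp add: I1_def)
  qed
  have colb: "(i' * d ^ Suc m + J) * b + k < d ^ Suc m * (d * b)"
    unfolding col by (rule lessThan_times_index[OF I1 sk])
  have row: "i * b + p < d * b" using Suc.prems by (intro lessThan_times_index)
  have "V_iter d b V (Suc (Suc m)) $$ (i * b + p, (i' * d ^ Suc m + J) * b + k)
      = (\<Sum>I<d ^ Suc m. \<Sum>l<b. V_iter d b V (Suc m) $$ (i * b + p, I * b + l) * ?K $$ (I * b + l, I1 * (d * b) + (J mod d * b + k)))"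
    unfolding V_iter.simps mat_mult_entry[OF W K row colb]
    unfolding sum_lessThan_times col ..
  also have "\<dots> = (\<Sum>I<d ^ Suc m. if I = I1 then
      \<Sum>l<b. V_iter d b V (Suc m) $$ (i * b + p, I * b + l) * V $$ (l, J mod d * b + k) else 0)"
    using I1 sk by (intro sum.cong) (auto simp: kron_one_left_entry[OF V] simp del: power_Suc)
  also have "\<dots> = (\<Sum>l<b. V_iter d b V (Suc m) $$ (i * b + p, I1 * b + l) * V $$ (l, J mod d * b + k))"
    using I1 by (simp del: power_Suc)
  also have "\<dots> = of_bool (i = i') * chain_amp d b V (Suc m) p J k"
    unfolding I1_def using Suc.IH[OF Suc.prems(1-3) Jd] by (simp add: sum_distrib_left mult.assoc)
  finally show ?case .
qed

lemma rho_AB_carrier: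
  assumes "V \<in> carrier_mat b (d * b)" "\<rho> \<in> carrier_mat b b"
  shows "rho_AB V \<rho> \<in> carrier_mat (d * b) (d * b)"
proof -
  have "mat_adjoint V * \<rho> \<in> carrier_mat (d * b) b"
    by (rule mult_carrier_mat[of _ _ b]) (use assms in auto)
  then show ?thesis
    unfolding rho_AB_def using assms(1) by (rule mult_carrier_mat)
qed

lemma mat_adjoint_conj_entry:
  assumes W: "W \<in> carrier_mat m n" and X: "X \<in> carrier_mat m m" and ij: "i < n" "j < n"
  shows "(mat_adjoint W * X * W) $$ (i, j) = (\<Sum>P<m. \<Sum>Q<m. cnj (W $$ (P, i)) * X $$ (P, Q) * W $$ (Q, j))"
proof -
  have WX: "mat_adjoint W * X \<in> carrier_mat n m"
    by (rule mult_carrier_mat[of _ _ m]) (use assms in auto)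
  have "(mat_adjoint W * X * W) $$ (i, j) = (\<Sum>Q<m. (\<Sum>P<m. cnj (W $$ (P, i)) * X $$ (P, Q)) * W $$ (Q, j))"
    unfolding mat_mult_entry[OF WX W ij]
    using ij by (intro sum.cong refl) (simp add: mat_mult_entry[OF mat_adjoint_carrier[OF W] X] mat_adjoint_entry[OF W] del: index_mult_mat)
  then show ?thesis
    unfolding sum_distrib_right by (subst sum.swap)
qed

lemma rho_chain_entry:
  assumes V: "V \<in> carrier_mat b (d * b)" and \<rho>: "\<rho> \<in> carrier_mat b b"
    and ij: "i < d" "j < d" "I < d ^ m" "J < d ^ m"
  shows "rho_chain d b V \<rho> (Suc m) $$ (i * d ^ m + I, j * d ^ m + J)
    = (\<Sum>k<b. \<Sum>p<b. \<Sum>q<b. cnj (chain_amp d b V m p I k) * rho_AB V \<rho> $$ (i * b + p, j * b + q) * chain_amp d b V m q J k)"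
proof -
  let ?R = "rho_AB V \<rho>"
  let ?W = "V_iter d b V (Suc m)"
  have W: "?W \<in> carrier_mat (d * b) (d ^ Suc m * b)"
    using V_iter_carrier[OF V, of "Suc m"] by simp
  have idx: "i * d ^ m + I < d ^ Suc m" "j * d ^ m + J < d ^ Suc m"
    using lessThan_times_index[OF ij(1,3)] lessThan_times_index[OF ij(2,4)] by (auto simp: mult.commute)
  have "rho_chain d b V \<rho> (Suc m) $$ (i * d ^ m + I, j * d ^ m + J)
      = (\<Sum>k<b. (mat_adjoint ?W * ?R * ?W) $$ ((i * d ^ m + I) * b + k, (j * d ^ m + J) * b + k))"
    using idx by (simp add: rho_chain_def ptrace2_def del: power_Suc V_iter.simps)
  also have "\<dots> = (\<Sum>k<b. \<Sum>P<d * b. \<Sum>Q<d * b. cnj (?W $$ (P, (i * d ^ m + I) * b + k)) * ?R $$ (P, Q)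
      * ?W $$ (Q, (j * d ^ m + J) * b + k))"
    using idx by (intro sum.cong refl mat_adjoint_conj_entry[OF W rho_AB_carrier[OF V \<rho>]] lessThan_times_index) auto
  also have "\<dots> = (\<Sum>k<b. \<Sum>i'<d. \<Sum>p<b. \<Sum>j'<d. \<Sum>q<b. of_bool (i' = i) * (of_bool (j' = j) *
      (cnj (chain_amp d b V m p I k) * ?R $$ (i' * b + p, j' * b + q) * chain_amp d b V m q J k)))"
    unfolding sum_lessThan_times using ij
    by (intro sum.cong refl) (simp add: V_iter_entry[OF V] del: V_iter.simps)
  also have "\<dots> = (\<Sum>k<b. \<Sum>i'<d. of_bool (i' = i) * (\<Sum>p<b. \<Sum>j'<d. of_bool (j' = j) * (\<Sum>q<b.
      cnj (chain_amp d b V m p I k) * ?R $$ (i' * b + p, j' * b + q) * chain_amp d b V m q J k)))"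
    by (simp only: sum_distrib_left)
  also have "\<dots> = (\<Sum>k<b. \<Sum>p<b. \<Sum>q<b. cnj (chain_amp d b V m p I k) * ?R $$ (i * b + p, j * b + q) * chain_amp d b V m q J k)"
    by (simp only: sum_of_bool_mult ij)
  finally show ?thesis .
qed

text \<open>The traced-out memory index is exactly the Kraus index. The conjugate appears because a
  density matrix is transported by the adjoint of the map acting on observables.\<close>

lemma rho_chain_eq_local_kraus:
  assumes V: "V \<in> carrier_mat b (d * b)" and \<rho>: "\<rho> \<in> carrier_mat b b" and d: "0 < d"
  shows "rho_chain d b V \<rho> (Suc m)
    = local_kraus d b (d ^ m) b (\<lambda>k J p. cnj (chain_amp d b V m p J k)) (rho_AB V \<rho>)" (is "_ = ?L")
proof (rule eq_matI)
  fix I J assume "I < dim_row ?L" "J < dim_col ?L"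
  then have IJ: "I < d * d ^ m" "J < d * d ^ m" by (auto simp: local_kraus_def)
  have "rho_chain d b V \<rho> (Suc m) $$ (I div d ^ m * d ^ m + I mod d ^ m, J div d ^ m * d ^ m + J mod d ^ m) = ?L $$ (I, J)"
    using IJ d by (subst rho_chain_entry[OF V \<rho>]) (auto simp: local_kraus_def less_mult_imp_div_less)
  then show "rho_chain d b V \<rho> (Suc m) $$ (I, J) = ?L $$ (I, J)"
    by (simp only: div_mult_mod_eq)
qed (auto simp: rho_chain_def ptrace2_def local_kraus_def)

text \<open>Peeling off the last spin replaces \<open>B\<close> by its image under one transfer
  step, so the induction must run over all \<open>B\<close>.\<close>

lemma chain_amp_transfer:
  assumes V: "V \<in> carrier_mat b (d * b)" and B: "B \<in> carrier_mat b b" and pq: "p < b" "q < b"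
  shows "(\<Sum>J<d ^ m. \<Sum>k<b. \<Sum>l<b. chain_amp d b V m p J k * B $$ (k, l) * cnj (chain_amp d b V m q J l))
    = (fcs_transfer d V ^^ m) B $$ (p, q)"
  using B
proof (induction m arbitrary: B)
  case 0
  have "(\<Sum>J<d ^ 0. \<Sum>k<b. \<Sum>l<b. chain_amp d b V 0 p J k * B $$ (k, l) * cnj (chain_amp d b V 0 q J l))
     = (\<Sum>k<b. of_bool (k = p) * (\<Sum>l<b. of_bool (l = q) * B $$ (k, l)))"
    by (auto simp: of_bool_def sum_distrib_left intro!: sum.cong)
  then show ?case using pq by (simp only: sum_of_bool_mult funpow_0)
next
  case (Suc m)
  let ?c = "chain_amp d b V m"
  have inner: "(\<Sum>s<d. \<Sum>k<b. \<Sum>l<b. (\<Sum>a<b. ?c p J a * V $$ (a, s * b + k)) * B $$ (k, l)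
        * cnj (\<Sum>a<b. ?c q J a * V $$ (a, s * b + l)))
      = (\<Sum>a<b. \<Sum>a'<b. ?c p J a * fcs_transfer d V B $$ (a, a') * cnj (?c q J a'))" for J
  proof -
    \<comment> \<open>The triple of last spin and two memory indices is treated as one inner index;
      \<open>B\<close> is attached to \<open>f\<close>, so the contraction of \<open>f\<close> with
      \<open>g\<close> is an entry of the transferred \<open>B\<close>.\<close>
    define f where "f = (\<lambda>a (s, k, l). V $$ (a, s * b + k) * B $$ (k, l))"
    define g where "g = (\<lambda>a (s :: nat, k :: nat, l). cnj (V $$ (a, s * b + l)))"
    let ?T = "{..<d} \<times> {..<b} \<times> {..<b}"
    have "(\<Sum>s<d. \<Sum>k<b. \<Sum>l<b. (\<Sum>a<b. ?c p J a * V $$ (a, s * b + k)) * B $$ (k, l)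
        * cnj (\<Sum>a<b. ?c q J a * V $$ (a, s * b + l)))
      = (\<Sum>t\<in>?T. (\<Sum>a<b. ?c p J a * f a t) * (\<Sum>a<b. g a t * cnj (?c q J a)))"
    proof -
      have "(\<Sum>a<b. ?c p J a * f a (s, k, l)) = (\<Sum>a<b. ?c p J a * V $$ (a, s * b + k)) * B $$ (k, l)" for s k l
        by (simp add: f_def sum_distrib_right mult.assoc)
      moreover have "(\<Sum>a<b. g a (s, k, l) * cnj (?c q J a)) = cnj (\<Sum>a<b. ?c q J a * V $$ (a, s * b + l))" for s k l
        by (simp add: g_def mult.commute)
      ultimately show ?thesis
        by (simp only: sum.cartesian_product')
    qed
    also have "\<dots> = (\<Sum>a<b. \<Sum>a'<b. ?c p J a * (\<Sum>t\<in>?T. f a t * g a' t) * cnj (?c q J a'))"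
      by (rule sum_bilinear)
    also have "\<dots> = (\<Sum>a<b. \<Sum>a'<b. ?c p J a * fcs_transfer d V B $$ (a, a') * cnj (?c q J a'))"
      by (intro sum.cong refl) (simp add: sum.cartesian_product' f_def g_def fcs_transfer_entry[OF V Suc.prems])
    finally show ?thesis .
  qed
  have "(\<Sum>J<d ^ Suc m. \<Sum>k<b. \<Sum>l<b. chain_amp d b V (Suc m) p J k * B $$ (k, l) * cnj (chain_amp d b V (Suc m) q J l))
      = (\<Sum>J<d ^ m. \<Sum>s<d. \<Sum>k<b. \<Sum>l<b. (\<Sum>a<b. ?c p J a * V $$ (a, s * b + k)) * B $$ (k, l)
        * cnj (\<Sum>a<b. ?c q J a * V $$ (a, s * b + l)))"
    by (simp add: mult.commute[of d] sum_lessThan_times)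
  also have "\<dots> = (\<Sum>J<d ^ m. \<Sum>a<b. \<Sum>a'<b. ?c p J a * fcs_transfer d V B $$ (a, a') * cnj (?c q J a'))"
    unfolding inner ..
  also have "\<dots> = (fcs_transfer d V ^^ Suc m) B $$ (p, q)"
    using Suc.IH[OF fcs_transfer_carrier[OF V Suc.prems]] by (simp add: funpow_swap1)
  finally show ?case .
qed

lemma fcs_transfer_one:
  assumes V: "V \<in> carrier_mat b (d * b)" "V * mat_adjoint V = 1\<^sub>m b"
  shows "fcs_transfer d V (1\<^sub>m b) = 1\<^sub>m b"
proof -
  have "1\<^sub>m d \<otimes>\<^sub>m 1\<^sub>m b = (1\<^sub>m (d * b) :: complex mat)"
  proof (rule eq_matI)
    fix I J assume "I < dim_row (1\<^sub>m (d * b) :: complex mat)" "J < dim_col (1\<^sub>m (d * b) :: complex mat)"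
    then have IJ: "I < d * b" "J < d * b" by auto
    then have "0 < b" by (cases b) auto
    then have "I = J \<longleftrightarrow> I div b = J div b \<and> I mod b = J mod b"
      by (metis div_mult_mod_eq)
    then show "(1\<^sub>m d \<otimes>\<^sub>m 1\<^sub>m b) $$ (I, J) = (1\<^sub>m (d * b) :: complex mat) $$ (I, J)"
      using IJ \<open>0 < b\<close> by (auto simp: kron_def less_mult_imp_div_less)
  qed (auto simp: kron_def)
  then show ?thesis using V by (simp add: fcs_transfer_def fcs_map_def)
qed

text \<open>The case \<open>B = 1\<close> of \<open>chain_amp_transfer\<close>: unitality of the
  transfer map passes to its powers.\<close>

lemma chain_amp_orthonormal:
  assumes V: "V \<in> carrier_mat b (d * b)" "V * mat_adjoint V = 1\<^sub>m b" and pq: "p < b" "q < b"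
  shows "(\<Sum>J<d ^ m. \<Sum>k<b. chain_amp d b V m p J k * cnj (chain_amp d b V m q J k)) = of_bool (p = q)"
proof -
  have "(fcs_transfer d V ^^ m) (1\<^sub>m b) = 1\<^sub>m b"
    by (induction m) (auto simp: fcs_transfer_one[OF V])
  moreover have "(\<Sum>J<d ^ m. \<Sum>k<b. \<Sum>l<b. chain_amp d b V m p J k * 1\<^sub>m b $$ (k, l) * cnj (chain_amp d b V m q J l))
      = (\<Sum>J<d ^ m. \<Sum>k<b. \<Sum>l<b. if l = k then chain_amp d b V m p J k * cnj (chain_amp d b V m q J l) else 0)"
    by (intro sum.cong refl) auto
  ultimately show ?thesis
    using chain_amp_transfer[OF V(1) one_carrier_mat pq, of m] pq by simp
qed

lemma mat_trace_local_kraus: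
  assumes \<sigma>: "\<sigma> \<in> carrier_mat (m * n1) (m * n1)"
    and tp: "\<And>e e'. e < n1 \<Longrightarrow> e' < n1 \<Longrightarrow> (\<Sum>k<r. \<Sum>c<n2. Kr k c e * cnj (Kr k c e')) = of_bool (e = e')"
  shows "mat_trace (local_kraus m n1 n2 r Kr \<sigma>) = mat_trace \<sigma>"
proof -
  have "mat_trace (local_kraus m n1 n2 r Kr \<sigma>) = (\<Sum>i<m. \<Sum>c<n2. \<Sum>k<r. \<Sum>e<n1. \<Sum>e'<n1.
     Kr k c e * \<sigma> $$ (i * n1 + e, i * n1 + e') * cnj (Kr k c e'))"
    by (simp add: mat_trace_def local_kraus_def lessThan_times_index sum_lessThan_times)
  also have "\<dots> = (\<Sum>i<m. \<Sum>e<n1. \<Sum>e'<n1. \<Sum>k<r. \<Sum>c<n2.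
     \<sigma> $$ (i * n1 + e, i * n1 + e') * (Kr k c e * cnj (Kr k c e')))"
  proof (rule sum.cong[OF refl])
    fix i
    let ?F = "\<lambda>c k e e'. \<sigma> $$ (i * n1 + e, i * n1 + e') * (Kr k c e * cnj (Kr k c e'))"
    have "(\<Sum>c<n2. \<Sum>k<r. \<Sum>e<n1. \<Sum>e'<n1. Kr k c e * \<sigma> $$ (i * n1 + e, i * n1 + e') * cnj (Kr k c e'))
        = (\<Sum>(c, k)\<in>{..<n2} \<times> {..<r}. \<Sum>(e, e')\<in>{..<n1} \<times> {..<n1}. ?F c k e e')"
      by (simp add: sum.cartesian_product' mult_ac)
    also have "\<dots> = (\<Sum>(e, e')\<in>{..<n1} \<times> {..<n1}. \<Sum>(c, k)\<in>{..<n2} \<times> {..<r}. ?F c k e e')"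
      unfolding split_beta by (rule sum.swap)
    also have "\<dots> = (\<Sum>e<n1. \<Sum>e'<n1. \<Sum>c<n2. \<Sum>k<r. ?F c k e e')"
      by (simp add: sum.cartesian_product')
    also have "\<dots> = (\<Sum>e<n1. \<Sum>e'<n1. \<Sum>k<r. \<Sum>c<n2. ?F c k e e')"
      by (intro sum.cong refl sum.swap)
    finally show "(\<Sum>c<n2. \<Sum>k<r. \<Sum>e<n1. \<Sum>e'<n1. Kr k c e * \<sigma> $$ (i * n1 + e, i * n1 + e') * cnj (Kr k c e'))
        = (\<Sum>e<n1. \<Sum>e'<n1. \<Sum>k<r. \<Sum>c<n2. ?F c k e e')" .
  qed
  also have "\<dots> = (\<Sum>i<m. \<Sum>e<n1. \<Sum>e'<n1. if e' = e then \<sigma> $$ (i * n1 + e, i * n1 + e') else 0)"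
    by (intro sum.cong refl) (auto simp: tp simp flip: sum_distrib_left)
  also have "\<dots> = (\<Sum>i<m. \<Sum>e<n1. \<sigma> $$ (i * n1 + e, i * n1 + e))" by simp
  also have "\<dots> = mat_trace \<sigma>"
    using \<sigma> by (simp add: mat_trace_def sum_lessThan_times)
  finally show ?thesis .
qed

text \<open>The adjoint of \<open>V\<close> is an isometry, so it carries the eigenvectors of
  \<open>\<rho>\<close> to unit vectors. The eigenvalues serve as weights.\<close>

lemma rho_AB_pure_decomposition:
  assumes V: "V \<in> carrier_mat b (d * b)" "V * mat_adjoint V = 1\<^sub>m b" and \<rho>: "density_mat b \<rho>"
  obtains p s where "pure_decomposition (d * b) (rho_AB V \<rho>) b p s"
proof -
  obtain U x where U: "unitary_mat b U" and eq: "\<rho> = U * mat_diag b (\<lambda>i. complex_of_real (x i)) * mat_adjoint U"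
    and x: "\<And>i. i < b \<Longrightarrow> 0 \<le> x i" "(\<Sum>i<b. x i) = 1"
    using density_mat_diagonalize[OF \<rho>] by blast
  have \<rho>c: "\<rho> \<in> carrier_mat b b" using \<rho> by (simp add: density_mat_def)
  define v where "v k I = (\<Sum>a<b. cnj (V $$ (a, I)) * U $$ (a, k))" for k I
  have VV: "(\<Sum>I<d * b. V $$ (a, I) * cnj (V $$ (c, I))) = of_bool (a = c)" if "a < b" "c < b" for a c
    using arg_cong[OF V(2), of "\<lambda>M. M $$ (a, c)"] mat_mult_entry[OF V(1) mat_adjoint_carrier[OF V(1)] that] that
    by (simp add: mat_adjoint_entry[OF V(1)] del: index_mult_mat)
  have "pure_decomposition (d * b) (rho_AB V \<rho>) b x (\<lambda>k. proj_mat (d * b) (v k))"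
    unfolding pure_decomposition_def
  proof (intro conjI allI impI)
    fix k assume k: "k < b"
    show "0 \<le> x k" using x k by simp
    have "(\<Sum>a<b. (cmod (U $$ (a, k)))\<^sup>2) = 1"
      using unitary_matD(3)[OF U k k]
      by (simp add: complex_eq_iff mult.commute[of "cnj _"] flip: complex_norm_square of_real_sum)
    then have "(\<Sum>I<d * b. (cmod (v k I))\<^sup>2) = 1"
      unfolding v_def using sum_cmod_isometry[where T = "{..<d * b}" and f = "\<lambda>a I. V $$ (a, I)", OF VV] by simp
    then show "pure_state (d * b) (proj_mat (d * b) (v k))" by (rule pure_state_proj_mat)
  next
    show "(\<Sum>k<b. x k) = 1" by (rule x(2))
    show "rho_AB V \<rho> = mat (d * b) (d * b) (\<lambda>(i, j). \<Sum>k<b. complex_of_real (x k) * proj_mat (d * b) (v k) $$ (i, j))"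
      (is "_ = ?M")
    proof (rule eq_matI)
      fix I J assume "I < dim_row ?M" "J < dim_col ?M"
      then have IJ: "I < d * b" "J < d * b" by auto
      have "rho_AB V \<rho> $$ (I, J) = (\<Sum>a<b. \<Sum>c<b. cnj (V $$ (a, I)) * \<rho> $$ (a, c) * V $$ (c, J))"
        unfolding rho_AB_def by (rule mat_adjoint_conj_entry[OF V(1) \<rho>c IJ])
      also have "\<dots> = (\<Sum>a<b. \<Sum>c<b. cnj (V $$ (a, I)) *
          (\<Sum>k<b. (complex_of_real (x k) * U $$ (a, k)) * cnj (U $$ (c, k))) * V $$ (c, J))"
        unfolding eq using unitary_matD(1)[OF U]
        by (intro sum.cong refl) (simp add: diag_conj_entry mult_ac del: index_mult_mat(1))
      also have "\<dots> = (\<Sum>k<b. (\<Sum>a<b. cnj (V $$ (a, I)) * (complex_of_real (x k) * U $$ (a, k))) * (\<Sum>c<b. cnj (U $$ (c, k)) * V $$ (c, J)))"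
        by (rule sum_bilinear[symmetric])
      also have "\<dots> = (\<Sum>k<b. complex_of_real (x k) * (v k I * cnj (v k J)))"
      proof (intro sum.cong refl)
      fix k
      have "(\<Sum>a<b. cnj (V $$ (a, I)) * (complex_of_real (x k) * U $$ (a, k))) = complex_of_real (x k) * v k I"
        by (simp add: v_def sum_distrib_left mult.left_commute)
      moreover have "(\<Sum>c<b. cnj (U $$ (c, k)) * V $$ (c, J)) = cnj (v k J)"
        by (simp add: v_def mult.commute)
      ultimately show "(\<Sum>a<b. cnj (V $$ (a, I)) * (complex_of_real (x k) * U $$ (a, k)))
          * (\<Sum>c<b. cnj (U $$ (c, k)) * V $$ (c, J)) = complex_of_real (x k) * (v k I * cnj (v k J))"
        by simp
    qed
      finally show "rho_AB V \<rho> $$ (I, J) = ?M $$ (I, J)"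
        using IJ by (simp add: proj_mat_def)
    qed (use rho_AB_carrier[OF V(1) \<rho>c] in auto)
  qed
  then show ?thesis by (rule that)
qed

section \<open>Exponential decay of the transfer map\<close>

text \<open>Power-boundedness, later used to exclude eigenvalues of modulus above 1. The amplitudes
  belonging to a fixed output index have total squared norm 1; the inequality between arithmetic and
  geometric mean leaves one free memory sum, which gives the factor \<open>b\<close>.\<close>

lemma fcs_transfer_funpow_bound:
  assumes V: "V \<in> carrier_mat b (d * b)" "V * mat_adjoint V = 1\<^sub>m b" and B: "B \<in> carrier_mat b b"
    and \<beta>: "\<And>k l. k < b \<Longrightarrow> l < b \<Longrightarrow> cmod (B $$ (k, l)) \<le> \<beta>" and pq: "p < b" "q < b"
  shows "cmod ((fcs_transfer d V ^^ m) B $$ (p, q)) \<le> \<beta> * real b"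
proof -
  let ?c = "chain_amp d b V m"
  have \<beta>0: "0 \<le> \<beta>" using \<beta>[OF pq] norm_ge_zero order_trans by blast
  have norm1: "(\<Sum>J<d ^ m. \<Sum>k<b. (cmod (?c p J k))\<^sup>2) = 1" if "p < b" for p
  proof -
    have "complex_of_real (\<Sum>J<d ^ m. \<Sum>k<b. (cmod (?c p J k))\<^sup>2) = complex_of_real 1"
      using chain_amp_orthonormal[OF V that that, of m] by (simp add: complex_norm_square del: of_real_power)
    then show ?thesis by (simp only: of_real_eq_iff)
  qed
  have "cmod ((fcs_transfer d V ^^ m) B $$ (p, q))
      \<le> (\<Sum>J<d ^ m. \<Sum>k<b. \<Sum>l<b. cmod (?c p J k * B $$ (k, l) * cnj (?c q J l)))"
    unfolding chain_amp_transfer[OF V(1) B pq, symmetric]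
    by (intro order_trans[OF norm_sum] sum_mono order_refl)
  also have "\<dots> \<le> (\<Sum>J<d ^ m. \<Sum>k<b. \<Sum>l<b. \<beta> * (((cmod (?c p J k))\<^sup>2 + (cmod (?c q J l))\<^sup>2) / 2))"
  proof (intro sum_mono)
    fix J k l assume "k \<in> {..<b}" "l \<in> {..<b}"
    then have kl: "cmod (B $$ (k, l)) \<le> \<beta>" by (intro \<beta>) auto
    have am: "x * y \<le> (x\<^sup>2 + y\<^sup>2) / 2" for x y :: real
      using sum_squares_bound[of x y] by simp
    have "cmod (?c p J k * B $$ (k, l) * cnj (?c q J l)) = cmod (B $$ (k, l)) * (cmod (?c p J k) * cmod (?c q J l))"
      by (simp add: norm_mult)
    also have "\<dots> \<le> \<beta> * (((cmod (?c p J k))\<^sup>2 + (cmod (?c q J l))\<^sup>2) / 2)"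
      using kl \<beta>0 by (intro mult_mono am) auto
    finally show "cmod (?c p J k * B $$ (k, l) * cnj (?c q J l))
      \<le> \<beta> * (((cmod (?c p J k))\<^sup>2 + (cmod (?c q J l))\<^sup>2) / 2)" .
  qed
  also have "\<dots> = (\<Sum>J<d ^ m. \<Sum>k<b. \<Sum>l<b. \<beta> / 2 * (cmod (?c p J k))\<^sup>2)
      + (\<Sum>J<d ^ m. \<Sum>k<b. \<Sum>l<b. \<beta> / 2 * (cmod (?c q J l))\<^sup>2)"
    unfolding sum.distrib[symmetric] by (intro sum.cong refl) (simp add: field_simps)
  also have "(\<Sum>J<d ^ m. \<Sum>k<b. \<Sum>l<b. \<beta> / 2 * (cmod (?c p J k))\<^sup>2) = \<beta> / 2 * real b * (\<Sum>J<d ^ m. \<Sum>k<b. (cmod (?c p J k))\<^sup>2)"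
    by (simp add: sum_distrib_left mult_ac)
  also have "(\<Sum>J<d ^ m. \<Sum>k<b. \<Sum>l<b. \<beta> / 2 * (cmod (?c q J l))\<^sup>2) = \<beta> / 2 * real b * (\<Sum>J<d ^ m. \<Sum>k<b. (cmod (?c q J k))\<^sup>2)"
    by (simp add: sum_distrib_left mult_ac)
  also have "\<beta> / 2 * real b * (\<Sum>J<d ^ m. \<Sum>k<b. (cmod (?c p J k))\<^sup>2)
      + \<beta> / 2 * real b * (\<Sum>J<d ^ m. \<Sum>k<b. (cmod (?c q J k))\<^sup>2) = \<beta> * real b"
    unfolding norm1[OF pq(1)] norm1[OF pq(2)] by simp
  finally show ?thesis .
qed

section \<open>The vectorised transfer map and its spectrum\<close>

lemma smult_mat_mult_vec:
  fixes c :: "'a :: semiring_0"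
  assumes "A \<in> carrier_mat n m" "v \<in> carrier_vec m"
  shows "(c \<cdot>\<^sub>m A) *\<^sub>v v = c \<cdot>\<^sub>v (A *\<^sub>v v)"
  using assms by (intro eq_vecI) (auto simp: scalar_prod_def sum_distrib_left mult.assoc intro!: sum.cong)

lemma mat_mult_vec_entry:
  fixes A :: "'a :: semiring_0 mat"
  assumes "A \<in> carrier_mat n m" "v \<in> carrier_vec m" "i < n"
  shows "(A *\<^sub>v v) $ i = (\<Sum>k<m. A $$ (i, k) * v $ k)"
  using assms by (auto simp: scalar_prod_def atLeast0LessThan intro!: sum.cong)

text \<open>Row-major vectorisation, so that the theory of spectral radii of matrices applies to a
  map between matrices.\<close>

definition mat_to_vec :: "nat \<Rightarrow> complex mat \<Rightarrow> complex vec" where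
  "mat_to_vec b B = vec (b * b) (\<lambda>K. B $$ (K div b, K mod b))"

text \<open>\<open>deflated_transfer\<close> represents \<open>B \<mapsto> fcs_transfer d V B - Tr (\<rho> B) 1\<close>, the transfer map
  with its eigenvalue 1 removed.\<close>

definition deflated_transfer :: "nat \<Rightarrow> nat \<Rightarrow> complex mat \<Rightarrow> complex mat \<Rightarrow> complex mat" where
  "deflated_transfer d b V \<rho> = mat (b * b) (b * b) (\<lambda>(P, K).
     (\<Sum>s<d. V $$ (P div b, s * b + K div b) * cnj (V $$ (P mod b, s * b + K mod b)))
     - of_bool (P div b = P mod b) * \<rho> $$ (K mod b, K div b))"

lemma mat_trace_mult:
  assumes "A \<in> carrier_mat n n" "B \<in> carrier_mat n n"
  shows "mat_trace (A * B) = (\<Sum>k<n. \<Sum>l<n. A $$ (l, k) * B $$ (k, l))"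
proof -
  have "mat_trace (A * B) = (\<Sum>l<n. \<Sum>k<n. A $$ (l, k) * B $$ (k, l))"
    using assms by (auto simp: mat_trace_def mat_mult_entry[OF assms] simp del: index_mult_mat(1) intro!: sum.cong)
  then show ?thesis by (subst sum.swap)
qed

lemma deflated_transfer_mult_vec:
  assumes V: "V \<in> carrier_mat b (d * b)" and \<rho>: "\<rho> \<in> carrier_mat b b" and B: "B \<in> carrier_mat b b"
    and pq: "p < b" "q < b"
  shows "(deflated_transfer d b V \<rho> *\<^sub>v mat_to_vec b B) $ (p * b + q)
    = fcs_transfer d V B $$ (p, q) - of_bool (p = q) * mat_trace (\<rho> * B)"
proof -
  have "(deflated_transfer d b V \<rho> *\<^sub>v mat_to_vec b B) $ (p * b + q)
     = (\<Sum>k<b. \<Sum>l<b. ((\<Sum>s<d. V $$ (p, s * b + k) * cnj (V $$ (q, s * b + l)))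
       - of_bool (p = q) * \<rho> $$ (l, k)) * B $$ (k, l))"
    using pq lessThan_times_index[OF pq]
    by (simp add: deflated_transfer_def mat_to_vec_def scalar_prod_def atLeast0LessThan sum_lessThan_times lessThan_times_index)
  also have "\<dots> = (\<Sum>k<b. \<Sum>l<b. \<Sum>s<d. V $$ (p, s * b + k) * B $$ (k, l) * cnj (V $$ (q, s * b + l)))
      - (\<Sum>k<b. \<Sum>l<b. of_bool (p = q) * (\<rho> $$ (l, k) * B $$ (k, l)))"
    unfolding sum_subtractf[symmetric]
    by (intro sum.cong refl) (simp add: algebra_simps sum_distrib_left)
  also have "(\<Sum>k<b. \<Sum>l<b. \<Sum>s<d. V $$ (p, s * b + k) * B $$ (k, l) * cnj (V $$ (q, s * b + l))) = fcs_transfer d V B $$ (p, q)"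
  proof -
    have "(\<Sum>k<b. \<Sum>l<b. \<Sum>s<d. V $$ (p, s * b + k) * B $$ (k, l) * cnj (V $$ (q, s * b + l)))
        = (\<Sum>k<b. \<Sum>s<d. \<Sum>l<b. V $$ (p, s * b + k) * B $$ (k, l) * cnj (V $$ (q, s * b + l)))"
      by (intro sum.cong refl sum.swap)
    also have "\<dots> = (\<Sum>s<d. \<Sum>k<b. \<Sum>l<b. V $$ (p, s * b + k) * B $$ (k, l) * cnj (V $$ (q, s * b + l)))"
      by (rule sum.swap)
    finally show ?thesis
      unfolding fcs_transfer_entry[OF V B pq] .
  qed
  also have "(\<Sum>k<b. \<Sum>l<b. of_bool (p = q) * (\<rho> $$ (l, k) * B $$ (k, l))) = of_bool (p = q) * mat_trace (\<rho> * B)"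
    by (simp add: mat_trace_mult[OF \<rho> B] sum_distrib_left)
  finally show ?thesis .
qed

lemma vec_eq_by_pairs:
  assumes "v \<in> carrier_vec (b * b)" "w \<in> carrier_vec (b * b)"
    and "\<And>p q. p < b \<Longrightarrow> q < b \<Longrightarrow> v $ (p * b + q) = w $ (p * b + q)"
  shows "v = w"
proof (rule eq_vecI)
  fix K assume "K < dim_vec w"
  then have K: "K < b * b" using assms by simp
  then have "0 < b" by (cases b) auto
  then have "v $ (K div b * b + K mod b) = w $ (K div b * b + K mod b)"
    using K by (intro assms(3)) (auto simp: less_mult_imp_div_less)
  then show "v $ K = w $ K" by simp
qed (use assms in auto)

lemma mat_to_vec_index: "p < b \<Longrightarrow> q < b \<Longrightarrow> mat_to_vec b B $ (p * b + q) = B $$ (p, q)"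
  by (simp add: mat_to_vec_def lessThan_times_index)

lemma pure_fcsD:
  assumes "pure_fcs d b V \<rho>"
  shows "1 \<le> d" "1 \<le> b" "V \<in> carrier_mat b (d * b)" "V * mat_adjoint V = 1\<^sub>m b"
    "density_mat b \<rho>" "\<rho> \<in> carrier_mat b b" "mat_trace \<rho> = 1" "invertible_mat \<rho>"
    "\<And>B. B \<in> carrier_mat b b \<Longrightarrow> mat_trace (\<rho> * fcs_transfer d V B) = mat_trace (\<rho> * B)"
  using assms by (auto simp: pure_fcs_def invariant_density_def density_mat_def)

text \<open>An eigenvector \<open>X\<close> satisfies: transfer of \<open>X\<close> equals
  \<open>z X + t 1\<close> with \<open>t = Tr (\<rho> X)\<close>. Pairing with the invariant
  \<open>\<rho>\<close> gives \<open>t = z t + t\<close>, so \<open>t = 0\<close> and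
  \<open>X\<close> is an eigenvector of the transfer map itself. Power-boundedness leaves only
  modulus 1, where \<open>X\<close> must be a multiple of the identity; as \<open>t = 0\<close>,
  that multiple is zero.\<close>

lemma deflated_transfer_eigenvalue_less_1:
  assumes fcs: "pure_fcs d b V \<rho>" and ev: "eigenvalue (deflated_transfer d b V \<rho>) z"
  shows "cmod z < 1"
proof (rule ccontr)
  assume "\<not> cmod z < 1"
  then have z: "1 \<le> cmod z" by simp
  note F = pure_fcsD[OF fcs]
  let ?M = "deflated_transfer d b V \<rho>"
  have Mc: "?M \<in> carrier_mat (b * b) (b * b)" by (simp add: deflated_transfer_def)
  obtain v where v: "v \<in> carrier_vec (b * b)" "v \<noteq> 0\<^sub>v (b * b)" "?M *\<^sub>v v = z \<cdot>\<^sub>v v"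
    using ev Mc by (auto simp: eigenvalue_def eigenvector_def)
  define X where "X = mat b b (\<lambda>(p, q). v $ (p * b + q))"
  have X: "X \<in> carrier_mat b b" by (simp add: X_def)
  have vX: "mat_to_vec b X = v"
    by (rule vec_eq_by_pairs[of _ b]) (use v in \<open>auto simp: mat_to_vec_index X_def, simp add: mat_to_vec_def\<close>)
  have X0: "X \<noteq> 0\<^sub>m b b"
  proof
    assume "X = 0\<^sub>m b b"
    then have "v = 0\<^sub>v (b * b)"
      using v by (intro vec_eq_by_pairs[of _ b]) (auto simp: mat_to_vec_index lessThan_times_index simp flip: vX)
    then show False using v by simp
  qed
  let ?t = "mat_trace (\<rho> * X)"
  have E: "fcs_transfer d V X $$ (p, q) = z * X $$ (p, q) + of_bool (p = q) * ?t" if pq: "p < b" "q < b" for p q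
  proof -
    have "(?M *\<^sub>v v) $ (p * b + q) = z * v $ (p * b + q)"
      using v lessThan_times_index[OF pq] by simp
    then show ?thesis
      using deflated_transfer_mult_vec[OF F(3,6) X pq] pq unfolding vX by (simp add: X_def algebra_simps)
  qed
  have EX: "fcs_transfer d V X \<in> carrier_mat b b" by (rule fcs_transfer_carrier[OF F(3) X])
  have "?t = mat_trace (\<rho> * fcs_transfer d V X)" using F(9)[OF X] by simp
  also have "\<dots> = (\<Sum>k<b. \<Sum>l<b. z * (\<rho> $$ (l, k) * X $$ (k, l)) + ?t * (of_bool (l = k) * \<rho> $$ (l, k)))"
    unfolding mat_trace_mult[OF F(6) EX] by (intro sum.cong refl) (simp add: E algebra_simps eq_commute)
  also have "\<dots> = z * ?t + ?t * (\<Sum>k<b. \<Sum>l<b. of_bool (l = k) * \<rho> $$ (l, k))"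
    unfolding sum.distrib sum_distrib_left[symmetric] by (simp only: mat_trace_mult[OF F(6) X])
  also have "(\<Sum>k<b. \<Sum>l<b. of_bool (l = k) * \<rho> $$ (l, k)) = (\<Sum>k<b. \<rho> $$ (k, k))"
    by (intro sum.cong refl sum_of_bool_mult) simp
  also have "\<dots> = 1" using F(6,7) by (simp add: mat_trace_def)
  finally have "z * ?t = 0" by simp
  then have t: "?t = 0" using z by auto
  have EzX: "fcs_transfer d V X = z \<cdot>\<^sub>m X"
    using X EX t by (intro eq_matI) (auto simp: E)
  have smult: "fcs_transfer d V (c \<cdot>\<^sub>m X) = c \<cdot>\<^sub>m fcs_transfer d V X" for c
  proof (rule eq_matI)
    fix p q assume "p < dim_row (c \<cdot>\<^sub>m fcs_transfer d V X)" "q < dim_col (c \<cdot>\<^sub>m fcs_transfer d V X)"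
    then have pq: "p < b" "q < b" using EX by auto
    have cX: "c \<cdot>\<^sub>m X \<in> carrier_mat b b" using X by simp
    show "fcs_transfer d V (c \<cdot>\<^sub>m X) $$ (p, q) = (c \<cdot>\<^sub>m fcs_transfer d V X) $$ (p, q)"
      using pq EX X by (simp add: fcs_transfer_entry[OF F(3) cX pq] fcs_transfer_entry[OF F(3) X pq] sum_distrib_left mult_ac)
  qed (use EX fcs_transfer_carrier[OF F(3), of "c \<cdot>\<^sub>m X"] X in auto)
  have pow: "(fcs_transfer d V ^^ m) X = z ^ m \<cdot>\<^sub>m X" for m
    by (induction m) (auto simp: smult EzX mult.commute intro!: eq_matI)
  have "\<exists>p<b. \<exists>q<b. X $$ (p, q) \<noteq> 0"
  proof (rule ccontr)
    assume "\<not> ?thesis"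
    then have "X = 0\<^sub>m b b" using X by (intro eq_matI) auto
    then show False using X0 by simp
  qed
  then obtain p q where pq: "p < b" "q < b" "X $$ (p, q) \<noteq> 0" by blast
  define \<beta> where "\<beta> = (\<Sum>k<b. \<Sum>l<b. cmod (X $$ (k, l)))"
  have \<beta>: "cmod (X $$ (k, l)) \<le> \<beta>" if "k < b" "l < b" for k l
  proof -
    have "cmod (X $$ (k, l)) \<le> (\<Sum>l<b. cmod (X $$ (k, l)))"
      using that by (intro member_le_sum) auto
    also have "\<dots> \<le> \<beta>"
      unfolding \<beta>_def using that
      by (intro member_le_sum[where f = "\<lambda>k. \<Sum>l<b. cmod (X $$ (k, l))"] ballI sum_nonneg) auto
    finally show ?thesis .
  qed
  have bnd: "cmod z ^ m * cmod (X $$ (p, q)) \<le> \<beta> * real b" for m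
    using fcs_transfer_funpow_bound[OF F(3,4) X \<beta> pq(1,2), of m] pq X by (simp add: pow norm_mult norm_power)
  have "cmod z = 1"
  proof (rule ccontr)
    assume "cmod z \<noteq> 1"
    then have "1 < cmod z" using z by simp
    then obtain m where "\<beta> * real b / cmod (X $$ (p, q)) < cmod z ^ m"
      using real_arch_pow by blast
    then show False using bnd[of m] pq(3) by (simp add: field_simps)
  qed
  then obtain c where c: "X = c \<cdot>\<^sub>m 1\<^sub>m b"
    using fcs X X0 EzX unfolding pure_fcs_def by blast
  have "?t = (\<Sum>k<b. \<Sum>l<b. of_bool (l = k) * (c * \<rho> $$ (l, k)))"
    unfolding mat_trace_mult[OF F(6) X] by (intro sum.cong refl) (auto simp: c)
  also have "\<dots> = (\<Sum>k<b. c * \<rho> $$ (k, k))"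
    by (intro sum.cong refl sum_of_bool_mult) simp
  also have "\<dots> = c" using F(6,7) by (simp add: mat_trace_def flip: sum_distrib_left)
  finally have "c = 0" using t by simp
  then show False using c X0 by auto
qed

text \<open>A rate strictly above the spectral radius absorbs the polynomial growth caused by Jordan
  blocks. The rate is common to all \<open>B\<close>; only the constant depends on
  \<open>B\<close>.\<close>

lemma fcs_transfer_funpow_decay:
  assumes fcs: "pure_fcs d b V \<rho>"
  obtains \<mu> where "0 < \<mu>" "\<mu> < 1"
    "\<And>B. B \<in> carrier_mat b b \<Longrightarrow> \<exists>c\<ge>0. \<forall>m. \<forall>p<b. \<forall>q<b.
      cmod ((fcs_transfer d V ^^ m) B $$ (p, q) - of_bool (p = q) * mat_trace (\<rho> * B)) \<le> c * \<mu> ^ m"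
proof -
  note F = pure_fcsD[OF fcs]
  let ?M = "deflated_transfer d b V \<rho>"
  let ?n = "b * b"
  have Mc: "?M \<in> carrier_mat ?n ?n" by (simp add: deflated_transfer_def)
  have n: "0 < ?n" using F(2) by simp
  define \<sigma> where "\<sigma> = spectral_radius ?M"
  have sr: "\<sigma> \<in> norm ` spectrum ?M" and sr_max: "\<And>a. a \<in> norm ` spectrum ?M \<Longrightarrow> a \<le> \<sigma>"
    unfolding \<sigma>_def using spectral_radius_mem_max[OF Mc n] by auto
  have \<sigma>: "0 \<le> \<sigma>" "\<sigma> < 1"
    using sr deflated_transfer_eigenvalue_less_1[OF fcs] by (auto simp: spectrum_def)
  \<comment> \<open>The midpoint leaves room above \<open>\<sigma>\<close>, stays below 1, and is
    positive even if \<open>\<sigma> = 0\<close>.\<close>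
  define \<mu> where "\<mu> = (1 + \<sigma>) / 2"
  have \<mu>: "0 < \<mu>" "\<mu> < 1" "\<sigma> < \<mu>" using \<sigma> by (auto simp: \<mu>_def)
  define N where "N = complex_of_real (1 / \<mu>) \<cdot>\<^sub>m ?M"
  have Nc: "N \<in> carrier_mat ?n ?n" using Mc by (simp add: N_def)
  have srN: "spectral_radius N < 1"
  proof -
    obtain z where z: "eigenvalue N z" "spectral_radius N = cmod z"
      using spectral_radius_mem_max(1)[OF Nc n] by (auto simp: spectrum_def)
    then obtain v where v: "v \<in> carrier_vec ?n" "v \<noteq> 0\<^sub>v ?n" "N *\<^sub>v v = z \<cdot>\<^sub>v v"
      using Nc by (auto simp: eigenvalue_def eigenvector_def)
    have "?M *\<^sub>v v = complex_of_real \<mu> \<cdot>\<^sub>v (N *\<^sub>v v)"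
    proof -
      have "N *\<^sub>v v = complex_of_real (1 / \<mu>) \<cdot>\<^sub>v (?M *\<^sub>v v)"
        unfolding N_def using v Mc by (intro smult_mat_mult_vec) 
      then show ?thesis using \<mu> by (simp add: smult_smult_assoc flip: of_real_mult)
    qed
    also have "\<dots> = (complex_of_real \<mu> * z) \<cdot>\<^sub>v v"
      by (simp add: v smult_smult_assoc)
    finally have "eigenvalue ?M (complex_of_real \<mu> * z)"
      using v Mc by (auto simp: eigenvalue_def eigenvector_def)
    then have "cmod (complex_of_real \<mu> * z) \<le> \<sigma>"
      by (intro sr_max imageI) (simp add: spectrum_def)
    then have "\<mu> * cmod z \<le> \<sigma>"
      using \<mu> by (simp add: norm_mult)
    then have "\<mu> * cmod z < \<mu>" using \<mu> by linarith
    then show ?thesis using \<mu> z by simp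
  qed
  from spectral_radius_jnf_norm_bound_less_1_upper_triangular[OF Nc srN]
  obtain c0 where c0: "\<And>k. norm_bound (N ^\<^sub>m k) c0" by auto
  \<comment> \<open>On matrices with \<open>Tr (\<rho> X) = 0\<close> the deflated map agrees with
    the transfer map, and invariance of \<open>\<rho>\<close> keeps all iterates in this
    subspace.\<close>
  have NX: "N ^\<^sub>m k *\<^sub>v mat_to_vec b X = complex_of_real (1 / \<mu>) ^ k \<cdot>\<^sub>v mat_to_vec b ((fcs_transfer d V ^^ k) X)"
    if "X \<in> carrier_mat b b" "mat_trace (\<rho> * X) = 0" for k X
    using that
  proof (induction k arbitrary: X)
    case 0
    then show ?case using Nc by (simp add: mat_to_vec_def)
  next
    case (Suc k)
    let ?E = "fcs_transfer d V X"
    have EX: "?E \<in> carrier_mat b b" by (rule fcs_transfer_carrier[OF F(3) Suc.prems(1)])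
    have cv: "mat_to_vec b Y \<in> carrier_vec ?n" for Y by (simp add: mat_to_vec_def)
    have Nk: "N ^\<^sub>m k \<in> carrier_mat ?n ?n" using Nc by simp
    have "?M *\<^sub>v mat_to_vec b X = mat_to_vec b ?E"
      by (rule vec_eq_by_pairs[of _ b])
        (use Mc cv in \<open>auto simp: deflated_transfer_mult_vec[OF F(3,6) Suc.prems(1)] Suc.prems(2) mat_to_vec_index\<close>)
    then have "N *\<^sub>v mat_to_vec b X = complex_of_real (1 / \<mu>) \<cdot>\<^sub>v mat_to_vec b ?E"
      unfolding N_def using smult_mat_mult_vec[OF Mc cv] by simp
    then have "N ^\<^sub>m Suc k *\<^sub>v mat_to_vec b X = N ^\<^sub>m k *\<^sub>v (complex_of_real (1 / \<mu>) \<cdot>\<^sub>v mat_to_vec b ?E)"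
      using assoc_mult_mat_vec[OF Nk Nc cv] by simp
    also have "\<dots> = complex_of_real (1 / \<mu>) \<cdot>\<^sub>v (N ^\<^sub>m k *\<^sub>v mat_to_vec b ?E)"
      by (rule mult_mat_vec[OF Nk cv])
    also have "\<dots> = complex_of_real (1 / \<mu>) \<cdot>\<^sub>v (complex_of_real (1 / \<mu>) ^ k \<cdot>\<^sub>v mat_to_vec b ((fcs_transfer d V ^^ Suc k) X))"
      using Suc.IH[OF EX] F(9)[OF Suc.prems(1)] Suc.prems(2) by (simp add: funpow_swap1)
    finally show ?case by (simp only: smult_smult_assoc power_Suc)
  qed
  have "\<exists>c\<ge>0. \<forall>m. \<forall>p<b. \<forall>q<b.
      cmod ((fcs_transfer d V ^^ m) B $$ (p, q) - of_bool (p = q) * mat_trace (\<rho> * B)) \<le> c * \<mu> ^ m"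
    if B: "B \<in> carrier_mat b b" for B
  proof -
    let ?t = "mat_trace (\<rho> * B)"
    \<comment> \<open>Subtracting \<open>Tr (\<rho> B)\<close> times the identity lands in that
      subspace. The transfer map fixes the identity, so the iterates of \<open>X\<close> are
      precisely the deviations to be bounded.\<close>
    define X where "X = mat b b (\<lambda>(p, q). B $$ (p, q) - of_bool (p = q) * ?t)"
    have X: "X \<in> carrier_mat b b" by (simp add: X_def)
    have "mat_trace (\<rho> * X) = (\<Sum>k<b. \<Sum>l<b. \<rho> $$ (l, k) * B $$ (k, l) - of_bool (l = k) * (\<rho> $$ (l, k) * ?t))"
      unfolding mat_trace_mult[OF F(6) X] by (intro sum.cong refl) (auto simp: X_def algebra_simps)
    also have "\<dots> = ?t - (\<Sum>k<b. \<Sum>l<b. of_bool (l = k) * (\<rho> $$ (l, k) * ?t))"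
      by (simp only: sum_subtractf mat_trace_mult[OF F(6) B])
    also have "(\<Sum>k<b. \<Sum>l<b. of_bool (l = k) * (\<rho> $$ (l, k) * ?t)) = (\<Sum>k<b. \<rho> $$ (k, k) * ?t)"
      by (intro sum.cong refl sum_of_bool_mult) simp
    also have "\<dots> = ?t" using F(6,7) by (simp add: mat_trace_def flip: sum_distrib_right)
    finally have tX: "mat_trace (\<rho> * X) = 0" by simp
    have EX: "(fcs_transfer d V ^^ m) X $$ (p, q) = (fcs_transfer d V ^^ m) B $$ (p, q) - of_bool (p = q) * ?t"
      if pq: "p < b" "q < b" for m p q
    proof -
      let ?c = "chain_amp d b V m"
      have "(fcs_transfer d V ^^ m) X $$ (p, q) = (\<Sum>J<d ^ m. \<Sum>k<b. \<Sum>l<b.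
          ?c p J k * B $$ (k, l) * cnj (?c q J l) - of_bool (l = k) * (?t * (?c p J k * cnj (?c q J l))))"
        unfolding chain_amp_transfer[OF F(3) X pq, symmetric]
        by (intro sum.cong refl) (auto simp: X_def algebra_simps)
      also have "\<dots> = (fcs_transfer d V ^^ m) B $$ (p, q)
          - (\<Sum>J<d ^ m. \<Sum>k<b. \<Sum>l<b. of_bool (l = k) * (?t * (?c p J k * cnj (?c q J l))))"
        by (simp only: sum_subtractf chain_amp_transfer[OF F(3) B pq])
      also have "(\<Sum>J<d ^ m. \<Sum>k<b. \<Sum>l<b. of_bool (l = k) * (?t * (?c p J k * cnj (?c q J l))))
          = (\<Sum>J<d ^ m. \<Sum>k<b. ?t * (?c p J k * cnj (?c q J k)))"
        by (intro sum.cong refl sum_of_bool_mult) simp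
      also have "\<dots> = of_bool (p = q) * ?t"
        using chain_amp_orthonormal[OF F(3,4) pq, of m] by (simp add: mult.commute flip: sum_distrib_left)
      finally show ?thesis .
    qed
    define c where "c = (\<Sum>K<?n. \<bar>c0\<bar> * cmod (mat_to_vec b X $ K))"
    have "cmod ((fcs_transfer d V ^^ m) B $$ (p, q) - of_bool (p = q) * ?t) \<le> c * \<mu> ^ m"
      if pq: "p < b" "q < b" for m p q
    proof -
      let ?P = "p * b + q"
      have P: "?P < ?n" by (rule lessThan_times_index[OF pq])
      have Nm: "N ^\<^sub>m m \<in> carrier_mat ?n ?n" using Nc by simp
      have "complex_of_real (1 / \<mu>) ^ m * (fcs_transfer d V ^^ m) X $$ (p, q) = (N ^\<^sub>m m *\<^sub>v mat_to_vec b X) $ ?P"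
        unfolding NX[OF X tX] using P pq by (simp add: mat_to_vec_index, simp add: mat_to_vec_def)
      also have "\<dots> = (\<Sum>K<?n. (N ^\<^sub>m m) $$ (?P, K) * mat_to_vec b X $ K)"
        by (rule mat_mult_vec_entry[OF Nm _ P]) (simp add: mat_to_vec_def)
      finally have eq: "complex_of_real (1 / \<mu>) ^ m * (fcs_transfer d V ^^ m) X $$ (p, q)
        = (\<Sum>K<?n. (N ^\<^sub>m m) $$ (?P, K) * mat_to_vec b X $ K)" .
      have "(1 / \<mu>) ^ m * cmod ((fcs_transfer d V ^^ m) X $$ (p, q))
          = cmod (complex_of_real (1 / \<mu>) ^ m * (fcs_transfer d V ^^ m) X $$ (p, q))"
        using \<mu> by (simp add: norm_mult norm_power norm_divide)
      also have "\<dots> \<le> (\<Sum>K<?n. cmod ((N ^\<^sub>m m) $$ (?P, K) * mat_to_vec b X $ K))"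
        unfolding eq by (rule norm_sum)
      also have "\<dots> \<le> c"
        unfolding c_def
      proof (rule sum_mono)
        fix K assume "K \<in> {..<?n}"
        then have "cmod ((N ^\<^sub>m m) $$ (?P, K)) \<le> c0"
          using c0[of m] P unfolding norm_bound_def carrier_matD[OF Nm] by auto
        then show "cmod ((N ^\<^sub>m m) $$ (?P, K) * mat_to_vec b X $ K) \<le> \<bar>c0\<bar> * cmod (mat_to_vec b X $ K)"
          by (simp add: norm_mult mult_right_mono)
      qed
      finally have "(1 / \<mu>) ^ m * cmod ((fcs_transfer d V ^^ m) X $$ (p, q)) \<le> c" .
      then show ?thesis
        using \<mu> by (simp add: EX[OF pq] power_one_over field_simps)
    qed
    moreover have "0 \<le> c" unfolding c_def by (intro sum_nonneg) auto
    ultimately show ?thesis by (intro exI[of _ c]) simp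
  qed
  then show ?thesis by (rule that[OF \<mu>(1,2)])
qed

section \<open>Recovering the memory from the chain\<close>

text \<open>Each cross term is at most \<open>\<delta>\<close> times the mean of two squared
  amplitudes, and every index meets \<open>M\<close> partners; hence the loss
  \<open>real M * \<delta>\<close>.\<close>

lemma near_identity_form_lower_bound:
  fixes \<phi> :: "nat \<Rightarrow> complex"
  assumes G: "\<And>P Q. P < M \<Longrightarrow> Q < M \<Longrightarrow> cmod (G P Q - of_bool (P = Q)) \<le> \<delta>"
  shows "(1 - real M * \<delta>) * (\<Sum>P<M. (cmod (\<phi> P))\<^sup>2) \<le> Re (\<Sum>P<M. \<Sum>Q<M. cnj (\<phi> P) * G P Q * \<phi> Q)"
proof (cases "M = 0")
  case False
  then have "cmod (G 0 0 - of_bool (0 = (0::nat))) \<le> \<delta>" by (intro G) auto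
  then have \<delta>: "0 \<le> \<delta>" using norm_ge_zero order_trans by blast
  let ?H = "\<lambda>P Q. G P Q - of_bool (P = Q)"
  let ?n = "\<Sum>P<M. (cmod (\<phi> P))\<^sup>2"
  have "(\<Sum>P<M. \<Sum>Q<M. cnj (\<phi> P) * G P Q * \<phi> Q)
      = (\<Sum>P<M. \<Sum>Q<M. of_bool (Q = P) * (cnj (\<phi> P) * \<phi> Q)) + (\<Sum>P<M. \<Sum>Q<M. cnj (\<phi> P) * ?H P Q * \<phi> Q)"
    unfolding sum.distrib[symmetric] by (intro sum.cong refl) (auto simp: algebra_simps)
  also have "(\<Sum>P<M. \<Sum>Q<M. of_bool (Q = P) * (cnj (\<phi> P) * \<phi> Q)) = (\<Sum>P<M. cnj (\<phi> P) * \<phi> P)"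
    by (intro sum.cong refl sum_of_bool_mult) simp
  also have "\<dots> = complex_of_real ?n"
    by (simp add: complex_norm_square mult.commute del: of_real_power)
  finally have eq: "(\<Sum>P<M. \<Sum>Q<M. cnj (\<phi> P) * G P Q * \<phi> Q)
      = complex_of_real ?n + (\<Sum>P<M. \<Sum>Q<M. cnj (\<phi> P) * ?H P Q * \<phi> Q)" .
  have "cmod (\<Sum>P<M. \<Sum>Q<M. cnj (\<phi> P) * ?H P Q * \<phi> Q) \<le> (\<Sum>P<M. \<Sum>Q<M. cmod (cnj (\<phi> P) * ?H P Q * \<phi> Q))"
    by (intro order_trans[OF norm_sum] sum_mono order_refl)
  also have "\<dots> \<le> (\<Sum>P<M. \<Sum>Q<M. \<delta> / 2 * (cmod (\<phi> P))\<^sup>2 + \<delta> / 2 * (cmod (\<phi> Q))\<^sup>2)"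
  proof (intro sum_mono)
    fix P Q assume "P \<in> {..<M}" "Q \<in> {..<M}"
    then have H: "cmod (?H P Q) \<le> \<delta>" by (intro G) auto
    have am: "x * y \<le> (x\<^sup>2 + y\<^sup>2) / 2" for x y :: real
      using sum_squares_bound[of x y] by simp
    have "cmod (cnj (\<phi> P) * ?H P Q * \<phi> Q) = cmod (?H P Q) * (cmod (\<phi> P) * cmod (\<phi> Q))"
      by (simp add: norm_mult)
    also have "\<dots> \<le> \<delta> * (((cmod (\<phi> P))\<^sup>2 + (cmod (\<phi> Q))\<^sup>2) / 2)"
      using H \<delta> by (intro mult_mono am) auto
    finally show "cmod (cnj (\<phi> P) * ?H P Q * \<phi> Q) \<le> \<delta> / 2 * (cmod (\<phi> P))\<^sup>2 + \<delta> / 2 * (cmod (\<phi> Q))\<^sup>2"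
      by (simp add: field_simps)
  qed
  also have "\<dots> = real M * \<delta> * ?n"
    by (simp add: sum.distrib flip: sum_distrib_left sum_divide_distrib)
  finally have "- (real M * \<delta> * ?n) \<le> Re (\<Sum>P<M. \<Sum>Q<M. cnj (\<phi> P) * ?H P Q * \<phi> Q)"
    using abs_Re_le_cmod[of "\<Sum>P<M. \<Sum>Q<M. cnj (\<phi> P) * ?H P Q * \<phi> Q"] by linarith
  then show ?thesis unfolding eq by (simp add: algebra_simps)
qed simp

text \<open>
  A map \<open>T\<close> whose Gram matrix \<open>G = T T\<^sup>*\<close> is close to the identity has the left inverse \<open>G\<^sup>-\<^sup>1 T\<close> of
  \<open>T\<^sup>*\<close>. It is almost contractive: \<open>\<phi> = G\<^sup>-\<^sup>1 T v\<close> satisfies \<open>\<langle>\<phi>, G \<phi>\<rangle> = \<langle>T\<^sup>* \<phi>, v\<rangle>\<close>, while \<open>\<langle>\<phi>, G \<phi>\<rangle>\<close> is the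
  squared norm of \<open>T\<^sup>* \<phi>\<close>.
\<close>

lemma almost_isometry_left_inverse:
  fixes T :: "nat \<Rightarrow> nat \<Rightarrow> complex"
  assumes G: "\<And>P Q. P < M \<Longrightarrow> Q < M \<Longrightarrow> cmod ((\<Sum>I<D. T P I * cnj (T Q I)) - of_bool (P = Q)) \<le> \<delta>"
    and \<delta>: "real M * \<delta> < 1"
  obtains R where "\<forall>P<M. \<forall>Q<M. (\<Sum>I<D. R P I * cnj (T Q I)) = of_bool (P = Q)"
    "\<forall>v. (\<Sum>P<M. (cmod (\<Sum>I<D. R P I * v I))\<^sup>2) \<le> 1 / (1 - real M * \<delta>) * (\<Sum>I<D. (cmod (v I))\<^sup>2)"
proof -
  define Tm where "Tm = mat M D (\<lambda>(P, I). T P I)"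
  have Tc: "Tm \<in> carrier_mat M D" by (simp add: Tm_def)
  define Gm where "Gm = Tm * mat_adjoint Tm"
  have Gc: "Gm \<in> carrier_mat M M"
    unfolding Gm_def by (rule mult_carrier_mat[OF Tc]) (use Tc in simp)
  have Ge: "Gm $$ (P, Q) = (\<Sum>I<D. T P I * cnj (T Q I))" if "P < M" "Q < M" for P Q
    unfolding Gm_def mat_mult_entry[OF Tc mat_adjoint_carrier[OF Tc] that]
    using that by (intro sum.cong refl) (simp add: mat_adjoint_entry[OF Tc], simp add: Tm_def)
  have lower: "(1 - real M * \<delta>) * (\<Sum>P<M. (cmod (\<phi> P))\<^sup>2) \<le> Re (\<Sum>P<M. \<Sum>Q<M. cnj (\<phi> P) * Gm $$ (P, Q) * \<phi> Q)" for \<phi>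
    by (rule near_identity_form_lower_bound) (simp add: Ge G)
  \<comment> \<open>A kernel vector would make the quadratic form of \<open>Gm\<close> vanish,
    against its strictly positive lower bound.\<close>
  have "det Gm \<noteq> 0"
  proof
    assume "det Gm = 0"
    then obtain w where w: "w \<in> carrier_vec M" "w \<noteq> 0\<^sub>v M" "Gm *\<^sub>v w = 0\<^sub>v M"
      using det_0_iff_vec_prod_zero[OF Gc] by auto
    have "(\<Sum>Q<M. Gm $$ (P, Q) * w $ Q) = 0" if "P < M" for P
      using mat_mult_vec_entry[OF Gc w(1) that] w(3) that by simp
    then have "(\<Sum>P<M. \<Sum>Q<M. cnj (w $ P) * Gm $$ (P, Q) * w $ Q) = 0"
      by (simp add: mult.assoc flip: sum_distrib_left)
    then have "(1 - real M * \<delta>) * (\<Sum>P<M. (cmod (w $ P))\<^sup>2) \<le> 0"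
      using lower[of "\<lambda>P. w $ P"] by simp
    then have "(\<Sum>P<M. (cmod (w $ P))\<^sup>2) \<le> 0"
      using \<delta> by (simp add: mult_le_0_iff)
    then have "(\<Sum>P<M. (cmod (w $ P))\<^sup>2) = 0"
      by (simp add: order_antisym sum_nonneg)
    then have "w $ P = 0" if "P < M" for P
      using that by (simp add: sum_nonneg_eq_0_iff)
    then have "w = 0\<^sub>v M" using w(1) by auto
    then show False using w by simp
  qed
  then have "Gm \<in> Units (ring_mat TYPE(complex) M ())"
    by (rule det_non_zero_imp_unit[OF Gc])
  then obtain Gi where Gi: "Gi \<in> carrier_mat M M" "Gi * Gm = 1\<^sub>m M" "Gm * Gi = 1\<^sub>m M"
    by (auto simp: Units_def ring_mat_def)
  define Rm where "Rm = Gi * Tm"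
  have Rc: "Rm \<in> carrier_mat M D" unfolding Rm_def using Gi(1) Tc by (rule mult_carrier_mat)
  have RT: "Rm * mat_adjoint Tm = 1\<^sub>m M"
    unfolding Rm_def using assoc_mult_mat[OF Gi(1) Tc mat_adjoint_carrier[OF Tc]] Gi(2) by (simp add: Gm_def)
  have GR: "Gm * Rm = Tm"
    unfolding Rm_def using assoc_mult_mat[OF Gc Gi(1) Tc] Gi(3) Tc by simp
  show ?thesis
  proof (rule that[of "\<lambda>P I. Rm $$ (P, I)"]; intro allI impI)
    fix P Q assume PQ: "P < M" "Q < M"
    have "(\<Sum>I<D. Rm $$ (P, I) * cnj (T Q I)) = (Rm * mat_adjoint Tm) $$ (P, Q)"
      unfolding mat_mult_entry[OF Rc mat_adjoint_carrier[OF Tc] PQ]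
      using PQ by (intro sum.cong refl) (simp add: mat_adjoint_entry[OF Tc], simp add: Tm_def)
    then show "(\<Sum>I<D. Rm $$ (P, I) * cnj (T Q I)) = of_bool (P = Q)"
      using PQ by (simp add: RT)
  next
    fix v :: "nat \<Rightarrow> complex"
    define \<phi> where "\<phi> P = (\<Sum>I<D. Rm $$ (P, I) * v I)" for P
    define w where "w I = (\<Sum>P<M. cnj (T P I) * \<phi> P)" for I
    let ?a = "\<Sum>P<M. \<Sum>Q<M. cnj (\<phi> P) * Gm $$ (P, Q) * \<phi> Q"
    have "?a = (\<Sum>P<M. \<Sum>Q<M. cnj (\<phi> P) * (\<Sum>I<D. T P I * cnj (T Q I)) * \<phi> Q)"
      by (intro sum.cong refl) (simp add: Ge)
    also have "\<dots> = (\<Sum>I<D. (\<Sum>P<M. cnj (\<phi> P) * T P I) * (\<Sum>Q<M. cnj (T Q I) * \<phi> Q))"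
      by (rule sum_bilinear[symmetric])
    also have "\<dots> = complex_of_real (\<Sum>I<D. (cmod (w I))\<^sup>2)"
      by (simp add: w_def complex_norm_square mult.commute del: of_real_power)
    finally have a1: "?a = complex_of_real (\<Sum>I<D. (cmod (w I))\<^sup>2)" .
    have "(\<Sum>Q<M. Gm $$ (P, Q) * \<phi> Q) = (\<Sum>I<D. T P I * v I)" if P: "P < M" for P
    proof -
      have "(\<Sum>Q<M. Gm $$ (P, Q) * \<phi> Q) = (\<Sum>I<D. (\<Sum>Q<M. Gm $$ (P, Q) * Rm $$ (Q, I)) * v I)"
        unfolding \<phi>_def sum_distrib_left sum_distrib_right by (subst sum.swap) (simp add: mult.assoc)
      also have "\<dots> = (\<Sum>I<D. (Gm * Rm) $$ (P, I) * v I)"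
        by (intro sum.cong refl) (simp add: mat_mult_entry[OF Gc Rc P] del: index_mult_mat)
      finally show ?thesis using P by (simp add: GR, simp add: Tm_def)
    qed
    then have "?a = (\<Sum>P<M. cnj (\<phi> P) * (\<Sum>I<D. T P I * v I))"
      by (simp add: mult.assoc flip: sum_distrib_left)
    also have "\<dots> = (\<Sum>I<D. cnj (w I) * v I)"
      unfolding w_def cnj_sum sum_distrib_left sum_distrib_right by (subst sum.swap) (simp add: mult_ac)
    finally have a2: "?a = (\<Sum>I<D. cnj (w I) * v I)" .
    have "Re ?a \<le> (\<Sum>I<D. cmod (cnj (w I) * v I))"
      unfolding a2 by (rule order_trans[OF complex_Re_le_cmod norm_sum])
    also have "\<dots> \<le> (\<Sum>I<D. ((cmod (w I))\<^sup>2 + (cmod (v I))\<^sup>2) / 2)"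
    proof (rule sum_mono)
      fix I show "cmod (cnj (w I) * v I) \<le> ((cmod (w I))\<^sup>2 + (cmod (v I))\<^sup>2) / 2"
        using sum_squares_bound[of "cmod (w I)" "cmod (v I)"] by (simp add: norm_mult)
    qed
    also have "\<dots> = ((\<Sum>I<D. (cmod (w I))\<^sup>2) + (\<Sum>I<D. (cmod (v I))\<^sup>2)) / 2"
      by (simp only: sum.distrib flip: sum_divide_distrib)
    \<comment> \<open>The norm of \<open>w\<close> is the form \<open>?a\<close> itself, so half of
      \<open>?a\<close> on the right is absorbed by the left, leaving constant 1 in front of the
      norm of \<open>v\<close>.\<close>
    also have "(\<Sum>I<D. (cmod (w I))\<^sup>2) = Re ?a" by (simp only: a1 Re_complex_of_real)
    finally have "Re ?a \<le> (\<Sum>I<D. (cmod (v I))\<^sup>2)" by simp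
    with lower[of \<phi>] have "(1 - real M * \<delta>) * (\<Sum>P<M. (cmod (\<phi> P))\<^sup>2) \<le> (\<Sum>I<D. (cmod (v I))\<^sup>2)" by linarith
    then show "(\<Sum>P<M. (cmod (\<Sum>I<D. Rm $$ (P, I) * v I))\<^sup>2) \<le> 1 / (1 - real M * \<delta>) * (\<Sum>I<D. (cmod (v I))\<^sup>2)"
      using \<delta> unfolding \<phi>_def by (simp add: field_simps)
  qed
qed

section \<open>Decompositions of the chain state and the lower bound\<close>

lemma pure_decomposition_trace:
  assumes "pure_decomposition n \<sigma> N p s"
  shows "mat_trace \<sigma> = 1"
proof -
  have ps: "\<And>k. k < N \<Longrightarrow> pure_state n (s k)" and p: "(\<Sum>k<N. p k) = 1"
    and \<sigma>: "\<sigma> = mat n n (\<lambda>(i, j). \<Sum>k<N. complex_of_real (p k) * s k $$ (i, j))"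
    using assms by (auto simp: pure_decomposition_def)
  have tr: "(\<Sum>i<n. s k $$ (i, i)) = 1" if k: "k < N" for k
  proof -
    obtain v where v: "s k = proj_mat n v" "(\<Sum>i<n. (cmod (v i))\<^sup>2) = 1"
      using pure_stateE[OF ps[OF k]] by blast
    have "(\<Sum>i<n. s k $$ (i, i)) = complex_of_real (\<Sum>i<n. (cmod (v i))\<^sup>2)"
      by (simp add: v(1) proj_mat_def complex_norm_square del: of_real_power)
    then show ?thesis using v(2) by simp
  qed
  have "mat_trace \<sigma> = (\<Sum>k<N. \<Sum>i<n. complex_of_real (p k) * s k $$ (i, i))"
    by (simp add: \<sigma> mat_trace_def) (rule sum.swap)
  also have "\<dots> = (\<Sum>k<N. complex_of_real (p k))"
    by (intro sum.cong refl) (simp add: tr flip: sum_distrib_left)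
  also have "\<dots> = 1" using p by (metis of_real_1 of_real_sum)
  finally show ?thesis .
qed

lemma chain_amp_orthonormal':
  assumes V: "V \<in> carrier_mat b (d * b)" "V * mat_adjoint V = 1\<^sub>m b" and pq: "p < b" "q < b"
  shows "(\<Sum>k<b. \<Sum>J<d ^ m. chain_amp d b V m p J k * cnj (chain_amp d b V m q J k)) = of_bool (p = q)"
  unfolding chain_amp_orthonormal[OF V pq, of m, symmetric] by (rule sum.swap)

lemma mat_trace_rho_chain:
  assumes fcs: "pure_fcs d b V \<rho>"
  shows "mat_trace (rho_chain d b V \<rho> (Suc m)) = 1"
proof -
  note F = pure_fcsD[OF fcs]
  obtain p s where "pure_decomposition (d * b) (rho_AB V \<rho>) b p s"
    using rho_AB_pure_decomposition[OF F(3-5)] by blast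
  then have tr: "mat_trace (rho_AB V \<rho>) = 1" by (rule pure_decomposition_trace)
  have tp: "(\<Sum>k<b. \<Sum>c<d ^ m. cnj (chain_amp d b V m e c k) * cnj (cnj (chain_amp d b V m e' c k))) = of_bool (e = e')"
    if "e < b" "e' < b" for e e'
    using chain_amp_orthonormal'[OF F(3,4) that(2,1), of m]
    by (simp only: complex_cnj_cnj mult.commute[of "cnj _"] eq_commute[of e e'])
  have "rho_chain d b V \<rho> (Suc m)
    = local_kraus d b (d ^ m) b (\<lambda>k J p. cnj (chain_amp d b V m p J k)) (rho_AB V \<rho>)"
    using F(1) by (intro rho_chain_eq_local_kraus[OF F(3,6)]) simp
  then show ?thesis
    using mat_trace_local_kraus[OF rho_AB_carrier[OF F(3,6)] tp] tr by (simp only:)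
qed

lemma chain_amp_adjoint_isometry:
  assumes fcs: "pure_fcs d b V \<rho>"
  shows "(\<Sum>k<b. \<Sum>J<d ^ m. (cmod (\<Sum>p<b. cnj (chain_amp d b V m p J k) * v p))\<^sup>2) = (\<Sum>p<b. (cmod (v p))\<^sup>2)"
proof -
  note F = pure_fcsD[OF fcs]
  let ?f = "\<lambda>a (k, J). chain_amp d b V m a J k"
  have "(\<Sum>t\<in>{..<b} \<times> {..<d ^ m}. ?f a t * cnj (?f c t)) = of_bool (a = c)" if "a < b" "c < b" for a c
    using chain_amp_orthonormal'[OF F(3,4) that, of m] by (simp add: sum.cartesian_product')
  from sum_cmod_isometry[where v = v, OF this] show ?thesis
    by (simp add: sum.cartesian_product')
qed

lemma entanglement_rho_chain_le:
  assumes fcs: "pure_fcs d b V \<rho>"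
  shows "entanglement_of_formation d (d ^ m) (rho_chain d b V \<rho> (Suc m)) \<le> entanglement_of_formation d b (rho_AB V \<rho>)"
proof -
  note F = pure_fcsD[OF fcs]
  have L: "rho_chain d b V \<rho> (Suc m)
    = local_kraus d b (d ^ m) b (\<lambda>k J p. cnj (chain_amp d b V m p J k)) (rho_AB V \<rho>)"
    using F(1) by (intro rho_chain_eq_local_kraus[OF F(3,6)]) simp
  obtain p s where dec: "pure_decomposition (d * b) (rho_AB V \<rho>) b p s"
    using rho_AB_pure_decomposition[OF F(3-5)] by blast
  have "entanglement_of_formation d (d ^ m) (rho_chain d b V \<rho> (Suc m)) \<le> 1 * entanglement_of_formation d b (rho_AB V \<rho>)"
    unfolding L
  proof (rule entanglement_of_formation_local_kraus_le[OF dec])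
    show "mat_trace (local_kraus d b (d ^ m) b (\<lambda>k J p. cnj (chain_amp d b V m p J k)) (rho_AB V \<rho>)) = 1"
      using mat_trace_rho_chain[OF fcs, of m] by (simp only: L)
  qed (simp_all add: chain_amp_adjoint_isometry[OF fcs])
  then show ?thesis by simp
qed

lemma rho_chain_pure_decomposition:
  assumes fcs: "pure_fcs d b V \<rho>"
  obtains N p s where "pure_decomposition (d * d ^ m) (rho_chain d b V \<rho> (Suc m)) N p s"
proof -
  note F = pure_fcsD[OF fcs]
  have L: "rho_chain d b V \<rho> (Suc m)
    = local_kraus d b (d ^ m) b (\<lambda>k J p. cnj (chain_amp d b V m p J k)) (rho_AB V \<rho>)"
    using F(1) by (intro rho_chain_eq_local_kraus[OF F(3,6)]) simp
  obtain p s where dec: "pure_decomposition (d * b) (rho_AB V \<rho>) b p s"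
    using rho_AB_pure_decomposition[OF F(3-5)] by blast
  have tr: "mat_trace (local_kraus d b (d ^ m) b (\<lambda>k J p. cnj (chain_amp d b V m p J k)) (rho_AB V \<rho>)) = 1"
    using mat_trace_rho_chain[OF fcs, of m] by (simp only: L)
  have bound: "(\<Sum>k<b. \<Sum>J<d ^ m. (cmod (\<Sum>p<b. cnj (chain_amp d b V m p J k) * v p))\<^sup>2) \<le> 1 * (\<Sum>p<b. (cmod (v p))\<^sup>2)" for v
    by (simp add: chain_amp_adjoint_isometry[OF fcs])
  show ?thesis
    using pure_decomposition_local_kraus[OF dec bound tr] that unfolding L by blast
qed

text \<open>A vanishing eigenvalue would put column \<open>k\<close> of \<open>U\<close> into the
  kernel of \<open>\<rho>\<close>. Positivity is what permits dividing by \<open>sqrt (r k)\<close>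
  in \<open>T\<close>.\<close>

lemma eigenvalue_pos_of_invertible:
  assumes U: "unitary_mat n U" and eq: "\<rho> = U * mat_diag n (\<lambda>i. complex_of_real (x i)) * mat_adjoint U"
    and inv: "invertible_mat \<rho>" and x: "0 \<le> x k" and k: "k < n"
  shows "0 < x k"
proof (rule ccontr)
  assume "\<not> 0 < x k"
  then have x0: "x k = 0" using x by simp
  note Uc = unitary_matD[OF U]
  have \<rho>: "\<rho> \<in> carrier_mat n n"
    unfolding eq using Uc(1,2) by (simp add: mult_carrier_mat[of _ n n _ n])
  obtain B where "B * \<rho> = 1\<^sub>m (dim_row B)" "\<rho> * B = 1\<^sub>m n"
    using inv \<rho> by (auto simp: invertible_mat_def inverts_mat_def)
  then have B: "B \<in> carrier_mat n n" "B * \<rho> = 1\<^sub>m n"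
    using \<rho> by (metis carrier_matI index_mult_mat(2,3) index_one_mat(2,3) carrier_matD)+
  have "\<rho> *\<^sub>v col U k = 0\<^sub>v n"
  proof (rule eq_vecI)
    fix i assume "i < dim_vec (0\<^sub>v n :: complex vec)"
    then have i: "i < n" by simp
    have "(\<rho> *\<^sub>v col U k) $ i = (\<Sum>a<n. \<rho> $$ (i, a) * U $$ (a, k))"
      using mat_mult_vec_entry[OF \<rho> _ i, of "col U k"] Uc(1) k by simp
    also have "\<dots> = (\<Sum>a<n. \<Sum>j<n. U $$ (i, j) * complex_of_real (x j) * (cnj (U $$ (a, j)) * U $$ (a, k)))"
      by (intro sum.cong refl) (simp add: eq diag_conj_entry[OF Uc(1) i] sum_distrib_right mult.assoc del: index_mult_mat(1))
    also have "\<dots> = (\<Sum>j<n. U $$ (i, j) * complex_of_real (x j) * (\<Sum>a<n. cnj (U $$ (a, j)) * U $$ (a, k)))"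
      unfolding sum_distrib_left by (rule sum.swap)
    also have "\<dots> = (\<Sum>j<n. of_bool (j = k) * (U $$ (i, j) * complex_of_real (x j)))"
      by (intro sum.cong refl) (simp add: Uc(3)[OF _ k])
    also have "\<dots> = 0" by (simp only: sum_of_bool_mult[OF k] x0) simp
    finally show "(\<rho> *\<^sub>v col U k) $ i = 0\<^sub>v n $ i" using i by simp
  qed (use \<rho> in simp)
  moreover have "B *\<^sub>v 0\<^sub>v n = 0\<^sub>v n"
    using B by (intro eq_vecI) (auto simp: scalar_prod_def)
  ultimately have "B *\<^sub>v (\<rho> *\<^sub>v col U k) = 0\<^sub>v n" by simp
  then have "col U k = 0\<^sub>v n"
    using assoc_mult_mat_vec[OF B(1) \<rho>, of "col U k"] B(2) Uc(1) k by simp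
  then have "U $$ (a, k) = 0" if "a < n" for a
    using that Uc(1) k by (metis index_col index_zero_vec(1) carrier_matD)
  then have "(\<Sum>a<n. cnj (U $$ (a, k)) * U $$ (a, k)) = 0" by simp
  then show False using Uc(3)[OF k k] by simp
qed

text \<open>
  \<open>T m\<close> arises from \<open>chain_amp\<close> by expanding its memory input in the eigenbasis of \<open>\<rho>\<close> and dividing
  by the square roots of the eigenvalues. Its Gram matrix consists of normalised matrix elements of the
  \<open>m\<close>-th power of the transfer map, which converge to those of \<open>B \<mapsto> Tr (\<rho> B) 1\<close>.
\<close>

lemma chain_almost_isometry:
  assumes fcs: "pure_fcs d b V \<rho>"
  obtains \<mu> c :: real and r :: "nat \<Rightarrow> real" and T :: "nat \<Rightarrow> nat \<Rightarrow> nat \<Rightarrow> complex"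
  where "0 < \<mu>" "\<mu> < 1" "0 \<le> c" "(\<Sum>k<b. r k) = 1"
    "\<forall>m. \<forall>P<b * b. \<forall>Q<b * b. cmod ((\<Sum>I<d ^ m. T m P I * cnj (T m Q I)) - of_bool (P = Q)) \<le> c * \<mu> ^ m"
    "\<forall>m I J. \<forall>p<b. \<forall>q<b. (\<Sum>k<b. complex_of_real (r k) * (cnj (T m (p * b + k) I) * T m (q * b + k) J))
      = (\<Sum>k<b. cnj (chain_amp d b V m p I k) * chain_amp d b V m q J k)"
proof -
  note F = pure_fcsD[OF fcs]
  obtain \<mu> where \<mu>: "0 < \<mu>" "\<mu> < 1" and decay: "\<And>B. B \<in> carrier_mat b b \<Longrightarrow> \<exists>c\<ge>0. \<forall>m. \<forall>p<b. \<forall>q<b.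
      cmod ((fcs_transfer d V ^^ m) B $$ (p, q) - of_bool (p = q) * mat_trace (\<rho> * B)) \<le> c * \<mu> ^ m"
    using fcs_transfer_funpow_decay[OF fcs] by blast
  obtain U r where U: "unitary_mat b U" and eq: "\<rho> = U * mat_diag b (\<lambda>i. complex_of_real (r i)) * mat_adjoint U"
    and r0: "\<And>i. i < b \<Longrightarrow> 0 \<le> r i" and r1: "(\<Sum>i<b. r i) = 1"
    using density_mat_diagonalize[OF F(5)] by blast
  note Uc = unitary_matD[OF U]
  have rpos: "0 < r k" if "k < b" for k
    by (rule eigenvalue_pos_of_invertible[OF U eq F(8) r0[OF that] that])
  \<comment> \<open>The matrix units of the eigenbasis: their limits under the transfer map vanish
    off the diagonal and equal \<open>r k\<close> on it.\<close>
  define B where "B k l = mat b b (\<lambda>(a, a'). U $$ (a, k) * cnj (U $$ (a', l)))" for k l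
  have Bc: "B k l \<in> carrier_mat b b" for k l by (simp add: B_def)
  have trB: "mat_trace (\<rho> * B k l) = of_bool (k = l) * complex_of_real (r k)" if kl: "k < b" "l < b" for k l
  proof -
    have "mat_trace (\<rho> * B k l) = (\<Sum>a<b. \<Sum>c<b. U $$ (a, k) * (\<Sum>j<b. cnj (U $$ (a, j)) * (complex_of_real (r j) * U $$ (c, j))) * cnj (U $$ (c, l)))"
      unfolding mat_trace_mult[OF F(6) Bc]
      by (intro sum.cong refl) (simp add: eq diag_conj_entry[OF Uc(1)] B_def mult_ac del: index_mult_mat(1))
    also have "\<dots> = (\<Sum>j<b. (\<Sum>a<b. U $$ (a, k) * cnj (U $$ (a, j))) * (\<Sum>c<b. (complex_of_real (r j) * U $$ (c, j)) * cnj (U $$ (c, l))))"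
      by (rule sum_bilinear[symmetric])
    also have "\<dots> = (\<Sum>j<b. of_bool (j = k) * (of_bool (l = j) * complex_of_real (r j)))"
    proof (intro sum.cong refl)
      fix j assume "j \<in> {..<b}"
      then have j: "j < b" by simp
      have "(\<Sum>a<b. U $$ (a, k) * cnj (U $$ (a, j))) = of_bool (j = k)"
        using Uc(3)[OF j kl(1)] by (simp add: mult.commute)
      moreover have "(\<Sum>c<b. (complex_of_real (r j) * U $$ (c, j)) * cnj (U $$ (c, l))) = complex_of_real (r j) * (\<Sum>c<b. cnj (U $$ (c, l)) * U $$ (c, j))"
        by (simp add: sum_distrib_left mult_ac)
      ultimately show "(\<Sum>a<b. U $$ (a, k) * cnj (U $$ (a, j))) * (\<Sum>c<b. (complex_of_real (r j) * U $$ (c, j)) * cnj (U $$ (c, l)))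
          = of_bool (j = k) * (of_bool (l = j) * complex_of_real (r j))"
        using Uc(3)[OF kl(2) j] by simp
    qed
    also have "\<dots> = of_bool (l = k) * complex_of_real (r k)" by (rule sum_of_bool_mult[OF kl(1)])
    finally show ?thesis by (simp only: eq_commute[of l k])
  qed
  have "\<forall>k l. \<exists>c\<ge>0. \<forall>m. \<forall>p<b. \<forall>q<b.
      cmod ((fcs_transfer d V ^^ m) (B k l) $$ (p, q) - of_bool (p = q) * mat_trace (\<rho> * B k l)) \<le> c * \<mu> ^ m"
    using decay[OF Bc] by simp
  then obtain c where "\<forall>k l. 0 \<le> c k l \<and> (\<forall>m. \<forall>p<b. \<forall>q<b.
      cmod ((fcs_transfer d V ^^ m) (B k l) $$ (p, q) - of_bool (p = q) * mat_trace (\<rho> * B k l)) \<le> c k l * \<mu> ^ m)"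
    unfolding choice_iff by auto
  then have c0: "\<And>k l. 0 \<le> c k l" and c: "\<And>k l m p q. p < b \<Longrightarrow> q < b \<Longrightarrow>
      cmod ((fcs_transfer d V ^^ m) (B k l) $$ (p, q) - of_bool (p = q) * mat_trace (\<rho> * B k l)) \<le> c k l * \<mu> ^ m"
    by auto
  \<comment> \<open>The denominators come from the normalisation of \<open>T\<close>; summing over
    all finitely many pairs makes the constant independent of \<open>k\<close> and
    \<open>l\<close>.\<close>
  define c' where "c' k l = c k l / (sqrt (r k) * sqrt (r l))" for k l
  have c'0: "0 \<le> c' k l" if "k < b" "l < b" for k l
    using c0 r0 that by (simp add: c'_def)
  define C where "C = (\<Sum>k<b. \<Sum>l<b. c' k l)"
  have c'C: "c' k l \<le> C" if "k < b" "l < b" for k l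
  proof -
    have "c' k l \<le> (\<Sum>l<b. c' k l)"
      using that c'0 by (intro member_le_sum) auto
    also have "\<dots> \<le> C"
      unfolding C_def using that c'0
      by (intro member_le_sum[where f = "\<lambda>k. \<Sum>l<b. c' k l"] ballI sum_nonneg) auto
    finally show ?thesis .
  qed
  have C0: "0 \<le> C" unfolding C_def using c'0 by (intro sum_nonneg) auto
  define T where "T m P I = (\<Sum>a<b. chain_amp d b V m (P div b) I a * U $$ (a, P mod b)) / complex_of_real (sqrt (r (P mod b)))"
    for m P I
  have gram: "cmod ((\<Sum>I<d ^ m. T m P I * cnj (T m Q I)) - of_bool (P = Q)) \<le> C * \<mu> ^ m"
    if PQ: "P < b * b" "Q < b * b" for m P Q
  proof -
    define p k q l where "p = P div b" and "k = P mod b" and "q = Q div b" and "l = Q mod b"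
    have pkql: "p < b" "k < b" "q < b" "l < b"
      using PQ F(2) by (auto simp: p_def k_def q_def l_def less_mult_imp_div_less)
    have PQ_iff: "P = Q \<longleftrightarrow> p = q \<and> k = l"
      unfolding p_def k_def q_def l_def by (metis div_mult_mod_eq)
    let ?E = "(fcs_transfer d V ^^ m) (B k l) $$ (p, q)"
    let ?s = "sqrt (r k) * sqrt (r l)"
    have s: "0 < ?s" using rpos pkql by simp
    have "T m P I * cnj (T m Q I) = (\<Sum>a<b. chain_amp d b V m p I a * U $$ (a, k))
        * (\<Sum>a<b. cnj (U $$ (a, l)) * cnj (chain_amp d b V m q I a)) / complex_of_real ?s" for I
      by (simp add: T_def p_def k_def q_def l_def mult.commute)
    then have "(\<Sum>I<d ^ m. T m P I * cnj (T m Q I)) = (\<Sum>I<d ^ m. (\<Sum>a<b. chain_amp d b V m p I a * U $$ (a, k))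
        * (\<Sum>a<b. cnj (U $$ (a, l)) * cnj (chain_amp d b V m q I a))) / complex_of_real ?s"
      by (simp only: sum_divide_distrib)
    also have "(\<Sum>I<d ^ m. (\<Sum>a<b. chain_amp d b V m p I a * U $$ (a, k))
        * (\<Sum>a<b. cnj (U $$ (a, l)) * cnj (chain_amp d b V m q I a)))
        = (\<Sum>I<d ^ m. \<Sum>a<b. \<Sum>a'<b. chain_amp d b V m p I a * B k l $$ (a, a') * cnj (chain_amp d b V m q I a'))"
      unfolding sum_product by (intro sum.cong refl) (simp add: B_def mult_ac)
    also have "\<dots> = ?E" by (rule chain_amp_transfer[OF F(3) Bc pkql(1,3)])
    finally have g: "(\<Sum>I<d ^ m. T m P I * cnj (T m Q I)) = ?E / complex_of_real ?s" .
    have "(of_bool (P = Q) :: complex) = of_bool (p = q) * mat_trace (\<rho> * B k l) / complex_of_real ?s"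
      using rpos[OF pkql(2)] pkql by (auto simp: PQ_iff trB simp flip: of_real_mult)
    then have "(\<Sum>I<d ^ m. T m P I * cnj (T m Q I)) - of_bool (P = Q)
        = (?E - of_bool (p = q) * mat_trace (\<rho> * B k l)) / complex_of_real ?s"
      unfolding g by (simp only: diff_divide_distrib)
    then have "cmod ((\<Sum>I<d ^ m. T m P I * cnj (T m Q I)) - of_bool (P = Q))
        = cmod (?E - of_bool (p = q) * mat_trace (\<rho> * B k l)) / ?s"
      using s r0 pkql by (simp add: norm_divide norm_mult)
    also have "\<dots> \<le> c k l * \<mu> ^ m / ?s"
      using c[OF pkql(1,3)] s by (intro divide_right_mono) auto
    also have "\<dots> = c' k l * \<mu> ^ m" by (simp add: c'_def)
    also have "\<dots> \<le> C * \<mu> ^ m" using c'C pkql \<mu> by (intro mult_right_mono) auto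
    finally show ?thesis .
  qed
  \<comment> \<open>The weight \<open>r k\<close> cancels the two square roots in \<open>T\<close>,
    and unitarity of \<open>U\<close> makes the sum over the memory input independent of the basis.
    No error term arises here.\<close>
  have weights: "(\<Sum>k<b. complex_of_real (r k) * (cnj (T m (p * b + k) I) * T m (q * b + k) J))
      = (\<Sum>k<b. cnj (chain_amp d b V m p I k) * chain_amp d b V m q J k)" if pq: "p < b" "q < b" for m p q I J
  proof -
    have "complex_of_real (r k) * (cnj (T m (p * b + k) I) * T m (q * b + k) J)
        = (\<Sum>a<b. cnj (chain_amp d b V m p I a) * cnj (U $$ (a, k))) * (\<Sum>a<b. U $$ (a, k) * chain_amp d b V m q J a)"
      if k: "k < b" for k
    proof -
      have "complex_of_real (sqrt (r k)) * complex_of_real (sqrt (r k)) = complex_of_real (r k)"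
        using r0[OF k] by (simp flip: of_real_mult)
      then show ?thesis
        using k rpos[OF k] by (simp add: T_def mult.commute field_simps)
    qed
    then have "(\<Sum>k<b. complex_of_real (r k) * (cnj (T m (p * b + k) I) * T m (q * b + k) J))
        = (\<Sum>k<b. (\<Sum>a<b. cnj (chain_amp d b V m p I a) * cnj (U $$ (a, k))) * (\<Sum>a<b. U $$ (a, k) * chain_amp d b V m q J a))"
      by (intro sum.cong refl) simp
    also have "\<dots> = (\<Sum>a<b. cnj (chain_amp d b V m p I a) * chain_amp d b V m q J a)"
    proof (rule sum_delta_bilinear)
      fix a a' assume "a < b" "a' < b"
      then show "(\<Sum>k<b. cnj (U $$ (a, k)) * U $$ (a', k)) = of_bool (a = a')"
        using Uc(4)[of a' a] by (simp only: mult.commute[of "cnj _"] eq_commute[of a a'])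
    qed
    finally show ?thesis .
  qed
  show ?thesis
    by (rule that[OF \<mu> C0 r1, of T]) (intro allI impI gram weights; assumption)+
qed

text \<open>The hypothesis on \<open>T\<close> factors the chain state exactly as
  \<open>T\<^sup>* (rho_AB \<otimes> diag r) T\<close>. A left inverse \<open>R\<close> of
  \<open>T\<^sup>*\<close> therefore restores \<open>rho_AB \<otimes> diag r\<close>, and summing
  over the Kraus index \<open>k\<close> traces out the auxiliary factor, whose weights add up to
  1.\<close>

lemma local_kraus_recovery:
  assumes V: "V \<in> carrier_mat b (d * b)" and \<rho>: "\<rho> \<in> carrier_mat b b" and d: "0 < d" and b: "0 < b"
    and r: "(\<Sum>k<b. r k) = (1::real)"
    and R: "\<And>P Q. P < b * b \<Longrightarrow> Q < b * b \<Longrightarrow> (\<Sum>I<d ^ m. R P I * cnj (T Q I)) = of_bool (P = Q)"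
    and T: "\<And>p q I J. p < b \<Longrightarrow> q < b \<Longrightarrow> (\<Sum>k<b. complex_of_real (r k) * (cnj (T (p * b + k) I) * T (q * b + k) J))
      = (\<Sum>k<b. cnj (chain_amp d b V m p I k) * chain_amp d b V m q J k)"
  shows "local_kraus d (d ^ m) b b (\<lambda>k p I. R (p * b + k) I) (rho_chain d b V \<rho> (Suc m)) = rho_AB V \<rho>"
proof -
  let ?\<sigma> = "rho_AB V \<rho>"
  let ?L = "local_kraus d (d ^ m) b b (\<lambda>k p I. R (p * b + k) I) (rho_chain d b V \<rho> (Suc m))"
  let ?S = "{..<b} \<times> {..<b} \<times> {..<b}"
  have \<sigma>c: "?\<sigma> \<in> carrier_mat (d * b) (d * b)" by (rule rho_AB_carrier[OF V \<rho>])
  have chain: "rho_chain d b V \<rho> (Suc m) $$ (i * d ^ m + I, j * d ^ m + J)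
      = (\<Sum>t\<in>?S. (case t of (p, q, l) \<Rightarrow> ?\<sigma> $$ (i * b + p, j * b + q) * complex_of_real (r l) * cnj (T (p * b + l) I))
        * (case t of (p, q, l) \<Rightarrow> T (q * b + l) J))"
    if "i < d" "j < d" "I < d ^ m" "J < d ^ m" for i j I J
  proof -
    have "rho_chain d b V \<rho> (Suc m) $$ (i * d ^ m + I, j * d ^ m + J)
        = (\<Sum>p<b. \<Sum>q<b. \<Sum>k<b. cnj (chain_amp d b V m p I k) * ?\<sigma> $$ (i * b + p, j * b + q) * chain_amp d b V m q J k)"
      unfolding rho_chain_entry[OF V \<rho> that] by (subst sum.swap, intro sum.cong refl sum.swap)
    also have "\<dots> = (\<Sum>p<b. \<Sum>q<b. ?\<sigma> $$ (i * b + p, j * b + q) *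
        (\<Sum>k<b. cnj (chain_amp d b V m p I k) * chain_amp d b V m q J k))"
      by (simp add: sum_distrib_left mult_ac)
    also have "\<dots> = (\<Sum>p<b. \<Sum>q<b. ?\<sigma> $$ (i * b + p, j * b + q) *
        (\<Sum>k<b. complex_of_real (r k) * (cnj (T (p * b + k) I) * T (q * b + k) J)))"
      by (intro sum.cong refl) (simp add: T)
    finally show ?thesis
      by (simp add: sum.cartesian_product' sum_distrib_left mult_ac)
  qed
  show ?thesis
  proof (rule eq_matI)
    fix I0 J0 assume "I0 < dim_row ?\<sigma>" "J0 < dim_col ?\<sigma>"
    then have IJ0: "I0 < d * b" "J0 < d * b" using \<sigma>c by auto
    define i p j q where "i = I0 div b" and "p = I0 mod b" and "j = J0 div b" and "q = J0 mod b"
    have ipjq: "i < d" "p < b" "j < d" "q < b"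
      using IJ0 b by (auto simp: i_def p_def j_def q_def less_mult_imp_div_less)
    have inner: "(\<Sum>I<d ^ m. \<Sum>J<d ^ m. R (p * b + k) I * rho_chain d b V \<rho> (Suc m) $$ (i * d ^ m + I, j * d ^ m + J) * cnj (R (q * b + k) J))
        = ?\<sigma> $$ (i * b + p, j * b + q) * complex_of_real (r k)" if k: "k < b" for k
    proof -
      define f where "f = (\<lambda>I (p, q, l). ?\<sigma> $$ (i * b + p, j * b + q) * complex_of_real (r l) * cnj (T (p * b + l) I))"
      define g where "g = (\<lambda>J (p :: nat, q, l). T (q * b + l) J)"
      have "(\<Sum>I<d ^ m. \<Sum>J<d ^ m. R (p * b + k) I * rho_chain d b V \<rho> (Suc m) $$ (i * d ^ m + I, j * d ^ m + J) * cnj (R (q * b + k) J))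
          = (\<Sum>I<d ^ m. \<Sum>J<d ^ m. R (p * b + k) I * (\<Sum>t\<in>?S. f I t * g J t) * cnj (R (q * b + k) J))"
        by (intro sum.cong refl) (simp only: chain[OF ipjq(1,3)] lessThan_iff f_def g_def)
      also have "\<dots> = (\<Sum>t\<in>?S. (\<Sum>I<d ^ m. R (p * b + k) I * f I t) * (\<Sum>J<d ^ m. g J t * cnj (R (q * b + k) J)))"
        by (rule sum_bilinear[symmetric])
      also have "\<dots> = (\<Sum>p'<b. \<Sum>q'<b. \<Sum>l<b. (\<Sum>I<d ^ m. R (p * b + k) I * f I (p', q', l)) * (\<Sum>J<d ^ m. g J (p', q', l) * cnj (R (q * b + k) J)))"
        by (simp add: sum.cartesian_product')
      also have "\<dots> = (\<Sum>p'<b. \<Sum>q'<b. \<Sum>l<b. of_bool (p' = p) * (of_bool (q' = q) * (of_bool (l = k) *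
          (?\<sigma> $$ (i * b + p', j * b + q') * complex_of_real (r l)))))"
      proof (intro sum.cong refl)
        fix p' q' l assume "p' \<in> {..<b}" "q' \<in> {..<b}" "l \<in> {..<b}"
        then have pql: "p' < b" "q' < b" "l < b" by auto
        have pair: "(x * b + k = y * b + l) \<longleftrightarrow> x = y \<and> k = l" for x y
          using k pql(3) by (metis add_right_cancel div_mult_self3 div_less add_0_right mod_mult_self3 mod_less b less_numeral_extra(3))
        have "(\<Sum>I<d ^ m. R (p * b + k) I * f I (p', q', l))
            = ?\<sigma> $$ (i * b + p', j * b + q') * complex_of_real (r l) * (\<Sum>I<d ^ m. R (p * b + k) I * cnj (T (p' * b + l) I))"
          by (simp add: f_def sum_distrib_left mult_ac)
        also have "(\<Sum>I<d ^ m. R (p * b + k) I * cnj (T (p' * b + l) I)) = of_bool (p = p' \<and> k = l)"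
          using R[OF lessThan_times_index[OF ipjq(2) k] lessThan_times_index[OF pql(1,3)]] by (simp only: pair)
        finally have 1: "(\<Sum>I<d ^ m. R (p * b + k) I * f I (p', q', l))
            = ?\<sigma> $$ (i * b + p', j * b + q') * complex_of_real (r l) * of_bool (p = p' \<and> k = l)" .
        have "(\<Sum>J<d ^ m. g J (p', q', l) * cnj (R (q * b + k) J)) = cnj (\<Sum>J<d ^ m. R (q * b + k) J * cnj (T (q' * b + l) J))"
          by (simp add: g_def mult.commute)
        also have "\<dots> = of_bool (q = q' \<and> k = l)"
          unfolding R[OF lessThan_times_index[OF ipjq(4) k] lessThan_times_index[OF pql(2,3)]] pair by simp
        finally have 2: "(\<Sum>J<d ^ m. g J (p', q', l) * cnj (R (q * b + k) J)) = of_bool (q = q' \<and> k = l)" .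
        show "(\<Sum>I<d ^ m. R (p * b + k) I * f I (p', q', l)) * (\<Sum>J<d ^ m. g J (p', q', l) * cnj (R (q * b + k) J))
            = of_bool (p' = p) * (of_bool (q' = q) * (of_bool (l = k) * (?\<sigma> $$ (i * b + p', j * b + q') * complex_of_real (r l))))"
          unfolding 1 2 by auto
      qed
      also have "\<dots> = (\<Sum>p'<b. of_bool (p' = p) * (\<Sum>q'<b. of_bool (q' = q) * (\<Sum>l<b. of_bool (l = k) *
          (?\<sigma> $$ (i * b + p', j * b + q') * complex_of_real (r l)))))"
        by (simp only: sum_distrib_left)
      also have "\<dots> = ?\<sigma> $$ (i * b + p, j * b + q) * complex_of_real (r k)"
        by (simp only: sum_of_bool_mult ipjq k)
      finally show ?thesis .
    qed
    have "?L $$ (I0, J0) = (\<Sum>k<b. \<Sum>I<d ^ m. \<Sum>J<d ^ m. R (p * b + k) I * rho_chain d b V \<rho> (Suc m) $$ (i * d ^ m + I, j * d ^ m + J) * cnj (R (q * b + k) J))"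
      using IJ0 by (simp add: local_kraus_def i_def p_def j_def q_def)
    also have "\<dots> = (\<Sum>k<b. ?\<sigma> $$ (i * b + p, j * b + q) * complex_of_real (r k))"
      by (intro sum.cong refl inner) simp
    also have "\<dots> = ?\<sigma> $$ (I0, J0)"
      using r by (simp add: i_def p_def j_def q_def flip: sum_distrib_left of_real_sum)
    finally show "?L $$ (I0, J0) = ?\<sigma> $$ (I0, J0)" .
  qed (use \<sigma>c in \<open>auto simp: local_kraus_def\<close>)
qed

theorem theorem3:
  fixes d b :: nat and V \<rho> :: "complex mat"
  assumes "pure_fcs d b V \<rho>"
  shows "\<exists>C \<mu> :: real. C > 0 \<and> 0 < \<mu> \<and> \<mu> < 1 \<and>
    (\<forall>n\<ge>1.
       0 \<le> entanglement_of_formation d b (rho_AB V \<rho>)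
             - entanglement_of_formation d (d ^ (n - 1)) (rho_chain d b V \<rho> n) \<and>
       entanglement_of_formation d b (rho_AB V \<rho>)
             - entanglement_of_formation d (d ^ (n - 1)) (rho_chain d b V \<rho> n) \<le> C * \<mu> ^ n)"
proof -
  note F = pure_fcsD[OF assms]
  let ?E = "entanglement_of_formation d b (rho_AB V \<rho>)"
  let ?En = "\<lambda>m. entanglement_of_formation d (d ^ m) (rho_chain d b V \<rho> (Suc m))"
  obtain \<mu> c r T where \<mu>: "0 < \<mu>" "\<mu> < 1" and c: "0 \<le> c" and r: "(\<Sum>k<b. r k) = (1::real)"
    and gram: "\<forall>m. \<forall>P<b * b. \<forall>Q<b * b. cmod ((\<Sum>I<d ^ m. T m P I * cnj (T m Q I)) - of_bool (P = Q)) \<le> c * \<mu> ^ m"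
    and weights: "\<forall>m I J. \<forall>p<b. \<forall>q<b. (\<Sum>k<b. complex_of_real (r k) * (cnj (T m (p * b + k) I) * T m (q * b + k) J))
      = (\<Sum>k<b. cnj (chain_amp d b V m p I k) * chain_amp d b V m q J k)"
    by (rule chain_almost_isometry[OF assms]) (rule that)
  obtain p s where dec: "pure_decomposition (d * b) (rho_AB V \<rho>) b p s"
    using rho_AB_pure_decomposition[OF F(3-5)] by blast
  have E0: "0 \<le> ?E" by (rule entanglement_of_formation_nonneg[OF dec])
  \<comment> \<open>With Gram error \<open>e\<close>, recovery gives
    \<open>(1 - e) E \<le> E\<^sub>n\<close>, that is, a difference of at most \<open>e E\<close>.
    If \<open>e\<close> is 1 or more the same bound follows from nonnegativity of the chain's
    entanglement, so short chains need no separate constant.\<close>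
  have upper: "?E - ?En m \<le> real (b * b) * (c * \<mu> ^ m) * ?E" for m
  proof (cases "real (b * b) * (c * \<mu> ^ m) < 1")
    case True
    let ?e = "real (b * b) * (c * \<mu> ^ m)"
    obtain N p s where dec_n: "pure_decomposition (d * d ^ m) (rho_chain d b V \<rho> (Suc m)) N p s"
      using rho_chain_pure_decomposition[OF assms] by blast
    have "cmod ((\<Sum>I<d ^ m. T m P I * cnj (T m Q I)) - of_bool (P = Q)) \<le> c * \<mu> ^ m" if "P < b * b" "Q < b * b" for P Q
      using gram that by simp
    from almost_isometry_left_inverse[OF this True]
    obtain R where R: "\<forall>P<b * b. \<forall>Q<b * b. (\<Sum>I<d ^ m. R P I * cnj (T m Q I)) = of_bool (P = Q)"
      and R_le: "\<forall>v. (\<Sum>P<b * b. (cmod (\<Sum>I<d ^ m. R P I * v I))\<^sup>2) \<le> 1 / (1 - ?e) * (\<Sum>I<d ^ m. (cmod (v I))\<^sup>2)"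
      by blast
    have L: "local_kraus d (d ^ m) b b (\<lambda>k p I. R (p * b + k) I) (rho_chain d b V \<rho> (Suc m)) = rho_AB V \<rho>"
      by (rule local_kraus_recovery[OF F(3,6) _ _ r, where T = "T m"]) (use F(1,2) R weights in auto)
    have "?E \<le> 1 / (1 - ?e) * ?En m"
      unfolding L[symmetric]
    proof (rule entanglement_of_formation_local_kraus_le[OF dec_n])
      show "0 < 1 / (1 - ?e)" using True by simp
      show "mat_trace (local_kraus d (d ^ m) b b (\<lambda>k p I. R (p * b + k) I) (rho_chain d b V \<rho> (Suc m))) = 1"
        unfolding L by (rule pure_decomposition_trace[OF dec])
      fix v
      \<comment> \<open>A row index \<open>P = p * b + k\<close> of \<open>R\<close> consists of the
        memory output \<open>p\<close> and the auxiliary index \<open>k\<close>; the Kraus sums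
        differ from the sum over \<open>P\<close> only in their order.\<close>
      have "(\<Sum>k<b. \<Sum>p<b. (cmod (\<Sum>I<d ^ m. R (p * b + k) I * v I))\<^sup>2) = (\<Sum>P<b * b. (cmod (\<Sum>I<d ^ m. R P I * v I))\<^sup>2)"
        unfolding sum_lessThan_times by (rule sum.swap)
      then show "(\<Sum>k<b. \<Sum>p<b. (cmod (\<Sum>I<d ^ m. R (p * b + k) I * v I))\<^sup>2) \<le> 1 / (1 - ?e) * (\<Sum>I<d ^ m. (cmod (v I))\<^sup>2)"
        using R_le by simp
    qed
    then have "(1 - ?e) * ?E \<le> (1 - ?e) * (1 / (1 - ?e) * ?En m)"
      using True by (intro mult_left_mono) auto
    also have "\<dots> = ?En m" using True by simp
    finally show ?thesis by (simp add: left_diff_distrib)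
  next
    case False
    obtain N p s where "pure_decomposition (d * d ^ m) (rho_chain d b V \<rho> (Suc m)) N p s"
      using rho_chain_pure_decomposition[OF assms] by blast
    then have "0 \<le> ?En m" by (rule entanglement_of_formation_nonneg)
    moreover have "1 * ?E \<le> real (b * b) * (c * \<mu> ^ m) * ?E"
      using False E0 by (intro mult_right_mono) auto
    ultimately show ?thesis by simp
  qed
  \<comment> \<open>The division by \<open>\<mu>\<close> compensates the shift
    \<open>n = Suc m\<close>, and the summand 1 keeps \<open>C\<close> positive when there is no
    entanglement at all.\<close>
  define C where "C = real (b * b) * c * ?E / \<mu> + 1"
  have "0 \<le> real (b * b) * c * ?E / \<mu>" using c E0 \<mu> by simp
  then have C: "0 < C" unfolding C_def by simp
  have "0 \<le> ?E - entanglement_of_formation d (d ^ (n - 1)) (rho_chain d b V \<rho> n) \<and>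
      ?E - entanglement_of_formation d (d ^ (n - 1)) (rho_chain d b V \<rho> n) \<le> C * \<mu> ^ n" if "1 \<le> n" for n
  proof -
    obtain m where n: "n = Suc m" using \<open>1 \<le> n\<close> by (cases n) auto
    have "real (b * b) * (c * \<mu> ^ m) * ?E = (C - 1) * \<mu> ^ n"
      using \<mu> by (simp add: C_def n)
    also have "\<dots> \<le> C * \<mu> ^ n" using \<mu> by (intro mult_right_mono) auto
    finally show ?thesis
      using upper[of m] entanglement_rho_chain_le[OF assms, of m] by (simp add: n)
  qed
  then show ?thesis using C \<mu> by blast
qed

end
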